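(* Let $G\subseteq \mathrm{Cl}_n$ be a set of Clifford unitaries and $p$ a probability distribution on $G$ such that the frame operator $S=\sum_{g\in G}p(g)\,\omega(g)^\dagger M\omega(g)$ is invertible. For every $g\in\mathrm{Cl}_n$ let $\Lambda(g)$ be a quantum channel (completely positive and trace preserving map) on $n$ qubits. Let $O$ be a Hermitian observable and $\rho$ an $n$-qubit quantum state, and let $\mathrm{bias}=\bigl|\mathrm{Tr}(O\rho)-(O|S^{-1}\tilde S|\rho)\bigr|$ with $\tilde S=\sum_{g\in G}p(g)\,\omega(g)^\dagger M\omega(g)\Lambda(g)$. Then $$\mathrm{bias}\le \lVert O\rVert_{\mathrm{st}}\max_{a\in\mathbb{F}_2^{2n}}\lVert \mathrm{id}-\bar\Lambda_a\rVert_\diamond\le \lVert O\rVert_{\mathrm{st}}\max_{g\in\mathrm{Cl}_n}\lVert \mathrm{id}-\Lambda(g)\rVert_\diamond .$$ If moreover every $\Lambda(g)$ is a Pauli channel, then $$\mathrm{bias}\le \min\{\lVert O\rVert_2,\lVert O\rVert_{\mathrm{st}}\}\max_{a\in\mathbb{F}_2^{2n}}|1-\bar\lambda_a| .$$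
   Context: Let $n\ge1$, $d=2^n$. For operators $A,B$ on $(\mathbb{C}^2)^{\otimes n}$, $(A|B)=\mathrm{Tr}(A^\dagger B)$, and $|A)(B|$ denotes the superoperator $C\mapsto (B|C)\,A$; $(A|\mathcal{X}|B)=\mathrm{Tr}(A^\dagger\mathcal{X}(B))$ for a superoperator $\mathcal X$. For a unitary $g$, $\omega(g)$ is the map $A\mapsto gAg^\dagger$ and $\omega(g)^\dagger$ its adjoint $A\mapsto g^\dagger A g$. $E_x=|x\rangle\langle x|$ for $x\in\mathbb{F}_2^n$ and $M=\sum_{x}|E_x)(E_x|$. Pauli operators: $\sigma_a=\sigma_{a_1}\otimes\cdots\otimes\sigma_{a_n}$ for $a=(a_1,\dots,a_n)\in(\mathbb{F}_2^2)^n\cong\mathbb{F}_2^{2n}$ with $\sigma_{00}=\mathbb 1,\sigma_{01}=X,\sigma_{11}=Y,\sigma_{10}=Z$. For $z\in\mathbb{F}_2^n$, $Z_z=\bigotimes_i Z^{z_i}$. $\mathrm{Cl}_n$ is the $n$-qubit Clifford group (generated by Hadamard, phase and CNOT gates). For $g\in\mathrm{Cl}_n$ and $z\in\mathbb{F}_2^n$, $\Xi_z(g)$ denotes the Pauli operator $\sigma_b$ such that $g^\dagger Z_z g=\pm\sigma_b$. Define $s_a=\sum_{z\in\mathbb{F}_2^n}\sum_{g\in G:\,\Xi_z(g)=\sigma_a}p(g)$ and the averaged channels $\bar\Lambda_a=s_a^{-1}\sum_{z\in\mathbb{F}_2^n}\sum_{g\in G:\,\Xi_z(g)=\sigma_a}p(g)\Lambda(g)$.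 A Pauli channel is a map $\Lambda(\rho)=\sum_b q_b\sigma_b\rho\sigma_b$ with $q$ a probability vector; it satisfies $\Lambda(\sigma_a)=\lambda_a\sigma_a$; if $\Lambda(g)$ has eigenvalues $\lambda_a(g)$, set $\bar\lambda_a=s_a^{-1}\sum_{z}\sum_{g\in G:\,\Xi_z(g)=\sigma_a}p(g)\lambda_a(g)$. Stabilizer norm: $\lVert O\rVert_{\mathrm{st}}=d^{-1}\sum_{a\in\mathbb{F}_2^{2n}}|(\sigma_a|O)|$. $\lVert O\rVert_2=\sqrt{(O|O)}$ is the Hilbert–Schmidt norm and $\lVert\cdot\rVert_\diamond$ the diamond norm. (The quantity $(O|S^{-1}\tilde S|\rho)$ is the expected value of the shadow estimator $\hat o(g,x)=(O|S^{-1}\omega(g)^\dagger|E_x)$ when $g\sim p$ is drawn, $\omega(g)\Lambda(g)$ is applied to $\rho$ and the computational basis is measured.) *)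

theory Defs
  imports "Jordan_Normal_Form.Char_Poly" "HOL-Computational_Algebra.Polynomial"
begin

type_synonym sop = "complex mat \<Rightarrow> complex mat"

definition adj :: "complex mat \<Rightarrow> complex mat" where
  "adj A = mat (dim_col A) (dim_row A) (\<lambda>(i,j). cnj (A $$ (j,i)))"

definition trace :: "complex mat \<Rightarrow> complex" where
  "trace A = (\<Sum>i<dim_row A. A $$ (i,i))"

definition hs_inner :: "complex mat \<Rightarrow> complex mat \<Rightarrow> complex" where
  "hs_inner A B = trace (adj A * B)"

definition msum :: "nat \<Rightarrow> ('i \<Rightarrow> complex mat) \<Rightarrow> 'i set \<Rightarrow> complex mat" where
  "msum d f I = mat d d (\<lambda>ij. \<Sum>i\<in>I. f i $$ ij)"

definition kron :: "complex mat \<Rightarrow> complex mat \<Rightarrow> complex mat" where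
  "kron A B = mat (dim_row A * dim_row B) (dim_col A * dim_col B)
     (\<lambda>(i,j). A $$ (i div dim_row B, j div dim_col B) * B $$ (i mod dim_row B, j mod dim_col B))"

fun kron_list :: "complex mat list \<Rightarrow> complex mat" where
  "kron_list [] = 1\<^sub>m 1"
| "kron_list (A # As) = kron A (kron_list As)"

definition Xm :: "complex mat" where "Xm = mat_of_rows_list 2 [[0,1],[1,0]]"
definition Ym :: "complex mat" where "Ym = mat_of_rows_list 2 [[0,-\<i>],[\<i>,0]]"
definition Zm :: "complex mat" where "Zm = mat_of_rows_list 2 [[1,0],[0,-1]]"
definition Hm :: "complex mat" where
  "Hm = mat_of_rows_list 2 [[1/sqrt 2, 1/sqrt 2],[1/sqrt 2, -1/sqrt 2]]"
definition Sm :: "complex mat" where "Sm = mat_of_rows_list 2 [[1,0],[0,\<i>]]"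
definition P0 :: "complex mat" where "P0 = mat_of_rows_list 2 [[1,0],[0,0]]"
definition P1 :: "complex mat" where "P1 = mat_of_rows_list 2 [[0,0],[0,1]]"

fun sigma1 :: "bool \<times> bool \<Rightarrow> complex mat" where
  "sigma1 (False, False) = 1\<^sub>m 2"
| "sigma1 (False, True) = Xm"
| "sigma1 (True, True) = Ym"
| "sigma1 (True, False) = Zm"

(* Pauli labels a \<in> (F_2^2)^n and bit strings z \<in> F_2^n *)
definition labels :: "nat \<Rightarrow> (bool \<times> bool) list set" where
  "labels n = {a. length a = n}"

definition bitstrings :: "nat \<Rightarrow> bool list set" where
  "bitstrings n = {z. length z = n}"

definition pauli :: "(bool \<times> bool) list \<Rightarrow> complex mat" where
  "pauli a = kron_list (map sigma1 a)"

definition Zz :: "bool list \<Rightarrow> complex mat" where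
  "Zz z = kron_list (map (\<lambda>b. if b then Zm else 1\<^sub>m 2) z)"

definition embed1 :: "nat \<Rightarrow> nat \<Rightarrow> complex mat \<Rightarrow> complex mat" where
  "embed1 n i U = kron_list (map (\<lambda>k. if k = i then U else 1\<^sub>m 2) [0..<n])"

definition cnot :: "nat \<Rightarrow> nat \<Rightarrow> nat \<Rightarrow> complex mat" where
  "cnot n c t = embed1 n c P0 +
     kron_list (map (\<lambda>k. if k = c then P1 else if k = t then Xm else 1\<^sub>m 2) [0..<n])"

(* the group generated by Hadamard, phase and CNOT gates (all generators have finite
   order, so the generated monoid is the generated group) *)
inductive_set clifford :: "nat \<Rightarrow> complex mat set" for n where
  cl_one: "1\<^sub>m (2^n) \<in> clifford n"
| cl_H: "i < n \<Longrightarrow> g \<in> clifford n \<Longrightarrow> embed1 n i Hm * g \<in> clifford n"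
| cl_S: "i < n \<Longrightarrow> g \<in> clifford n \<Longrightarrow> embed1 n i Sm * g \<in> clifford n"
| cl_CNOT: "c < n \<Longrightarrow> t < n \<Longrightarrow> c \<noteq> t \<Longrightarrow> g \<in> clifford n \<Longrightarrow> cnot n c t * g \<in> clifford n"

definition omega :: "complex mat \<Rightarrow> sop" where
  "omega g A = g * A * adj g"

definition omega_adj :: "complex mat \<Rightarrow> sop" where
  "omega_adj g A = adj g * A * g"

definition Ebas :: "nat \<Rightarrow> nat \<Rightarrow> complex mat" where
  "Ebas d x = mat d d (\<lambda>(i,j). if i = x \<and> j = x then 1 else 0)"

definition Mmap :: "nat \<Rightarrow> sop" where
  "Mmap d C = msum d (\<lambda>x. hs_inner (Ebas d x) C \<cdot>\<^sub>m Ebas d x) {..<d}"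

definition frameS :: "nat \<Rightarrow> complex mat set \<Rightarrow> (complex mat \<Rightarrow> real) \<Rightarrow> sop" where
  "frameS d G p C = msum d (\<lambda>g. complex_of_real (p g) \<cdot>\<^sub>m omega_adj g (Mmap d (omega g C))) G"

definition frameS_tilde :: "nat \<Rightarrow> complex mat set \<Rightarrow> (complex mat \<Rightarrow> real) \<Rightarrow> (complex mat \<Rightarrow> sop) \<Rightarrow> sop" where
  "frameS_tilde d G p \<Lambda> C =
     msum d (\<lambda>g. complex_of_real (p g) \<cdot>\<^sub>m omega_adj g (Mmap d (omega g (\<Lambda> g C)))) G"

definition hermitian :: "nat \<Rightarrow> complex mat \<Rightarrow> bool" where
  "hermitian d A \<longleftrightarrow> A \<in> carrier_mat d d \<and> adj A = A"

definition psd :: "nat \<Rightarrow> complex mat \<Rightarrow> bool" where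
  "psd d A \<longleftrightarrow> hermitian d A \<and>
     (\<forall>v :: nat \<Rightarrow> complex. 0 \<le> Re (\<Sum>i<d. \<Sum>j<d. cnj (v i) * A $$ (i,j) * v j))"

definition density :: "nat \<Rightarrow> complex mat \<Rightarrow> bool" where
  "density d \<rho> \<longleftrightarrow> psd d \<rho> \<and> trace \<rho> = 1"

(* block (b,e) w.r.t. the second (k-dimensional) tensor factor of X on C^d \<otimes> C^k *)
definition blk :: "nat \<Rightarrow> nat \<Rightarrow> complex mat \<Rightarrow> nat \<Rightarrow> nat \<Rightarrow> complex mat" where
  "blk d k X b e = mat d d (\<lambda>(a,c). X $$ (a * k + b, c * k + e))"

definition tensor_id :: "nat \<Rightarrow> nat \<Rightarrow> sop \<Rightarrow> sop" where
  "tensor_id d k \<Phi> X = mat (d * k) (d * k)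
     (\<lambda>(i,j). \<Phi> (blk d k X (i mod k) (j mod k)) $$ (i div k, j div k))"

definition linear_sop :: "nat \<Rightarrow> sop \<Rightarrow> bool" where
  "linear_sop d \<Phi> \<longleftrightarrow> (\<forall>A\<in>carrier_mat d d. \<Phi> A \<in> carrier_mat d d) \<and>
     (\<forall>A\<in>carrier_mat d d. \<forall>B\<in>carrier_mat d d. \<Phi> (A + B) = \<Phi> A + \<Phi> B) \<and>
     (\<forall>c. \<forall>A\<in>carrier_mat d d. \<Phi> (c \<cdot>\<^sub>m A) = c \<cdot>\<^sub>m \<Phi> A)"

definition completely_positive :: "nat \<Rightarrow> sop \<Rightarrow> bool" where
  "completely_positive d \<Phi> \<longleftrightarrow>
     (\<forall>k X. psd (d * k) X \<longrightarrow> psd (d * k) (tensor_id d k \<Phi> X))"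

definition trace_preserving :: "nat \<Rightarrow> sop \<Rightarrow> bool" where
  "trace_preserving d \<Phi> \<longleftrightarrow> (\<forall>A\<in>carrier_mat d d. trace (\<Phi> A) = trace A)"

definition quantum_channel :: "nat \<Rightarrow> sop \<Rightarrow> bool" where
  "quantum_channel d \<Phi> \<longleftrightarrow> linear_sop d \<Phi> \<and> completely_positive d \<Phi> \<and> trace_preserving d \<Phi>"

definition pauli_channel :: "nat \<Rightarrow> sop \<Rightarrow> bool" where
  "pauli_channel n \<Phi> \<longleftrightarrow> (\<exists>q :: (bool \<times> bool) list \<Rightarrow> real.
     (\<forall>b\<in>labels n. 0 \<le> q b) \<and> (\<Sum>b\<in>labels n. q b) = 1 \<and>
     (\<forall>A\<in>carrier_mat (2^n) (2^n).
        \<Phi> A = msum (2^n) (\<lambda>b. complex_of_real (q b) \<cdot>\<^sub>m (pauli b * A * pauli b)) (labels n)))"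

(* trace norm: sum of the singular values, i.e. of the square roots of the eigenvalues
   (with algebraic multiplicity) of X^dagger X *)
definition trace_norm :: "complex mat \<Rightarrow> real" where
  "trace_norm X = sum_mset (image_mset (\<lambda>\<mu>. sqrt (Re \<mu>)) (proots (char_poly (adj X * X))))"

definition diamond_norm :: "nat \<Rightarrow> sop \<Rightarrow> real" where
  "diamond_norm d \<Phi> = Sup {trace_norm (tensor_id d d \<Phi> X) | X.
      X \<in> carrier_mat (d * d) (d * d) \<and> trace_norm X \<le> 1}"

definition stab_norm :: "nat \<Rightarrow> complex mat \<Rightarrow> real" where
  "stab_norm n Obs = (1 / 2^n) * (\<Sum>a\<in>labels n. cmod (hs_inner (pauli a) Obs))"

definition hs_norm :: "complex mat \<Rightarrow> real" where
  "hs_norm Obs = sqrt (Re (hs_inner Obs Obs))"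

definition Xi :: "nat \<Rightarrow> bool list \<Rightarrow> complex mat \<Rightarrow> (bool \<times> bool) list" where
  "Xi n z g = (THE b. length b = n \<and>
      (adj g * Zz z * g = pauli b \<or> adj g * Zz z * g = - pauli b))"

definition s_weight :: "nat \<Rightarrow> complex mat set \<Rightarrow> (complex mat \<Rightarrow> real) \<Rightarrow> (bool \<times> bool) list \<Rightarrow> real" where
  "s_weight n G p a = (\<Sum>z\<in>bitstrings n. \<Sum>g\<in>{g\<in>G. Xi n z g = a}. p g)"

definition avg_channel :: "nat \<Rightarrow> complex mat set \<Rightarrow> (complex mat \<Rightarrow> real) \<Rightarrow> (complex mat \<Rightarrow> sop)
    \<Rightarrow> (bool \<times> bool) list \<Rightarrow> sop" where
  "avg_channel n G p \<Lambda> a C =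
     complex_of_real (inverse (s_weight n G p a)) \<cdot>\<^sub>m
       msum (2^n) (\<lambda>z. msum (2^n) (\<lambda>g. complex_of_real (p g) \<cdot>\<^sub>m \<Lambda> g C) {g\<in>G. Xi n z g = a})
         (bitstrings n)"

definition pauli_eig :: "sop \<Rightarrow> (bool \<times> bool) list \<Rightarrow> complex" where
  "pauli_eig \<Phi> a = (THE c. \<Phi> (pauli a) = c \<cdot>\<^sub>m pauli a)"

definition avg_eig :: "nat \<Rightarrow> complex mat set \<Rightarrow> (complex mat \<Rightarrow> real) \<Rightarrow> (complex mat \<Rightarrow> sop)
    \<Rightarrow> (bool \<times> bool) list \<Rightarrow> complex" where
  "avg_eig n G p \<Lambda> a = complex_of_real (inverse (s_weight n G p a)) *
     (\<Sum>z\<in>bitstrings n. \<Sum>g\<in>{g\<in>G. Xi n z g = a}. complex_of_real (p g) * pauli_eig (\<Lambda> g) a)"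

definition bias :: "nat \<Rightarrow> complex mat set \<Rightarrow> (complex mat \<Rightarrow> real) \<Rightarrow> (complex mat \<Rightarrow> sop)
    \<Rightarrow> complex mat \<Rightarrow> complex mat \<Rightarrow> real" where
  "bias n G p \<Lambda> Obs \<rho> =
     cmod (trace (Obs * \<rho>) -
       hs_inner Obs (inv_into (carrier_mat (2^n) (2^n)) (frameS (2^n) G p)
                     (frameS_tilde (2^n) G p \<Lambda> \<rho>)))"

end

theory Submission
  imports "HOL-Analysis.L2_Norm" Defs
begin

text \<open>Write \<open>M = d\<^sup>-\<^sup>1 \<Sum>\<^sub>z |Z\<^sub>z)(Z\<^sub>z|\<close>. Clifford conjugation sends every \<open>Z\<^sub>z\<close> to a signed Pauli matrix, so the
  frame operators act on Pauli coefficients by \<open>(\<sigma>\<^sub>a|S C) = s\<^sub>a (\<sigma>\<^sub>a|C)\<close> and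
  \<open>(\<sigma>\<^sub>a|S' C) = s\<^sub>a (\<sigma>\<^sub>a|\<Lambda>\<^sub>a C)\<close>, where \<open>S'\<close> is the noisy frame operator and \<open>\<Lambda>\<^sub>a\<close> the averaged
  channel. Invertibility of \<open>S\<close> forces \<open>s\<^sub>a > 0\<close>, hence \<open>\<rho> - S\<^sup>-\<^sup>1 S' \<rho>\<close> has the Pauli coefficients
  \<open>(\<sigma>\<^sub>a|(id - \<Lambda>\<^sub>a) \<rho>)\<close>. Expanding the observable in Pauli matrices bounds the bias: each coefficient is
  at most the diamond norm of \<open>id - \<Lambda>\<^sub>a\<close>, and for Pauli channels it equals \<open>(1 - \<lambda>\<^sub>a) (\<sigma>\<^sub>a|\<rho>)\<close>, so that
  Cauchy-Schwarz and Parseval apply. The second inequality is convexity of the diamond norm. Everything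
  about the trace norm, which is defined by eigenvalues, follows from the spectral theorem through
  the duality \<open>\<parallel>X\<parallel>\<^sub>1 = max |Tr (U X)|\<close> over contractions \<open>U\<close>. The supremum over the Clifford group is
  finite because the entries of a channel are bounded by \<open>d\<close>, uniformly over all channels.\<close>

section \<open>Unitary matrices and the spectral theorem\<close>

text \<open>The trace norm is given as a sum over roots of a characteristic polynomial, a form in
  which even the triangle inequality is invisible. The duality runs over contractions because the
  polar factor of a singular matrix is only a partial isometry. Matrix units are contractions too
  and yield entry bounds; Pauli matrices are unitary, so the trace norm dominates every Pauli
  coefficient. \<open>diamond_norm\<close> and the supremum over the Clifford group are suprema of
  sets of reals and carry no information unless these sets are bounded. The crude entrywise
  estimates are there to secure this. The Clifford group enters through its generators: each sends
  Pauli matrices to Pauli matrices up to a sign, and the sign cancels in the frame operators because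
  every \<open>Zz z\<close> occurs there twice. The weights p(g)/s_a over the pairs (z,g) with
  \<open>Xi n z g = a\<close> sum to one, so an averaged channel is a convex combination. In the
  Hilbert-Schmidt bound the prefactor 1/d is consumed by two factors sqrt d, one from Parseval for
  the observable and one from Parseval for the state, whose purity is at most one.\<close>

lemma dim_adj [simp]: "dim_row (adj A) = dim_col A" "dim_col (adj A) = dim_row A"
  by (simp_all add: adj_def)

lemma adj_carrier [simp]: "A \<in> carrier_mat m n \<Longrightarrow> adj A \<in> carrier_mat n m"
  by (auto simp: adj_def)

lemma index_adj [simp]: "i < dim_col A \<Longrightarrow> j < dim_row A \<Longrightarrow> adj A $$ (i,j) = cnj (A $$ (j,i))"
  by (simp add: adj_def)

lemma adj_adj [simp]: "adj (adj A) = A"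
  by (intro eq_matI) auto

lemma adj_one [simp]: "adj (1\<^sub>m n) = 1\<^sub>m n"
  by (intro eq_matI) auto

lemma adj_smult [simp]: "adj (c \<cdot>\<^sub>m A) = cnj c \<cdot>\<^sub>m adj A"
  by (intro eq_matI) auto

lemma adj_add: "A \<in> carrier_mat m n \<Longrightarrow> B \<in> carrier_mat m n \<Longrightarrow> adj (A + B) = adj A + adj B"
  by (intro eq_matI) auto

lemma index_mult_sum:
  assumes "A \<in> carrier_mat m k" "B \<in> carrier_mat k n" "i < m" "j < n"
  shows "(A * B) $$ (i,j) = (\<Sum>l<k. A $$ (i,l) * B $$ (l,j))"
  using assms by (auto simp: scalar_prod_def lessThan_atLeast0)

lemma adj_mult:
  assumes "A \<in> carrier_mat m k" "B \<in> carrier_mat k n"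
  shows "adj (A * B) = adj B * adj A"
  using assms by (intro eq_matI) (auto simp: scalar_prod_def mult.commute)

lemma mult_carrier_sq [simp]:
  "A \<in> carrier_mat n n \<Longrightarrow> B \<in> carrier_mat n n \<Longrightarrow> A * B \<in> carrier_mat n n"
  by (rule mult_carrier_mat)

lemma mult_assoc_sq:
  fixes A B C :: "complex mat"
  assumes "A \<in> carrier_mat n n" "B \<in> carrier_mat n n" "C \<in> carrier_mat n n"
  shows "A * B * C = A * (B * C)"
  using assms by (rule assoc_mult_mat)

definition unitary :: "nat \<Rightarrow> complex mat \<Rightarrow> bool" where
  "unitary n U \<longleftrightarrow> U \<in> carrier_mat n n \<and> adj U * U = 1\<^sub>m n"

text \<open>A left inverse of a square matrix is also a right inverse, which gives the third
  equation.\<close>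

lemma unitaryD:
  assumes "unitary n U"
  shows "U \<in> carrier_mat n n" "adj U * U = 1\<^sub>m n" "U * adj U = 1\<^sub>m n"
  using assms mat_mult_left_right_inverse[of "adj U" n U] by (auto simp: unitary_def)

lemma unitary_one [simp]: "unitary n (1\<^sub>m n)"
  by (simp add: unitary_def)

lemma unitary_adj: "unitary n U \<Longrightarrow> unitary n (adj U)"
  by (simp add: unitary_def[of n "adj U"] unitaryD)

lemma unitary_mult:
  assumes "unitary n U" "unitary n V"
  shows "unitary n (U * V)"
proof -
  note c = unitaryD(1)[OF assms(1)] unitaryD(1)[OF assms(2)]
  have "adj (U * V) * (U * V) = adj V * (adj U * (U * V))"
    using c by (simp add: adj_mult[of _ n n _ n] assoc_mult_mat[of _ n n _ n _ n])
  also have "adj U * (U * V) = (adj U * U) * V"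
    using c by (simp add: assoc_mult_mat[of _ n n _ n _ n])
  finally show ?thesis using c unitaryD(2)[OF assms(1)] unitaryD(2)[OF assms(2)]
    by (simp add: unitary_def)
qed

definition dmat :: "nat \<Rightarrow> (nat \<Rightarrow> complex) \<Rightarrow> complex mat" where
  "dmat n f = mat n n (\<lambda>(i,j). if i = j then f i else 0)"

lemma dmat_carrier [simp]: "dmat n f \<in> carrier_mat n n"
  by (simp add: dmat_def)

lemma dmat_dim [simp]: "dim_row (dmat n f) = n" "dim_col (dmat n f) = n"
  by (simp_all add: dmat_def)

lemma dmat_index [simp]: "i < n \<Longrightarrow> j < n \<Longrightarrow> dmat n f $$ (i,j) = (if i = j then f i else 0)"
  by (simp add: dmat_def)

lemma dmat_mult: "dmat n f * dmat n g = dmat n (\<lambda>i. f i * g i)"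
proof (intro eq_matI)
  fix i j assume ij: "i < dim_row (dmat n (\<lambda>i. f i * g i))" "j < dim_col (dmat n (\<lambda>i. f i * g i))"
  hence "i < n" "j < n" by auto
  hence "(dmat n f * dmat n g) $$ (i,j) = (\<Sum>l<n. if l = i then (if i = j then f i * g i else 0) else 0)"
    by (subst index_mult_sum[OF dmat_carrier dmat_carrier], simp, simp, intro sum.cong) auto
  thus "(dmat n f * dmat n g) $$ (i,j) = dmat n (\<lambda>i. f i * g i) $$ (i,j)"
    using ij by (simp add: sum.delta)
qed auto

lemma dmat_mult_left_index:
  "A \<in> carrier_mat n m \<Longrightarrow> i < n \<Longrightarrow> j < m \<Longrightarrow> (dmat n f * A) $$ (i,j) = f i * A $$ (i,j)"
  by (subst index_mult_sum[of _ n n _ m]) (auto simp: if_distrib[of "\<lambda>x. x * _"] sum.delta cong: if_cong)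

lemma adj_dmat [simp]: "adj (dmat n f) = dmat n (\<lambda>i. cnj (f i))"
  by (intro eq_matI) auto

lemma dmat_one: "dmat n (\<lambda>_. 1) = 1\<^sub>m n"
  by (intro eq_matI) auto

lemma unitary_mult_cancel:
  assumes "unitary n V" "A \<in> carrier_mat n m"
  shows "V * (adj V * A) = A" "adj V * (V * A) = A"
  using assms(2) unitaryD[OF assms(1)]
  by (simp_all add: assoc_mult_mat[of V n n "adj V" n A m, symmetric]
     assoc_mult_mat[of "adj V" n n V n A m, symmetric])

text \<open>The witness is a Householder reflection times a phase.\<close>

lemma unitary_with_first_column:
  fixes v :: "nat \<Rightarrow> complex"
  assumes v: "(\<Sum>i<n. (cmod (v i))\<^sup>2) = 1" and n: "0 < n"
  shows "\<exists>W. unitary n W \<and> (\<forall>i<n. W $$ (i,0) = v i)"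
proof -
  \<comment> \<open>The phase of \<open>v 0\<close> is split off. A reflection can exchange the
    first basis vector with a unit vector \<open>u\<close> only if their inner product is real, and
    \<open>u = cnj c * v\<close> has the real entry \<open>r = cmod (v 0)\<close> there.\<close>
  obtain c where c: "cmod c = 1" "v 0 = complex_of_real (cmod (v 0)) * c"
  proof (cases "v 0 = 0")
    case False
    thus ?thesis using that[of "v 0 / cmod (v 0)"] by (auto simp: norm_divide)
  qed (use that[of 1] in auto)
  have cc: "cnj c * c = 1" "c * cnj c = 1"
    using c(1) complex_norm_square[of c] by (simp_all add: mult.commute)
  define u where "u i = cnj c * v i" for i
  define r where "r = cmod (v 0)"
  have u0: "u 0 = of_real r" using c cc unfolding u_def r_def
    by (metis mult.left_commute mult.right_neutral)
  have uu: "(\<Sum>i<n. u i * cnj (u i)) = 1"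
  proof -
    have "(\<Sum>i<n. u i * cnj (u i)) = (\<Sum>i<n. complex_of_real ((cmod (v i))\<^sup>2))"
      using c(1) by (intro sum.cong) (auto simp: u_def complex_norm_square[symmetric] norm_mult simp del: complex_cnj_mult of_real_power)
    thus ?thesis using v by (simp only: of_real_sum[symmetric] of_real_1)
  qed
  define w where "w i = u i - (if i = 0 then 1 else 0)" for i
  have ww: "(\<Sum>i<n. cnj (w i) * w i) = 2 - 2 * of_real r"
  proof -
    have "(\<Sum>i<n. cnj (w i) * w i) = (\<Sum>i<n. u i * cnj (u i) + (if i = 0 then 1 - 2 * of_real r else 0))"
      by (intro sum.cong) (auto simp: w_def u0 algebra_simps)
    thus ?thesis using n by (simp add: sum.distrib uu)
  qed
  \<comment> \<open>This is 2 / |w|^2, the Householder coefficient, since |w|^2 = 2 - 2r by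
    \<open>ww\<close>.\<close>
  define t :: complex where "t = 1 / (1 - of_real r)"
  have "\<exists>H. unitary n H \<and> (\<forall>i<n. H $$ (i,0) = u i)"
  \<comment> \<open>For r = 1 the vector \<open>w\<close> vanishes and there is no direction to
    reflect in; \<open>u\<close> is then the first basis vector and the identity serves.\<close>
  proof (cases "r = 1")
    case True
    have "complex_of_real (\<Sum>i<n. (cmod (w i))\<^sup>2) = (\<Sum>i<n. cnj (w i) * w i)"
      by (simp only: of_real_sum complex_norm_square mult.commute)
    also have "\<dots> = 0" using ww True by simp
    finally have "(\<Sum>i<n. (cmod (w i))\<^sup>2) = 0" by (simp only: of_real_eq_0_iff)
    hence "\<forall>i<n. w i = 0" by (subst (asm) sum_nonneg_eq_0_iff) auto
    hence "\<forall>i<n. 1\<^sub>m n $$ (i,0) = u i" using n by (auto simp: w_def split: if_splits)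
    thus ?thesis using unitary_one by blast
  next
    case False
    hence r: "1 - complex_of_real r \<noteq> 0" by (metis eq_iff_diff_eq_0 of_real_1 of_real_eq_iff)
    define H where "H = mat n n (\<lambda>(i,j). (if i = j then 1 else 0) - t * w i * cnj (w j))"
    have tr: "cnj t = t" by (simp add: t_def)
    have "adj H * H = 1\<^sub>m n"
    proof (intro eq_matI)
      fix i j assume "i < dim_row (1\<^sub>m n :: complex mat)" "j < dim_col (1\<^sub>m n :: complex mat)"
      hence ij: "i < n" "j < n" by auto
      have "(adj H * H) $$ (i,j) = (\<Sum>l<n. cnj (H $$ (l,i)) * H $$ (l,j))"
        using ij by (subst index_mult_sum[of _ n n _ n]) (auto simp: H_def)
      also have "\<dots> = (\<Sum>l<n. ((if l = i then (if i = j then 1 else 0) - t * w i * cnj (w j) else 0)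
           + (if l = j then - t * w i * cnj (w j) else 0)) + t * t * w i * cnj (w j) * (cnj (w l) * w l))"
        using ij by (intro sum.cong) (auto simp: H_def tr algebra_simps)
      also have "\<dots> = (if i = j then 1 else 0) - 2 * t * w i * cnj (w j)
             + t * t * w i * cnj (w j) * (2 - 2 * of_real r)"
        using ij by (simp add: sum.distrib sum.delta ww flip: sum_distrib_left)
      also have "t * t * w i * cnj (w j) * (2 - 2 * of_real r) = (t * (1 - of_real r)) * (2 * t * w i * cnj (w j))"
        by (simp add: algebra_simps)
      also have "t * (1 - of_real r) = 1" using r by (simp add: t_def)
      finally show "(adj H * H) $$ (i,j) = 1\<^sub>m n $$ (i,j)" using ij by simp
    qed (auto simp: H_def)
    moreover have "H $$ (i,0) = u i" if "i < n" for i
    proof -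
      have "H $$ (i,0) = (if i = 0 then 1 else 0) - t * w i * (of_real r - 1)"
        using that n by (simp add: H_def w_def u0)
      also have "t * w i * (of_real r - 1) = - w i * (t * (1 - of_real r))"
        by (simp add: algebra_simps)
      also have "t * (1 - of_real r) = 1" using r by (simp add: t_def)
      finally show ?thesis by (simp add: w_def)
    qed
    ultimately show ?thesis by (intro exI[of _ H]) (auto simp: unitary_def H_def)
  qed
  then obtain H where H: "unitary n H" "\<forall>i<n. H $$ (i,0) = u i" by blast
  have "adj (c \<cdot>\<^sub>m H) * (c \<cdot>\<^sub>m H) = (cnj c * c) \<cdot>\<^sub>m (adj H * H)"
    using unitaryD(1)[OF H(1)]
    by (intro eq_matI) (auto simp: mult_smult_assoc_mat[of _ n n _ n] mult_smult_distrib[of _ n n _ n])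
  hence "unitary n (c \<cdot>\<^sub>m H)"
    using unitaryD(1,2)[OF H(1)] by (auto simp: unitary_def cc intro!: eq_matI)
  moreover have "(c \<cdot>\<^sub>m H) $$ (i,0) = v i" if "i < n" for i
    using that n H unitaryD(1)[OF H(1)] cc(2) by (auto simp: u_def simp flip: mult.assoc)
  ultimately show ?thesis by blast
qed

text \<open>The characteristic polynomial has degree n > 0, so the fundamental theorem of algebra
  supplies an eigenvalue. The eigenvector is scaled to unit length so that it can be the first
  column of a unitary matrix.\<close>

lemma eigenvector_exists:
  assumes A: "A \<in> carrier_mat n n" and n: "0 < n"
  obtains v :: "nat \<Rightarrow> complex" and l where
    "(\<Sum>i<n. (cmod (v i))\<^sup>2) = 1" "\<And>i. i < n \<Longrightarrow> (\<Sum>j<n. A $$ (i,j) * v j) = l * v i"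
proof -
  have "degree (char_poly A) \<noteq> 0" using degree_monic_char_poly[OF A] n by simp
  hence "\<not> constant (poly (char_poly A))" by (simp add: constant_degree)
  then obtain l where "poly (char_poly A) l = 0" using fundamental_theorem_of_algebra by blast
  hence "eigenvalue A l" using eigenvalue_root_char_poly[OF A] by simp
  then obtain x where x: "x \<in> carrier_vec n" "x \<noteq> 0\<^sub>v n" "A *\<^sub>v x = l \<cdot>\<^sub>v x"
    using A by (auto simp: eigenvalue_def eigenvector_def)
  define N where "N = (\<Sum>i<n. (cmod (x $ i))\<^sup>2)"
  have "N \<noteq> 0"
  proof
    assume "N = 0"
    hence "\<forall>i<n. x $ i = 0" unfolding N_def by (subst (asm) sum_nonneg_eq_0_iff) auto
    hence "x = 0\<^sub>v n" using x(1) by (intro eq_vecI) auto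
    thus False using x(2) by simp
  qed
  moreover have "N \<ge> 0" unfolding N_def by (intro sum_nonneg) auto
  ultimately have N: "N > 0" by simp
  define v where "v i = x $ i / sqrt N" for i
  have "(\<Sum>i<n. (cmod (v i))\<^sup>2) = N / N"
    using N unfolding v_def N_def
    by (simp add: norm_divide power_divide flip: sum_divide_distrib)
  moreover have "(\<Sum>j<n. A $$ (i,j) * v j) = l * v i" if i: "i < n" for i
  proof -
    have "(\<Sum>j<n. A $$ (i,j) * x $ j) = (A *\<^sub>v x) $ i"
      using i A x(1) by (auto simp: scalar_prod_def lessThan_atLeast0)
    also have "\<dots> = l * x $ i" using x i by simp
    finally show ?thesis by (simp add: v_def flip: sum_divide_distrib)
  qed
  ultimately show ?thesis using that[of v l] N by auto
qed

text \<open>Deflation: a unit eigenvector is completed to a unitary \<open>W\<close>. The first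
  column of \<open>adj W * (A * W)\<close> is then \<open>l\<close> followed by zeros; hermiticity
  clears the first row as well and makes \<open>l\<close> real, and the induction hypothesis
  diagonalises the remaining block.\<close>

theorem spectral_theorem:
  "hermitian n A \<Longrightarrow> \<exists>V f. unitary n V \<and> A = V * dmat n (\<lambda>i. complex_of_real (f i)) * adj V"
proof (induction n arbitrary: A)
  case 0
  thus ?case by (intro exI[of _ "1\<^sub>m 0"] exI[of _ "\<lambda>_. 0"] conjI eq_matI) (auto simp: hermitian_def)
next
  case (Suc n)
  let ?N = "Suc n"
  have A: "A \<in> carrier_mat ?N ?N" "adj A = A" using Suc.prems by (auto simp: hermitian_def)
  obtain v l where v: "(\<Sum>i<?N. (cmod (v i))\<^sup>2) = 1"
    and Av: "\<And>i. i < ?N \<Longrightarrow> (\<Sum>j<?N. A $$ (i,j) * v j) = l * v i"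
    using eigenvector_exists[OF A(1)] by blast
  obtain W where W: "unitary ?N W" and Wv: "\<And>i. i < ?N \<Longrightarrow> W $$ (i,0) = v i"
    using unitary_with_first_column[OF v] by blast
  note Wc = unitaryD(1)[OF W]
  define B where "B = adj W * (A * W)"
  have B: "B \<in> carrier_mat ?N ?N" using A Wc by (auto simp: B_def)
  have adjB: "adj B = B"
    using A Wc by (simp add: B_def adj_mult[of _ ?N ?N _ ?N] assoc_mult_mat[of _ ?N ?N _ ?N _ ?N])
  have B0: "B $$ (i,0) = (if i = 0 then l else 0)" if i: "i < ?N" for i
  proof -
    have "(A * W) $$ (j,0) = l * v j" if "j < ?N" for j
      using that A Wc Av by (subst index_mult_sum[of _ ?N ?N _ ?N]) (auto simp: Wv simp del: sum.lessThan_Suc)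
    hence "B $$ (i,0) = l * (\<Sum>j<?N. adj W $$ (i,j) * W $$ (j,0))"
      using i A Wc Wv unfolding B_def
      by (subst index_mult_sum[of _ ?N ?N _ ?N]) (auto simp: sum_distrib_left mult_ac simp del: sum.lessThan_Suc intro!: sum.cong)
    also have "(\<Sum>j<?N. adj W $$ (i,j) * W $$ (j,0)) = (adj W * W) $$ (i,0)"
      using i Wc by (subst index_mult_sum[of _ ?N ?N _ ?N]) auto
    finally show ?thesis using i unitaryD(2)[OF W] by simp
  qed
  have Bc: "B $$ (i,j) = cnj (B $$ (j,i))" if "i < ?N" "j < ?N" for i j
    using arg_cong[OF adjB, of "\<lambda>M. M $$ (i,j)"] that B by auto
  have lr: "l = of_real (Re l)"
    using Bc[of 0 0] B0[of 0] by (simp add: complex_eq_iff)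
  define A' where "A' = mat n n (\<lambda>(i,j). B $$ (Suc i, Suc j))"
  have "hermitian n A'"
    unfolding hermitian_def by (auto simp: A'_def Bc[symmetric])
  from Suc.IH[OF this] obtain V' f' where V': "unitary n V'"
    and A'V: "A' = V' * dmat n (\<lambda>i. complex_of_real (f' i)) * adj V'" by blast
  note V'c = unitaryD(1)[OF V']
  let ?blk = "\<lambda>a C. four_block_mat (dmat 1 (\<lambda>_. a)) (0\<^sub>m 1 n) (0\<^sub>m n 1) C"
  have blk_mult: "?blk a C * ?blk b D = ?blk (a * b) (C * D)"
    if "C \<in> carrier_mat n n" "D \<in> carrier_mat n n" for a b C D
    using that by (subst mult_four_block_mat[of _ 1 1 _ n _ n _ _ 1 _ n])
      (auto simp: dmat_mult intro!: cong_four_block_mat)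
  have blk_adj: "adj (?blk a C) = ?blk (cnj a) (adj C)" if "C \<in> carrier_mat n n" for a C
    using that by (intro eq_matI) auto
  have B_blk: "B = ?blk l A'"
  proof (intro eq_matI)
    fix i j assume "i < dim_row (?blk l A')" "j < dim_col (?blk l A')"
    hence ij: "i < ?N" "j < ?N" by (auto simp: A'_def)
    show "B $$ (i,j) = ?blk l A' $$ (i,j)"
      using ij B0[of i] B0[of j] Bc[of i j] by (cases i; cases j) (auto simp: A'_def)
  qed (use B in \<open>auto simp: A'_def\<close>)
  \<comment> \<open>The new eigenvalue goes in front of those of the lower block.\<close>
  let ?D = "dmat ?N (\<lambda>i. complex_of_real (case i of 0 \<Rightarrow> Re l | Suc j \<Rightarrow> f' j))"
  have D_blk: "?D = ?blk l (dmat n (\<lambda>i. complex_of_real (f' i)))"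
    using lr by (intro eq_matI) (auto split: nat.splits)
  define V1 where "V1 = ?blk 1 V'"
  have V1: "unitary ?N V1"
    using V'c unitaryD(2)[OF V'] unfolding unitary_def V1_def
    by (auto simp: blk_adj blk_mult simp del: One_nat_def) (simp only: dmat_one four_block_one_mat plus_1_eq_Suc)
  note V1c = unitaryD(1)[OF V1]
  have "V1 * ?D * adj V1 = B"
    unfolding D_blk B_blk V1_def A'V using V'c by (simp add: blk_adj blk_mult del: One_nat_def)
  have "W * V1 * ?D * adj (W * V1) = W * (V1 * ?D * adj V1) * adj W"
    using Wc V1c by (simp add: adj_mult[of _ ?N ?N _ ?N] mult_assoc_sq[of _ ?N])
  also have "\<dots> = W * B * adj W" by (simp add: \<open>V1 * ?D * adj V1 = B\<close>)
  also have "\<dots> = A"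
    using Wc A unitaryD[OF W] unfolding B_def
    by (simp add: mult_assoc_sq[of _ ?N] unitary_mult_cancel[OF W, of _ ?N])
  finally have "A = W * V1 * ?D * adj (W * V1)" ..
  thus ?case using unitary_mult[OF W V1] by (intro exI conjI)
qed

section \<open>The trace norm\<close>

lemma trace_eq: "A \<in> carrier_mat n n \<Longrightarrow> trace A = (\<Sum>i<n. A $$ (i,i))"
  by (auto simp: trace_def)

lemma trace_mult_eq:
  assumes "A \<in> carrier_mat m n" "B \<in> carrier_mat n m"
  shows "trace (A * B) = (\<Sum>i<m. \<Sum>l<n. A $$ (i,l) * B $$ (l,i))"
  using assms by (subst trace_eq[of _ m]) (auto simp: index_mult_sum[of _ m n _ m] simp del: index_mult_mat(1))

lemma trace_comm:
  assumes "A \<in> carrier_mat m n" "B \<in> carrier_mat n m"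
  shows "trace (A * B) = trace (B * A)"
  unfolding trace_mult_eq[OF assms] trace_mult_eq[OF assms(2,1)]
  by (subst sum.swap) (simp add: mult.commute)

lemma trace_smult: "A \<in> carrier_mat n n \<Longrightarrow> trace (c \<cdot>\<^sub>m A) = c * trace A"
  by (simp add: trace_eq[of _ n] sum_distrib_left)

lemma trace_minus: "A \<in> carrier_mat n n \<Longrightarrow> B \<in> carrier_mat n n \<Longrightarrow> trace (A - B) = trace A - trace B"
  by (subst (1 2 3) trace_eq[of _ n]) (auto simp: sum_subtractf)

lemma msum_carrier [simp]: "msum d f I \<in> carrier_mat d d"
  by (simp add: msum_def)

lemma msum_dim [simp]: "dim_row (msum d f I) = d" "dim_col (msum d f I) = d"
  by (simp_all add: msum_def)

lemma msum_index [simp]: "i < d \<Longrightarrow> j < d \<Longrightarrow> msum d f I $$ (i,j) = (\<Sum>x\<in>I. f x $$ (i,j))"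
  by (simp add: msum_def)

lemma msum_cong: "I = J \<Longrightarrow> (\<And>x. x \<in> J \<Longrightarrow> f x = g x) \<Longrightarrow> msum d f I = msum d g J"
  by (intro eq_matI) (auto intro: sum.cong)

lemma trace_mult_msum:
  assumes "A \<in> carrier_mat n n" "\<And>x. x \<in> I \<Longrightarrow> f x \<in> carrier_mat n n"
  shows "trace (A * msum n f I) = (\<Sum>x\<in>I. trace (A * f x))"
proof -
  have "trace (A * msum n f I) = (\<Sum>i<n. \<Sum>l<n. A $$ (i,l) * (\<Sum>x\<in>I. f x $$ (l,i)))"
    using assms by (subst trace_mult_eq[of _ n n]) auto
  also have "\<dots> = (\<Sum>i<n. \<Sum>l<n. \<Sum>x\<in>I. A $$ (i,l) * f x $$ (l,i))"
    by (simp add: sum_distrib_left)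
  also have "\<dots> = (\<Sum>i<n. \<Sum>x\<in>I. \<Sum>l<n. A $$ (i,l) * f x $$ (l,i))"
    by (subst sum.swap[of _ I]) (rule refl)
  also have "\<dots> = (\<Sum>x\<in>I. \<Sum>i<n. \<Sum>l<n. A $$ (i,l) * f x $$ (l,i))"
    by (rule sum.swap)
  also have "\<dots> = (\<Sum>x\<in>I. trace (A * f x))"
    using assms by (intro sum.cong refl) (simp add: trace_mult_eq[of _ n n])
  finally show ?thesis .
qed

lemma gram_diag:
  assumes "A \<in> carrier_mat m n" "i < n"
  shows "(adj A * A) $$ (i,i) = of_real (\<Sum>k<m. (cmod (A $$ (k,i)))\<^sup>2)"
  using assms by (subst index_mult_sum[of _ n m _ n])
    (auto simp: complex_norm_square mult.commute simp del: of_real_power)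

lemma gram_diag':
  assumes "A \<in> carrier_mat m n" "i < m"
  shows "(A * adj A) $$ (i,i) = of_real (\<Sum>k<n. (cmod (A $$ (i,k)))\<^sup>2)"
  using gram_diag[of "adj A" n m i] assms by simp

lemma unitary_row_norm:
  assumes "unitary n U" "i < n"
  shows "(\<Sum>k<n. (cmod (U $$ (i,k)))\<^sup>2) = 1"
proof -
  have "complex_of_real (\<Sum>k<n. (cmod (U $$ (i,k)))\<^sup>2) = 1"
    using gram_diag'[of U n n i] unitaryD[OF assms(1)] assms(2) by simp
  thus ?thesis using of_real_eq_1_iff by blast
qed

lemma char_poly_conj_dmat:
  assumes "unitary n V"
  shows "char_poly (V * dmat n f * adj V) = (\<Prod>i\<leftarrow>[0..<n]. [:- f i, 1:])"
proof -
  have "similar_mat_wit (V * dmat n f * adj V) (dmat n f) V (adj V)"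
    using unitaryD[OF assms] by (intro similar_mat_witI[of _ _ n]) auto
  hence "char_poly (V * dmat n f * adj V) = char_poly (dmat n f)"
    by (intro char_poly_similar) (auto simp: similar_mat_def)
  also have "\<dots> = (\<Prod>a\<leftarrow>diag_mat (dmat n f). [:- a, 1:])"
    by (rule char_poly_upper_triangular[of _ n]) (auto simp: upper_triangular_def)
  also have "diag_mat (dmat n f) = map f [0..<n]"
    by (auto simp: diag_mat_def)
  finally show ?thesis by (simp add: o_def)
qed

lemma proots_linear_factors: "proots (\<Prod>i\<leftarrow>xs. [:- f i, 1:]) = image_mset f (mset xs)"
  for f :: "'b \<Rightarrow> 'a :: idom"
proof (induction xs)
  case (Cons x xs)
  have "(\<Prod>i\<leftarrow>xs. [:- f i, 1:]) \<noteq> 0" by (auto simp: prod_list_zero_iff)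
  hence "proots ([:- f x, 1:] * (\<Prod>i\<leftarrow>xs. [:- f i, 1:])) = {#f x#} + proots (\<Prod>i\<leftarrow>xs. [:- f i, 1:])"
    by (subst proots_mult) (auto simp: proots_linear_factor)
  thus ?case using Cons by simp
qed auto

text \<open>Any unitary diagonalisation of the Gram matrix computes the trace norm: similarity
  preserves the characteristic polynomial, and \<open>proots\<close> counts its roots with
  multiplicity.\<close>

lemma trace_norm_eq:
  assumes "unitary n V" "adj X * X = V * dmat n (\<lambda>i. complex_of_real (f i)) * adj V"
  shows "trace_norm X = (\<Sum>i<n. sqrt (f i))"
  unfolding trace_norm_def assms(2) char_poly_conj_dmat[OF assms(1)] proots_linear_factors
  by (simp add: image_mset.compositionality o_def lessThan_atLeast0 sum_unfold_sum_mset)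

lemma hermitian_gram: "X \<in> carrier_mat m n \<Longrightarrow> hermitian n (adj X * X)"
  by (auto simp: hermitian_def adj_mult[of _ n m _ n])

text \<open>The columns of \<open>X * V\<close> are orthogonal and \<open>f i\<close> is the squared
  length of the i-th one, that is, a squared singular value. This form gives non-negativity at once
  and fits Cauchy-Schwarz.\<close>

lemma trace_norm_svd:
  assumes X: "X \<in> carrier_mat n n"
  obtains V f where "unitary n V" "adj X * X = V * dmat n (\<lambda>i. complex_of_real (f i)) * adj V"
    "trace_norm X = (\<Sum>i<n. sqrt (f i))"
    "\<And>i. i < n \<Longrightarrow> f i = (\<Sum>k<n. (cmod ((X * V) $$ (k,i)))\<^sup>2)" "\<And>i. i < n \<Longrightarrow> 0 \<le> f i"
proof -
  obtain V f where V: "unitary n V" and eq: "adj X * X = V * dmat n (\<lambda>i. complex_of_real (f i)) * adj V"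
    using spectral_theorem[OF hermitian_gram[OF X]] by blast
  have f: "f i = (\<Sum>k<n. (cmod ((X * V) $$ (k,i)))\<^sup>2)" if i: "i < n" for i
  proof -
    note c = unitaryD(1)[OF V]
    have "adj (X * V) * (X * V) = adj V * (adj X * X) * V"
      using X c by (simp add: adj_mult[of _ n n _ n] mult_assoc_sq[of _ n])
    also have "\<dots> = dmat n (\<lambda>i. complex_of_real (f i))"
      unfolding eq using c unitaryD[OF V] by (simp add: mult_assoc_sq[of _ n] unitary_mult_cancel[OF V, of _ n])
    finally have "complex_of_real (\<Sum>k<n. (cmod ((X * V) $$ (k,i)))\<^sup>2) = of_real (f i)"
      using gram_diag[of "X * V" n n i] X c i by simp
    thus ?thesis by (simp only: of_real_eq_iff)
  qed
  show ?thesis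
    by (rule that[OF V eq trace_norm_eq[OF V eq] f]) (auto simp: f intro!: sum_nonneg)
qed

lemma trace_norm_nonneg:
  assumes "X \<in> carrier_mat n n" shows "0 \<le> trace_norm X"
  by (rule trace_norm_svd[OF assms]) (auto intro!: sum_nonneg)

text \<open>Operator norm at most one, expressed by the row norms in every orthonormal basis.\<close>

definition contraction :: "nat \<Rightarrow> complex mat \<Rightarrow> bool" where
  "contraction n U \<longleftrightarrow> U \<in> carrier_mat n n \<and>
     (\<forall>V i. unitary n V \<longrightarrow> i < n \<longrightarrow> (\<Sum>k<n. (cmod ((adj V * U) $$ (i,k)))\<^sup>2) \<le> 1)"

lemma unitary_contraction: "unitary n U \<Longrightarrow> contraction n U"
  using unitary_row_norm[OF unitary_mult[OF unitary_adj]] unitaryD(1)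
  by (auto simp: contraction_def)

text \<open>Taken in the basis \<open>V\<close>, the trace pairs row i of \<open>adj V * U\<close>
  with column i of \<open>X * V\<close>. The row has norm at most one because \<open>U\<close> is a
  contraction, the column has norm \<open>sqrt (f i)\<close>, and Cauchy-Schwarz is applied to each
  i.\<close>

lemma cmod_trace_mult_le:
  assumes U: "contraction n U" and X: "X \<in> carrier_mat n n"
  shows "cmod (trace (U * X)) \<le> trace_norm X"
proof -
  obtain V f where V: "unitary n V" and tn: "trace_norm X = (\<Sum>i<n. sqrt (f i))"
    and f: "\<And>i. i < n \<Longrightarrow> f i = (\<Sum>k<n. (cmod ((X * V) $$ (k,i)))\<^sup>2)"
    using trace_norm_svd[OF X] by metis
  note c = unitaryD(1)[OF V] and Uc = U[unfolded contraction_def, THEN conjunct1]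
  have "trace (U * X) = trace ((U * X * V) * adj V)"
    using c Uc X unitaryD(3)[OF V] by (simp add: mult_assoc_sq[of _ n])
  also have "\<dots> = trace (adj V * (U * X * V))"
    using c Uc X by (intro trace_comm) auto
  also have "adj V * (U * X * V) = (adj V * U) * (X * V)"
    using c Uc X by (simp add: mult_assoc_sq[of _ n])
  also have "trace \<dots> = (\<Sum>i<n. \<Sum>k<n. (adj V * U) $$ (i,k) * (X * V) $$ (k,i))"
    using c Uc X by (subst trace_eq[of _ n]) (auto simp: index_mult_sum[of _ n n "X * V" n] simp del: index_mult_mat)
  also have "cmod \<dots> \<le> (\<Sum>i<n. sqrt (f i))"
  proof (rule sum_norm_le)
    fix i assume "i \<in> {..<n}"
    hence i: "i < n" by simp
    have "cmod (\<Sum>k<n. (adj V * U) $$ (i,k) * (X * V) $$ (k,i))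
          \<le> (\<Sum>k<n. \<bar>cmod ((adj V * U) $$ (i,k))\<bar> * \<bar>cmod ((X * V) $$ (k,i))\<bar>)"
      by (rule order.trans[OF norm_sum]) (simp add: norm_mult)
    also have "\<dots> \<le> L2_set (\<lambda>k. cmod ((adj V * U) $$ (i,k))) {..<n} * L2_set (\<lambda>k. cmod ((X * V) $$ (k,i))) {..<n}"
      by (rule L2_set_mult_ineq)
    also have "\<dots> \<le> 1 * sqrt (f i)"
      using U V i f[OF i] by (intro mult_mono) (auto simp: L2_set_def contraction_def simp del: index_mult_mat intro!: sum_nonneg)
    finally show "cmod (\<Sum>k<n. (adj V * U) $$ (i,k) * (X * V) $$ (k,i)) \<le> sqrt (f i)" by simp
  qed
  finally show ?thesis using tn by simp
qed

text \<open>The contraction is the adjoint of the partial isometry in the polar decomposition of \<open>X\<close>.\<close>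

lemma trace_norm_attained:
  assumes X: "X \<in> carrier_mat n n"
  shows "\<exists>U. contraction n U \<and> trace (U * X) = of_real (trace_norm X)"
proof -
  obtain V f where V: "unitary n V" and tn: "trace_norm X = (\<Sum>i<n. sqrt (f i))"
    and eq: "adj X * X = V * dmat n (\<lambda>i. complex_of_real (f i)) * adj V"
    and f: "\<And>i. i < n \<Longrightarrow> 0 \<le> f i"
    using trace_norm_svd[OF X] by metis
  note c = unitaryD(1)[OF V]
  \<comment> \<open>The inverse square root of the Gram matrix on its range, and zero on its kernel.
    Hence \<open>P\<close> below is the indicator of the non-zero singular values, and
    \<open>U * adj U\<close> is a projection.\<close>
  define e where "e i = complex_of_real (if f i > 0 then 1 / sqrt (f i) else 0)" for i
  define P where "P i = complex_of_real (if f i > 0 then 1 else 0)" for i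
  let ?F = "dmat n (\<lambda>i. complex_of_real (f i))"
  define U where "U = V * dmat n e * adj V * adj X"
  have Uc: "U \<in> carrier_mat n n" using c X by (simp add: U_def)
  have cnje: "cnj (e i) = e i" for i by (simp add: e_def)
  have ss: "complex_of_real (sqrt a) * complex_of_real (sqrt a) = of_real a" if "a > 0" for a
    using that by (simp flip: of_real_mult)
  have efe: "dmat n (\<lambda>i. e i * (f i * e i)) = dmat n P"
    by (intro eq_matI) (auto simp: e_def P_def field_simps ss)
  have "e i * f i = of_real (sqrt (f i))" if "i < n" for i
    using f[OF that] by (cases "f i = 0") (auto simp: e_def real_div_sqrt simp flip: of_real_mult of_real_divide)
  hence ef: "trace (dmat n (\<lambda>i. e i * f i)) = of_real (\<Sum>i<n. sqrt (f i))"
    by (subst trace_eq[of _ n]) auto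
  have "U * adj U = V * dmat n e * adj V * (adj X * X) * (V * dmat n e * adj V)"
    using c X by (simp add: U_def adj_mult[of _ n n _ n] mult_assoc_sq[of _ n] cnje)
  also have "\<dots> = V * (dmat n e * (?F * dmat n e)) * adj V"
    unfolding eq using c by (simp add: mult_assoc_sq[of _ n] unitary_mult_cancel[OF V, of _ n])
  also have "\<dots> = V * dmat n P * adj V" by (simp add: dmat_mult efe)
  finally have UU: "U * adj U = V * dmat n P * adj V" .
  \<comment> \<open>The squared row norm is a diagonal entry of \<open>U * adj U\<close> in the
    basis \<open>W\<close>. Written with the unitary \<open>adj W * V\<close> it is a row norm with
    some terms omitted, so at most one.\<close>
  have "(\<Sum>k<n. (cmod ((adj W * U) $$ (i,k)))\<^sup>2) \<le> 1" if W: "unitary n W" and i: "i < n" for W i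
  proof -
    note d = unitaryD(1)[OF W]
    let ?Y = "adj W * V"
    have Y: "unitary n ?Y" by (intro unitary_mult unitary_adj W V)
    have "complex_of_real (\<Sum>k<n. (cmod ((adj W * U) $$ (i,k)))\<^sup>2) = ((adj W * U) * adj (adj W * U)) $$ (i,i)"
      using Uc d i by (subst gram_diag'[of _ n n]) auto
    also have "(adj W * U) * adj (adj W * U) = adj W * (U * adj U) * W"
      using Uc d by (simp add: adj_mult[of _ n n _ n] mult_assoc_sq[of _ n])
    also have "\<dots> = ?Y * (dmat n P * adj ?Y)"
      unfolding UU using c d by (simp add: adj_mult[of _ n n _ n] mult_assoc_sq[of _ n])
    also have "\<dots> $$ (i,i) = (\<Sum>k<n. ?Y $$ (i,k) * (P k * adj ?Y $$ (k,i)))"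
      using c d i by (subst index_mult_sum[of _ n n _ n])
         (auto simp: dmat_mult_left_index[of _ n n] simp del: index_mult_mat intro!: sum.cong)
    also have "\<dots> = of_real (\<Sum>k<n. if f k > 0 then (cmod (?Y $$ (i,k)))\<^sup>2 else 0)"
    proof -
      have "adj ?Y $$ (k,i) = cnj (?Y $$ (i,k))" if "k < n" for k
        using that c d i by (intro index_adj) auto
      thus ?thesis
        by (auto simp: P_def complex_norm_square simp del: index_mult_mat of_real_power intro!: sum.cong)
    qed
    finally have "(\<Sum>k<n. (cmod ((adj W * U) $$ (i,k)))\<^sup>2) = (\<Sum>k<n. if f k > 0 then (cmod (?Y $$ (i,k)))\<^sup>2 else 0)"
      by (simp only: of_real_eq_iff)
    also have "\<dots> \<le> (\<Sum>k<n. (cmod (?Y $$ (i,k)))\<^sup>2)" by (intro sum_mono) auto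
    also have "\<dots> = 1" by (rule unitary_row_norm[OF Y i])
    finally show ?thesis .
  qed
  hence "contraction n U" using Uc by (simp add: contraction_def)
  moreover have "trace (U * X) = of_real (trace_norm X)"
  proof -
    have "U * X = V * dmat n e * adj V * (adj X * X)"
      using c X by (simp add: U_def mult_assoc_sq[of _ n])
    also have "\<dots> = V * (dmat n (\<lambda>i. e i * f i) * adj V)"
      unfolding eq using c by (simp add: mult_assoc_sq[of _ n] unitary_mult_cancel[OF V, of _ n] flip: dmat_mult)
    also have "trace \<dots> = trace (dmat n (\<lambda>i. e i * f i) * adj V * V)"
      using c by (intro trace_comm) auto
    also have "dmat n (\<lambda>i. e i * f i) * adj V * V = dmat n (\<lambda>i. e i * f i)"
      using c unitaryD[OF V] by (simp add: mult_assoc_sq[of _ n])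
    finally show ?thesis using ef tn by simp
  qed
  ultimately show ?thesis by blast
qed

text \<open>The contraction that attains the norm of the sum is also a competitor for each summand,
  so duality gives the triangle inequality in weighted form.\<close>

lemma trace_norm_msum_le:
  assumes F: "\<And>x. x \<in> I \<Longrightarrow> F x \<in> carrier_mat n n" and w: "\<And>x. x \<in> I \<Longrightarrow> 0 \<le> w x"
  shows "trace_norm (msum n (\<lambda>x. complex_of_real (w x) \<cdot>\<^sub>m F x) I) \<le> (\<Sum>x\<in>I. w x * trace_norm (F x))"
proof -
  let ?M = "msum n (\<lambda>x. complex_of_real (w x) \<cdot>\<^sub>m F x) I"
  obtain U where U: "contraction n U" and tr: "trace (U * ?M) = of_real (trace_norm ?M)"
    using trace_norm_attained[of ?M n] by auto
  have Uc: "U \<in> carrier_mat n n" using U by (simp add: contraction_def)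
  have "trace (U * ?M) = (\<Sum>x\<in>I. of_real (w x) * trace (U * F x))"
    using Uc F by (subst trace_mult_msum)
     (auto simp: mult_smult_distrib[of _ n n _ n] trace_smult[of _ n] intro!: sum.cong)
  hence "cmod (trace (U * ?M)) \<le> (\<Sum>x\<in>I. w x * cmod (trace (U * F x)))"
    using w by (auto simp: norm_mult intro!: order.trans[OF norm_sum] sum_mono)
  also have "\<dots> \<le> (\<Sum>x\<in>I. w x * trace_norm (F x))"
    using w F cmod_trace_mult_le[OF U] by (intro sum_mono mult_left_mono) auto
  finally have "\<bar>trace_norm ?M\<bar> \<le> (\<Sum>x\<in>I. w x * trace_norm (F x))" unfolding tr by simp
  thus ?thesis by simp
qed

text \<open>The entries of a contraction have modulus at most one; this is read off from its row
  norms in the standard basis.\<close>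

lemma trace_norm_le_entries:
  assumes X: "X \<in> carrier_mat n n"
  shows "trace_norm X \<le> (\<Sum>i<n. \<Sum>j<n. cmod (X $$ (i,j)))"
proof -
  obtain U where U: "contraction n U" and tr: "trace (U * X) = of_real (trace_norm X)"
    using trace_norm_attained[OF X] by auto
  have Uc: "U \<in> carrier_mat n n" using U by (simp add: contraction_def)
  have U1: "cmod (U $$ (i,j)) \<le> 1" if "i < n" "j < n" for i j
  proof -
    have "(cmod (U $$ (i,j)))\<^sup>2 \<le> (\<Sum>k<n. (cmod (U $$ (i,k)))\<^sup>2)"
      using that by (intro member_le_sum) auto
    also have "\<dots> \<le> 1"
      using U that Uc unfolding contraction_def by (metis adj_one left_mult_one_mat unitary_one)
    finally show ?thesis by (simp add: power_le_one_iff abs_square_le_1)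
  qed
  have "trace_norm X = cmod (trace (U * X))" unfolding tr using trace_norm_nonneg[OF X] by simp
  also have "trace (U * X) = trace (X * U)" using Uc X by (rule trace_comm)
  also have "\<dots> = (\<Sum>i<n. \<Sum>j<n. X $$ (i,j) * U $$ (j,i))"
    using Uc X by (subst trace_eq[of _ n]) (auto simp: index_mult_sum[of _ n n _ n] simp del: index_mult_mat)
  also have "cmod \<dots> \<le> (\<Sum>i<n. \<Sum>j<n. cmod (X $$ (i,j)) * 1)"
    using U1 by (intro sum_norm_le) (auto simp: norm_mult intro!: mult_left_le)
  finally show ?thesis by simp
qed

lemma entry_le_trace_norm:
  assumes X: "X \<in> carrier_mat n n" and ij: "i < n" "j < n"
  shows "cmod (X $$ (i,j)) \<le> trace_norm X"
proof -
  \<comment> \<open>The matrix unit at the transposed position (j,i), since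
    \<open>trace (E * X)\<close> is then the entry of \<open>X\<close> at (i,j).\<close>
  define E :: "complex mat" where "E = mat n n (\<lambda>(a,b). if a = j \<and> b = i then 1 else 0)"
  have Ec: "E \<in> carrier_mat n n" by (simp add: E_def)
  have "contraction n E"
    unfolding contraction_def
  proof (intro conjI allI impI Ec)
    fix V k assume V: "unitary n V" and k: "k < n"
    note c = unitaryD(1)[OF V]
    have "(adj V * E) $$ (k,l) = (if l = i then cnj (V $$ (j,k)) else 0)" if "l < n" for l
      using that c k ij Ec by (subst index_mult_sum[of _ n n _ n])
        (auto simp: E_def if_distrib[of "\<lambda>x. _ * x"] sum.delta cong: if_cong)
    hence "(\<Sum>l<n. (cmod ((adj V * E) $$ (k,l)))\<^sup>2) = (\<Sum>l<n. if l = i then (cmod (V $$ (j,k)))\<^sup>2 else 0)"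
      by (intro sum.cong) (auto simp del: index_mult_mat)
    also have "\<dots> = (cmod (V $$ (j,k)))\<^sup>2" using ij by simp
    also have "\<dots> \<le> (\<Sum>l<n. (cmod (V $$ (j,l)))\<^sup>2)"
      using k by (intro member_le_sum) auto
    also have "\<dots> = 1" using unitary_row_norm[OF V] ij by simp
    finally show "(\<Sum>l<n. (cmod ((adj V * E) $$ (k,l)))\<^sup>2) \<le> 1" .
  qed
  from cmod_trace_mult_le[OF this X] have "cmod (trace (E * X)) \<le> trace_norm X" .
  also have "trace (E * X) = (\<Sum>a<n. \<Sum>l<n. if l = i then (if a = j then X $$ (i,j) else 0) else 0)"
    unfolding trace_mult_eq[OF Ec X] by (intro sum.cong refl) (auto simp: E_def)
  finally show ?thesis using ij by simp
qed

text \<open>Evaluating the quadratic form at the columns of \<open>V\<close> shows that the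
  eigenvalues are non-negative. The Gram matrix has their squares as eigenvalues, so the singular
  values are the eigenvalues themselves and add up to the trace.\<close>

lemma trace_norm_psd:
  assumes A: "psd n A"
  shows "complex_of_real (trace_norm A) = trace A"
proof -
  have h: "hermitian n A" and
    pos: "0 \<le> Re (\<Sum>i<n. \<Sum>j<n. cnj (v i) * A $$ (i,j) * v j)" for v :: "nat \<Rightarrow> complex"
    using A by (auto simp: psd_def)
  obtain V f where V: "unitary n V" and eq: "A = V * dmat n (\<lambda>i. complex_of_real (f i)) * adj V"
    using spectral_theorem[OF h] by blast
  note c = unitaryD(1)[OF V]
  let ?F = "dmat n (\<lambda>i. complex_of_real (f i))"
  have Ac: "A \<in> carrier_mat n n" "adj A = A" using h by (auto simp: hermitian_def)
  have AF: "adj V * (A * V) = ?F"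
    unfolding eq using c unitaryD[OF V] by (simp add: mult_assoc_sq[of _ n] unitary_mult_cancel[OF V, of _ n])
  have f: "0 \<le> f i" if i: "i < n" for i
  proof -
    have "of_real (f i) = (adj V * (A * V)) $$ (i,i)" using i AF by simp
    also have "\<dots> = (\<Sum>k<n. cnj (V $$ (k,i)) * (\<Sum>l<n. A $$ (k,l) * V $$ (l,i)))"
      using c Ac i by (subst index_mult_sum[of _ n n _ n])
        (auto simp: index_mult_sum[of A n n V n] simp del: index_mult_mat intro!: sum.cong)
    also have "\<dots> = (\<Sum>k<n. \<Sum>l<n. cnj (V $$ (k,i)) * A $$ (k,l) * V $$ (l,i))"
      by (simp add: sum_distrib_left mult.assoc)
    finally have "Re (of_real (f i)) \<ge> 0" using pos[of "\<lambda>k. V $$ (k,i)"] by simp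
    thus ?thesis by simp
  qed
  have "adj A * A = V * dmat n (\<lambda>i. complex_of_real ((f i)\<^sup>2)) * adj V"
  proof -
    have "adj A * A = V * (?F * ?F) * adj V"
      unfolding Ac(2) using c unfolding eq
      by (simp add: mult_assoc_sq[of _ n] unitary_mult_cancel[OF V, of _ n])
    thus ?thesis by (simp add: dmat_mult power2_eq_square)
  qed
  from trace_norm_eq[OF V this] have "trace_norm A = (\<Sum>i<n. f i)" using f by simp
  moreover have "trace A = (\<Sum>i<n. of_real (f i))"
  proof -
    have "trace A = trace (A * V * adj V)"
      using c Ac unitaryD[OF V] by (simp add: mult_assoc_sq[of _ n])
    also have "\<dots> = trace (adj V * (A * V))" using c Ac by (intro trace_comm) auto
    also have "\<dots> = (\<Sum>i<n. of_real (f i))" unfolding AF by (subst trace_eq[of _ n]) auto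
    finally show ?thesis .
  qed
  ultimately show ?thesis by simp
qed

section \<open>Kronecker products\<close>

text \<open>\<open>kron\<close> encodes a pair of tensor indices (a,b) as a * n + b. Decoding by
  \<open>div\<close> and \<open>mod\<close> turns a sum over the composite index into a double
  sum.\<close>

lemma sum_div_mod:
  fixes f :: "nat \<Rightarrow> nat \<Rightarrow> 'a :: comm_monoid_add"
  shows "(\<Sum>l<m * n. f (l div n) (l mod n)) = (\<Sum>a<m. \<Sum>b<n. f a b)"
proof (cases "n = 0")
  case False
  have "(\<Sum>l<m * n. f (l div n) (l mod n)) = (\<Sum>a<m. \<Sum>l\<in>{a * n..<a * n + n}. f (l div n) (l mod n))"
    by (rule sum.nat_group[symmetric])
  also have "\<dots> = (\<Sum>a<m. \<Sum>b<n. f a b)"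
  proof (rule sum.cong[OF refl])
    fix a
    have "(\<Sum>l\<in>{a * n..<a * n + n}. f (l div n) (l mod n)) = (\<Sum>b\<in>{0..<n}. f ((b + a * n) div n) ((b + a * n) mod n))"
      using sum.shift_bounds_nat_ivl[of "\<lambda>l. f (l div n) (l mod n)" 0 "a * n" n] by (simp add: add.commute)
    also have "\<dots> = (\<Sum>b<n. f a b)"
      by (auto simp: lessThan_atLeast0 intro!: sum.cong)
    finally show "(\<Sum>l\<in>{a * n..<a * n + n}. f (l div n) (l mod n)) = (\<Sum>b<n. f a b)" .
  qed
  finally show ?thesis .
qed simp

lemma mod_less_mult: "(i::nat) < m * n \<Longrightarrow> i mod n < n"
  by (cases "n = 0") auto

lemma div_less_mult: "(i::nat) < m * n \<Longrightarrow> i div n < m"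
  by (simp add: less_mult_imp_div_less)

lemma kron_carrier [simp]:
  "A \<in> carrier_mat m n \<Longrightarrow> B \<in> carrier_mat k l \<Longrightarrow> kron A B \<in> carrier_mat (m * k) (n * l)"
  by (auto simp: kron_def)

lemma kron_dim [simp]: "dim_row (kron A B) = dim_row A * dim_row B" "dim_col (kron A B) = dim_col A * dim_col B"
  by (simp_all add: kron_def)

lemma kron_index:
  "A \<in> carrier_mat m n \<Longrightarrow> B \<in> carrier_mat k l \<Longrightarrow> i < m * k \<Longrightarrow> j < n * l \<Longrightarrow>
   kron A B $$ (i,j) = A $$ (i div k, j div l) * B $$ (i mod k, j mod l)"
  by (auto simp: kron_def)

lemma kron_mult:
  assumes "A \<in> carrier_mat m m" "C \<in> carrier_mat m m" "B \<in> carrier_mat k k" "D \<in> carrier_mat k k"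
  shows "kron A B * kron C D = kron (A * C) (B * D)"
proof (intro eq_matI)
  fix i j assume "i < dim_row (kron (A * C) (B * D))" "j < dim_col (kron (A * C) (B * D))"
  hence ij: "i < m * k" "j < m * k" using assms by auto
  hence ij': "i div k < m" "j div k < m" "i mod k < k" "j mod k < k"
    by (auto intro: mod_less_mult div_less_mult)
  have "(kron A B * kron C D) $$ (i,j) = (\<Sum>l<m * k. kron A B $$ (i,l) * kron C D $$ (l,j))"
    using assms ij by (subst index_mult_sum[of _ "m * k" "m * k" _ "m * k"]) auto
  also have "\<dots> = (\<Sum>l<m * k. (A $$ (i div k, l div k) * B $$ (i mod k, l mod k)) *
      (C $$ (l div k, j div k) * D $$ (l mod k, j mod k)))"
    using assms ij by (intro sum.cong refl) (simp add: kron_index[of _ m m _ k k])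
  also have "\<dots> = (\<Sum>a<m. \<Sum>b<k. (A $$ (i div k, a) * B $$ (i mod k, b)) *
      (C $$ (a, j div k) * D $$ (b, j mod k)))"
    by (rule sum_div_mod)
  also have "\<dots> = (\<Sum>a<m. A $$ (i div k, a) * C $$ (a, j div k)) * (\<Sum>b<k. B $$ (i mod k, b) * D $$ (b, j mod k))"
    by (simp add: sum_product mult_ac)
  also have "\<dots> = (A * C) $$ (i div k, j div k) * (B * D) $$ (i mod k, j mod k)"
    using assms ij' by (simp add: index_mult_sum[of _ m m _ m] index_mult_sum[of _ k k _ k] del: index_mult_mat)
  also have "\<dots> = kron (A * C) (B * D) $$ (i,j)"
    using assms ij by (simp add: kron_index[of _ m m _ k k] del: index_mult_mat)
  finally show "(kron A B * kron C D) $$ (i,j) = kron (A * C) (B * D) $$ (i,j)" .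
qed (use assms in auto)

lemma kron_adj: "adj (kron A B) = kron (adj A) (adj B)"
  by (intro eq_matI) (auto simp: kron_def mod_less_mult div_less_mult)

lemma kron_one: "kron (1\<^sub>m m) (1\<^sub>m k) = 1\<^sub>m (m * k)"
  by (intro eq_matI)
    (auto simp: kron_def mod_less_mult div_less_mult, metis div_mult_mod_eq)

lemma trace_kron:
  assumes "A \<in> carrier_mat m m" "B \<in> carrier_mat k k"
  shows "trace (kron A B) = trace A * trace B"
proof -
  have "trace (kron A B) = (\<Sum>i<m * k. A $$ (i div k, i div k) * B $$ (i mod k, i mod k))"
    using assms by (subst trace_eq[of _ "m * k"]) (auto simp: kron_index[of _ m m _ k k])
  also have "\<dots> = (\<Sum>a<m. \<Sum>b<k. A $$ (a,a) * B $$ (b,b))" by (rule sum_div_mod)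
  finally show ?thesis using assms by (simp add: trace_eq[of _ m] trace_eq[of _ k] sum_product)
qed

lemma kron_smult_left: "kron (c \<cdot>\<^sub>m A) B = c \<cdot>\<^sub>m kron A B"
  by (intro eq_matI) (auto simp: kron_def mod_less_mult div_less_mult)

lemma kron_smult_right: "kron A (c \<cdot>\<^sub>m B) = c \<cdot>\<^sub>m kron A B"
  by (intro eq_matI) (auto simp: kron_def mod_less_mult div_less_mult)

lemma kron_add_left:
  "A \<in> carrier_mat m m \<Longrightarrow> C \<in> carrier_mat m m \<Longrightarrow> kron (A + C) B = kron A B + kron C B"
  by (intro eq_matI) (auto simp: kron_def mod_less_mult div_less_mult distrib_right)

lemma kron_add_right:
  "B \<in> carrier_mat m m \<Longrightarrow> C \<in> carrier_mat m m \<Longrightarrow> kron A (B + C) = kron A B + kron A C"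
  by (intro eq_matI) (auto simp: kron_def mod_less_mult div_less_mult distrib_left)

lemma kron_list_carrier:
  "(\<And>x. x \<in> set xs \<Longrightarrow> f x \<in> carrier_mat 2 2) \<Longrightarrow>
    kron_list (map f xs) \<in> carrier_mat (2 ^ length xs) (2 ^ length xs)"
  by (induction xs) auto

lemma kron_list_mult:
  assumes "\<And>x. x \<in> set xs \<Longrightarrow> f x \<in> carrier_mat 2 2" "\<And>x. x \<in> set xs \<Longrightarrow> g x \<in> carrier_mat 2 2"
  shows "kron_list (map f xs) * kron_list (map g xs) = kron_list (map (\<lambda>x. f x * g x) xs)"
  using assms
proof (induction xs)
  case (Cons x xs)
  thus ?case
    by (simp add: kron_mult[of _ 2 _ _ "2 ^ length xs"] kron_list_carrier)
qed auto

lemma kron_list_adj: "adj (kron_list (map f xs)) = kron_list (map (\<lambda>x. adj (f x)) xs)"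
  by (induction xs) (auto simp: kron_adj)

text \<open>Additivity in one tensor slot. Slots are addressed by function update, so the list has
  to be distinct for the slot to occur only once.\<close>

lemma kron_list_update_add:
  assumes "\<And>x. f x \<in> carrier_mat 2 2" "A \<in> carrier_mat 2 2" "B \<in> carrier_mat 2 2"
    "distinct xs" "c \<in> set xs"
  shows "kron_list (map (f(c := A + B)) xs) = kron_list (map (f(c := A)) xs) + kron_list (map (f(c := B)) xs)"
  using assms(4,5)
proof (induction xs)
  case (Cons x xs)
  show ?case
  proof (cases "x = c")
    case True
    hence eq: "map (f(c := M)) xs = map f xs" for M using Cons.prems by auto
    show ?thesis using True assms by (simp add: kron_add_left[of _ 2] eq fun_upd_same del: fun_upd_apply)
  next
    case False
    thus ?thesis using Cons assms
      by (simp add: kron_add_right[of _ "2 ^ length xs"] kron_list_carrier)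
  qed
qed auto

lemma kron_list_update_smult:
  assumes "distinct xs" "c \<in> set xs"
  shows "kron_list (map (f(c := z \<cdot>\<^sub>m A)) xs) = z \<cdot>\<^sub>m kron_list (map (f(c := A)) xs)"
  using assms
proof (induction xs)
  case (Cons x xs)
  show ?case
  proof (cases "x = c")
    case True
    hence eq: "map (f(c := M)) xs = map f xs" for M using Cons.prems by auto
    show ?thesis using True by (simp add: kron_smult_left eq fun_upd_same del: fun_upd_apply)
  next
    case False
    thus ?thesis using Cons by (simp add: kron_smult_right)
  qed
qed auto

lemma sum_lists_Suc:
  fixes g :: "'b :: finite list \<Rightarrow> 'c :: comm_monoid_add"
  shows "(\<Sum>a | length a = Suc n. g a) = (\<Sum>x\<in>UNIV. \<Sum>a | length a = n. g (x # a))"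
proof -
  have eq: "{a :: 'b list. length a = Suc n} = (\<lambda>(x,a). x # a) ` (UNIV \<times> {a. length a = n})"
    by (auto simp: length_Suc_conv)
  show ?thesis unfolding eq
    by (subst sum.reindex) (auto simp: inj_on_def sum.cartesian_product split_def)
qed

lemma finite_lists_length: "finite {a :: 'b :: finite list. length a = n}"
  using finite_lists_length_eq[of "UNIV :: 'b set" n] by simp

text \<open>Completeness relations multiply over tensor factors. The flag \<open>q\<close> lets one
  induction cover two families: \<open>q = True\<close> is completeness in all matrices, for the
  Pauli matrices; \<open>q = False\<close> is completeness in the diagonal matrices, for products of
  1 and Z.\<close>

lemma kron_list_complete:
  fixes F :: "'b :: finite \<Rightarrow> complex mat"
  assumes F: "\<And>x. F x \<in> carrier_mat 2 2"
    and c: "\<And>i j k l. i < 2 \<Longrightarrow> j < 2 \<Longrightarrow> k < 2 \<Longrightarrow> l < 2 \<Longrightarrow>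
      (\<Sum>x\<in>UNIV. F x $$ (i,j) * cnj (F x $$ (k,l))) = (if i = k \<and> j = l \<and> (q \<or> i = j) then 2 else 0)"
  shows "i < 2 ^ n \<Longrightarrow> j < 2 ^ n \<Longrightarrow> k < 2 ^ n \<Longrightarrow> l < 2 ^ n \<Longrightarrow>
    (\<Sum>a | length a = n. kron_list (map F a) $$ (i,j) * cnj (kron_list (map F a) $$ (k,l)))
     = (if i = k \<and> j = l \<and> (q \<or> i = j) then 2 ^ n else 0)"
proof (induction n arbitrary: i j k l)
  case (Suc n)
  let ?d = "2 ^ n :: nat"
  let ?K = "\<lambda>a. kron_list (map F a)"
  have lt: "m div ?d < 2" "m mod ?d < ?d" if "m < 2 ^ Suc n" for m
    using that by (simp_all add: less_mult_imp_div_less)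
  have idx: "?K (x # a) $$ (u,v) = F x $$ (u div ?d, v div ?d) * ?K a $$ (u mod ?d, v mod ?d)"
    if "length a = n" "u < 2 ^ Suc n" "v < 2 ^ Suc n" for x a u v
    using that F kron_list_carrier[of a F] by (simp add: kron_index[of _ 2 2 _ ?d ?d])
  have eqdm: "u = v \<longleftrightarrow> u div ?d = v div ?d \<and> u mod ?d = v mod ?d" for u v
    by (metis div_mult_mod_eq)
  have "(\<Sum>a | length a = Suc n. ?K a $$ (i,j) * cnj (?K a $$ (k,l))) =
     (\<Sum>x\<in>UNIV. \<Sum>a | length a = n. (F x $$ (i div ?d, j div ?d) * cnj (F x $$ (k div ?d, l div ?d))) *
       (?K a $$ (i mod ?d, j mod ?d) * cnj (?K a $$ (k mod ?d, l mod ?d))))"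
    unfolding sum_lists_Suc using Suc.prems by (intro sum.cong refl) (auto simp only: idx mem_Collect_eq complex_cnj_mult mult_ac)
  also have "\<dots> = (\<Sum>x\<in>UNIV. F x $$ (i div ?d, j div ?d) * cnj (F x $$ (k div ?d, l div ?d))) *
     (\<Sum>a | length a = n. ?K a $$ (i mod ?d, j mod ?d) * cnj (?K a $$ (k mod ?d, l mod ?d)))"
    by (simp add: sum_product)
  also have "\<dots> = (if i div ?d = k div ?d \<and> j div ?d = l div ?d \<and> (q \<or> i div ?d = j div ?d) then 2 else 0) *
     (if i mod ?d = k mod ?d \<and> j mod ?d = l mod ?d \<and> (q \<or> i mod ?d = j mod ?d) then 2 ^ n else 0)"
    using Suc.prems lt by (subst c, blast, blast, blast, blast, subst Suc.IH) auto
  also have "\<dots> = (if i = k \<and> j = l \<and> (q \<or> i = j) then 2 ^ Suc n else 0)"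
    unfolding eqdm[of i k] eqdm[of j l] eqdm[of i j] by auto
  finally show ?case .
qed auto

section \<open>Two-by-two matrices and the single-qubit Pauli matrices\<close>

lemma less_2_cases': "(i::nat) < 2 \<longleftrightarrow> i = 0 \<or> i = 1" by auto

lemma mat2_eqI:
  assumes "A \<in> carrier_mat 2 2" "B \<in> carrier_mat 2 2"
    "A $$ (0,0) = B $$ (0,0)" "A $$ (0,1) = B $$ (0,1)" "A $$ (1,0) = B $$ (1,0)" "A $$ (1,1) = B $$ (1,1)"
  shows "A = B"
  using assms by (intro eq_matI) (auto simp: less_2_cases')

lemma mult2_index:
  "A \<in> carrier_mat 2 2 \<Longrightarrow> B \<in> carrier_mat 2 2 \<Longrightarrow> i < 2 \<Longrightarrow> j < 2 \<Longrightarrow>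
    (A * B) $$ (i,j) = A $$ (i,0) * B $$ (0,j) + A $$ (i,1) * B $$ (1,j)"
  by (subst index_mult_sum[of _ 2 2 _ 2]) (auto simp: numeral_2_eq_2)

lemma mat2_carrier [simp]:
  "Xm \<in> carrier_mat 2 2" "Ym \<in> carrier_mat 2 2" "Zm \<in> carrier_mat 2 2" "Hm \<in> carrier_mat 2 2"
  "Sm \<in> carrier_mat 2 2" "P0 \<in> carrier_mat 2 2" "P1 \<in> carrier_mat 2 2"
  by (auto simp: Xm_def Ym_def Zm_def Hm_def Sm_def P0_def P1_def mat_of_rows_list_def)

lemma mat2_dim [simp]:
  "dim_row Xm = 2" "dim_row Ym = 2" "dim_row Zm = 2" "dim_row Hm = 2" "dim_row Sm = 2" "dim_row P0 = 2" "dim_row P1 = 2"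
  "dim_col Xm = 2" "dim_col Ym = 2" "dim_col Zm = 2" "dim_col Hm = 2" "dim_col Sm = 2" "dim_col P0 = 2" "dim_col P1 = 2"
  using mat2_carrier by (metis carrier_matD)+

lemma mat2_index:
  "Xm $$ (0,0) = 0" "Xm $$ (0,Suc 0) = 1" "Xm $$ (Suc 0,0) = 1" "Xm $$ (Suc 0,Suc 0) = 0"
  "Ym $$ (0,0) = 0" "Ym $$ (0,Suc 0) = -\<i>" "Ym $$ (Suc 0,0) = \<i>" "Ym $$ (Suc 0,Suc 0) = 0"
  "Zm $$ (0,0) = 1" "Zm $$ (0,Suc 0) = 0" "Zm $$ (Suc 0,0) = 0" "Zm $$ (Suc 0,Suc 0) = -1"
  "Hm $$ (0,0) = 1/sqrt 2" "Hm $$ (0,Suc 0) = 1/sqrt 2" "Hm $$ (Suc 0,0) = 1/sqrt 2" "Hm $$ (Suc 0,Suc 0) = -1/sqrt 2"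
  "Sm $$ (0,0) = 1" "Sm $$ (0,Suc 0) = 0" "Sm $$ (Suc 0,0) = 0" "Sm $$ (Suc 0,Suc 0) = \<i>"
  "P0 $$ (0,0) = 1" "P0 $$ (0,Suc 0) = 0" "P0 $$ (Suc 0,0) = 0" "P0 $$ (Suc 0,Suc 0) = 0"
  "P1 $$ (0,0) = 0" "P1 $$ (0,Suc 0) = 0" "P1 $$ (Suc 0,0) = 0" "P1 $$ (Suc 0,Suc 0) = 1"
  by (simp_all add: Xm_def Ym_def Zm_def Hm_def Sm_def P0_def P1_def mat_of_rows_list_def)

lemma sigma1_carrier [simp]: "sigma1 s \<in> carrier_mat 2 2"
  by (cases s rule: sigma1.cases) auto

lemma sigma1_dim [simp]: "dim_row (sigma1 s) = 2" "dim_col (sigma1 s) = 2"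
  using sigma1_carrier by (metis carrier_matD)+

lemma trace2: "A \<in> carrier_mat 2 2 \<Longrightarrow> trace A = A $$ (0,0) + A $$ (1,1)"
  by (simp add: trace_eq[of _ 2] numeral_2_eq_2)

lemma sigma1_adj [simp]: "adj (sigma1 s) = sigma1 s"
  by (cases s rule: sigma1.cases; intro mat2_eqI) (auto simp: mat2_index)

lemma sigma1_sq [simp]: "sigma1 s * sigma1 s = 1\<^sub>m 2"
  by (cases s rule: sigma1.cases; intro mat2_eqI) (auto simp: mult2_index mat2_index simp del: index_mult_mat(1))

lemma sigma1_orth: "trace (sigma1 s * sigma1 t) = (if s = t then 2 else 0)"
  by (cases s rule: sigma1.cases; cases t rule: sigma1.cases)
   (auto simp: trace2 mult2_index mat2_index simp del: index_mult_mat(1))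

text \<open>The sign is the symplectic form of the two labels, which decides whether the matrices
  commute or anticommute.\<close>

lemma sigma1_conj: "\<exists>u\<in>{1,-1}. sigma1 s * sigma1 t * sigma1 s = u \<cdot>\<^sub>m sigma1 t"
proof
  show "sigma1 s * sigma1 t * sigma1 s
      = (if (fst s \<and> snd t) = (snd s \<and> fst t) then 1 else -1) \<cdot>\<^sub>m sigma1 t"
    by (cases s rule: sigma1.cases; cases t rule: sigma1.cases; rule mat2_eqI)
      (auto simp: mult2_index mat2_index simp del: index_mult_mat(1))
qed auto

section \<open>Pauli matrices\<close>

lemma labels_iff: "a \<in> labels n \<longleftrightarrow> length a = n"
  by (simp add: labels_def)

lemma finite_labels [simp]: "finite (labels n)"
  by (simp add: labels_def finite_lists_length)

lemma labels_nonempty [simp]: "labels n \<noteq> {}"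
  using Ex_list_of_length by (auto simp: labels_def)

lemma finite_bitstrings [simp]: "finite (bitstrings n)"
  by (simp add: bitstrings_def finite_lists_length)

lemma pauli_carrier: "a \<in> labels n \<Longrightarrow> pauli a \<in> carrier_mat (2^n) (2^n)"
  using kron_list_carrier[of a sigma1] by (simp add: pauli_def labels_iff)

lemma pauli_adj [simp]: "adj (pauli a) = pauli a"
  by (simp add: pauli_def kron_list_adj)

lemma pauli_sq: "a \<in> labels n \<Longrightarrow> pauli a * pauli a = 1\<^sub>m (2^n)"
  unfolding labels_iff
proof (induction a arbitrary: n)
  case (Cons s a)
  let ?d = "2 ^ length a"
  have "pauli (s # a) * pauli (s # a) = kron (sigma1 s * sigma1 s) (pauli a * pauli a)"
    using pauli_carrier[of a "length a"] unfolding pauli_def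
    by (simp add: kron_mult[of _ 2 _ _ ?d] labels_iff)
  thus ?case using Cons.IH[OF refl] Cons.prems by (auto simp: kron_one)
qed (simp add: pauli_def)

lemma pauli_unitary: "a \<in> labels n \<Longrightarrow> unitary (2^n) (pauli a)"
  by (simp add: unitary_def pauli_carrier pauli_sq)

lemma pauli_orth:
  "a \<in> labels n \<Longrightarrow> b \<in> labels n \<Longrightarrow> trace (pauli a * pauli b) = (if a = b then 2^n else 0)"
proof -
  have "length a = length b \<Longrightarrow> trace (pauli a * pauli b) = (if a = b then 2 ^ length a else 0)"
  proof (induction a b rule: list_induct2)
    case (Cons s a t b)
    let ?d = "2 ^ length a"
    have c: "pauli a \<in> carrier_mat ?d ?d" "pauli b \<in> carrier_mat ?d ?d"
      using pauli_carrier[of a "length a"] pauli_carrier[of b "length a"] Cons by (auto simp: labels_iff)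
    have "pauli (s # a) * pauli (t # b) = kron (sigma1 s * sigma1 t) (pauli a * pauli b)"
      using c unfolding pauli_def by (simp add: kron_mult[of _ 2 _ _ ?d])
    also have "trace \<dots> = trace (sigma1 s * sigma1 t) * trace (pauli a * pauli b)"
      using c by (intro trace_kron[of _ 2 _ ?d]) auto
    finally show ?case using Cons.IH by (simp add: sigma1_orth)
  qed (simp add: pauli_def trace_def)
  thus "a \<in> labels n \<Longrightarrow> b \<in> labels n \<Longrightarrow> ?thesis" by (simp add: labels_iff)
qed

lemma pauli_conj:
  assumes "a \<in> labels n" "b \<in> labels n"
  shows "\<exists>u\<in>{1,-1}. pauli a * pauli b * pauli a = u \<cdot>\<^sub>m pauli b"
proof -
  have "length a = length b" using assms by (simp add: labels_iff)
  thus ?thesis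
  proof (induction a b rule: list_induct2)
    case (Cons s a t b)
    let ?d = "2 ^ length a"
    have c: "pauli a \<in> carrier_mat ?d ?d" "pauli b \<in> carrier_mat ?d ?d"
      using pauli_carrier[of a "length a"] pauli_carrier[of b "length a"] Cons by (auto simp: labels_iff)
    obtain u v where uv: "u \<in> {1,-1}" "v \<in> {1,-1}" "sigma1 s * sigma1 t * sigma1 s = u \<cdot>\<^sub>m sigma1 t"
      "pauli a * pauli b * pauli a = v \<cdot>\<^sub>m pauli b"
      using Cons.IH sigma1_conj[of s t] by blast
    have "pauli (s # a) * pauli (t # b) * pauli (s # a)
        = kron (sigma1 s * sigma1 t * sigma1 s) (pauli a * pauli b * pauli a)"
      using c unfolding pauli_def by (simp add: kron_mult[of _ 2 _ _ ?d])
    also have "\<dots> = (u * v) \<cdot>\<^sub>m pauli (t # b)"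
      unfolding uv kron_smult_left kron_smult_right by (intro eq_matI) (auto simp: pauli_def)
    finally show ?case using uv by auto
  qed (auto simp: pauli_def intro: eq_matI)
qed

lemma Zz_eq_pauli: "Zz z = pauli (map (\<lambda>b. (b, False)) z)"
proof -
  have "(\<lambda>b. if b then Zm else 1\<^sub>m 2) = sigma1 \<circ> (\<lambda>b. (b, False))" by (auto simp: fun_eq_iff)
  thus ?thesis by (simp add: Zz_def pauli_def)
qed

lemma Zz_adj [simp]: "adj (Zz z) = Zz z"
  by (simp add: Zz_eq_pauli)

lemma UNIV_labels1: "(UNIV :: (bool \<times> bool) set) = {(False,False),(False,True),(True,True),(True,False)}"
  by auto

lemma pauli_complete:
  assumes "i < 2 ^ n" "j < 2 ^ n" "k < 2 ^ n" "l < 2 ^ n"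
  shows "(\<Sum>a\<in>labels n. pauli a $$ (i,j) * cnj (pauli a $$ (k,l))) = (if i = k \<and> j = l then 2 ^ n else 0)"
proof -
  have "(\<Sum>a | length a = n. kron_list (map sigma1 a) $$ (i,j) * cnj (kron_list (map sigma1 a) $$ (k,l)))
     = (if i = k \<and> j = l \<and> (True \<or> i = j) then 2 ^ n else 0)"
    by (rule kron_list_complete) (use assms in \<open>auto simp: UNIV_labels1 less_2_cases' mat2_index\<close>)
  thus ?thesis by (simp add: labels_def pauli_def)
qed

lemma Zz_complete:
  assumes "i < 2 ^ n" "j < 2 ^ n" "k < 2 ^ n" "l < 2 ^ n"
  shows "(\<Sum>z\<in>bitstrings n. Zz z $$ (i,j) * cnj (Zz z $$ (k,l))) = (if i = k \<and> j = l \<and> i = j then 2 ^ n else 0)"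
proof -
  let ?F = "\<lambda>b. if b then Zm else 1\<^sub>m 2"
  have "(\<Sum>a | length a = n. kron_list (map ?F a) $$ (i,j) * cnj (kron_list (map ?F a) $$ (k,l)))
     = (if i = k \<and> j = l \<and> (False \<or> i = j) then 2 ^ n else 0)"
    by (rule kron_list_complete) (use assms in \<open>auto simp: UNIV_bool less_2_cases' mat2_index\<close>)
  thus ?thesis by (simp add: bitstrings_def Zz_def)
qed

text \<open>A completeness relation, contracted with \<open>C\<close>, becomes the orthogonal
  projection onto the span of the family, up to the factor \<open>c\<close>. The predicate
  \<open>q\<close> marks the positions that survive: all of them for the Pauli matrices, the
  diagonal for the Z products.\<close>

lemma expand_complete:
  assumes f: "\<And>x. x \<in> I \<Longrightarrow> f x \<in> carrier_mat d d" "\<And>x. x \<in> I \<Longrightarrow> adj (f x) = f x"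
    and c: "\<And>i j k l. i < d \<Longrightarrow> j < d \<Longrightarrow> k < d \<Longrightarrow> l < d \<Longrightarrow>
      (\<Sum>x\<in>I. f x $$ (i,j) * cnj (f x $$ (k,l))) = (if i = k \<and> j = l \<and> q i j then c else 0)"
    and C: "C \<in> carrier_mat d d" and ij: "i < d" "j < d"
  shows "(\<Sum>x\<in>I. trace (f x * C) * f x $$ (i,j)) = (if q i j then c * C $$ (i,j) else 0)"
proof -
  have h: "f x $$ (k,l) = cnj (f x $$ (l,k))" if "x \<in> I" "k < d" "l < d" for x k l
    using carrier_matD[OF f(1)[OF that(1)]] index_adj[of k "f x" l] that(2,3) by (simp add: f(2)[OF that(1)])
  have "(\<Sum>x\<in>I. trace (f x * C) * f x $$ (i,j))
      = (\<Sum>x\<in>I. \<Sum>k<d. \<Sum>l<d. (f x $$ (i,j) * cnj (f x $$ (l,k))) * C $$ (l,k))"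
  proof (rule sum.cong[OF refl])
    fix x assume x: "x \<in> I"
    have "trace (f x * C) = (\<Sum>k<d. \<Sum>l<d. cnj (f x $$ (l,k)) * C $$ (l,k))"
      unfolding trace_mult_eq[OF f(1)[OF x] C] by (intro sum.cong refl) (simp add: h[OF x, symmetric])
    thus "trace (f x * C) * f x $$ (i,j) = (\<Sum>k<d. \<Sum>l<d. (f x $$ (i,j) * cnj (f x $$ (l,k))) * C $$ (l,k))"
      by (simp add: sum_distrib_right sum_distrib_left mult_ac)
  qed
  also have "\<dots> = (\<Sum>k<d. \<Sum>x\<in>I. \<Sum>l<d. (f x $$ (i,j) * cnj (f x $$ (l,k))) * C $$ (l,k))"
    by (rule sum.swap)
  also have "\<dots> = (\<Sum>k<d. \<Sum>l<d. \<Sum>x\<in>I. (f x $$ (i,j) * cnj (f x $$ (l,k))) * C $$ (l,k))"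
    by (rule sum.cong[OF refl], rule sum.swap)
  also have "\<dots> = (\<Sum>k<d. \<Sum>l<d. if l = i then (if k = j then (if q i j then c * C $$ (i,j) else 0) else 0) else 0)"
    using ij by (intro sum.cong refl) (auto simp: c simp flip: sum_distrib_right)
  also have "\<dots> = (if q i j then c * C $$ (i,j) else 0)" using ij by simp
  finally show ?thesis .
qed

lemma pauli_expand:
  assumes "C \<in> carrier_mat (2^n) (2^n)"
  shows "C = msum (2^n) (\<lambda>a. (trace (pauli a * C) / 2^n) \<cdot>\<^sub>m pauli a) (labels n)"
proof (intro eq_matI)
  fix i j assume "i < dim_row (msum (2^n) (\<lambda>a. (trace (pauli a * C) / 2^n) \<cdot>\<^sub>m pauli a) (labels n))"
    "j < dim_col (msum (2^n) (\<lambda>a. (trace (pauli a * C) / 2^n) \<cdot>\<^sub>m pauli a) (labels n))"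
  hence ij: "i < 2^n" "j < 2^n" by auto
  have "(\<Sum>a\<in>labels n. trace (pauli a * C) * pauli a $$ (i,j)) = 2^n * C $$ (i,j)"
    using expand_complete[of "labels n" pauli "2^n" "\<lambda>_ _. True" "2^n" C i j] assms ij
    by (simp add: pauli_carrier pauli_complete)
  moreover have "msum (2^n) (\<lambda>a. (trace (pauli a * C) / 2^n) \<cdot>\<^sub>m pauli a) (labels n) $$ (i,j)
     = (\<Sum>a\<in>labels n. trace (pauli a * C) * pauli a $$ (i,j)) / 2^n"
    using ij carrier_matD[OF pauli_carrier]
    by (auto simp: sum_divide_distrib intro!: sum.cong)
  ultimately show "C $$ (i,j) = msum (2^n) (\<lambda>a. (trace (pauli a * C) / 2^n) \<cdot>\<^sub>m pauli a) (labels n) $$ (i,j)"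
    by simp
qed (use assms in auto)

section \<open>The measurement map expanded in products of Z\<close>

lemma Ebas_index: "i < d \<Longrightarrow> j < d \<Longrightarrow> Ebas d x $$ (i,j) = (if i = x \<and> j = x then 1 else 0)"
  by (simp add: Ebas_def)

lemma Ebas_dim [simp]: "dim_row (Ebas d x) = d" "dim_col (Ebas d x) = d"
  by (simp_all add: Ebas_def)

lemma hs_Ebas:
  assumes "C \<in> carrier_mat d d" "x < d"
  shows "hs_inner (Ebas d x) C = C $$ (x,x)"
proof -
  have E: "adj (Ebas d x) \<in> carrier_mat d d" by (auto simp: Ebas_def)
  have "hs_inner (Ebas d x) C = (\<Sum>k<d. \<Sum>l<d. if l = x then (if k = x then C $$ (x,x) else 0) else 0)"
    unfolding hs_inner_def trace_mult_eq[OF E assms(1)]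
    by (intro sum.cong refl) (auto simp: Ebas_def)
  thus ?thesis using assms by simp
qed

lemma Mmap_carrier [simp]: "Mmap d C \<in> carrier_mat d d"
  by (simp add: Mmap_def)

lemma Zz_carrier: "z \<in> bitstrings n \<Longrightarrow> Zz z \<in> carrier_mat (2^n) (2^n)"
  by (simp add: Zz_eq_pauli pauli_carrier labels_iff bitstrings_def)

text \<open>Both sides keep the diagonal of \<open>C\<close> and erase the rest. The products of 1
  and Z are an orthogonal basis of the diagonal matrices with squared norm 2^n, whence the
  divisor.\<close>

lemma Mmap_eq:
  assumes "C \<in> carrier_mat (2^n) (2^n)"
  shows "Mmap (2^n) C = msum (2^n) (\<lambda>z. (trace (Zz z * C) / 2^n) \<cdot>\<^sub>m Zz z) (bitstrings n)"
proof (intro eq_matI)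
  let ?M = "msum (2^n) (\<lambda>z. (trace (Zz z * C) / 2^n) \<cdot>\<^sub>m Zz z) (bitstrings n)"
  fix i j assume "i < dim_row ?M" "j < dim_col ?M"
  hence ij: "i < 2^n" "j < 2^n" by auto
  have "(\<Sum>z\<in>bitstrings n. trace (Zz z * C) * Zz z $$ (i,j)) = (if i = j then 2^n * C $$ (i,j) else 0)"
    using assms ij by (intro expand_complete) (auto simp: Zz_carrier Zz_complete)
  moreover have "?M $$ (i,j) = (\<Sum>z\<in>bitstrings n. trace (Zz z * C) * Zz z $$ (i,j)) / 2^n"
    using ij carrier_matD[OF Zz_carrier] by (auto simp: sum_divide_distrib intro!: sum.cong)
  moreover have "Mmap (2^n) C $$ (i,j) = (\<Sum>x<2^n. if x = i then (if i = j then C $$ (i,j) else 0) else 0)"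
    unfolding Mmap_def msum_index[OF ij] using ij assms
    by (intro sum.cong refl) (auto simp: hs_Ebas Ebas_index)
  ultimately show "Mmap (2^n) C $$ (i,j) = ?M $$ (i,j)" using ij by simp
qed (auto simp: Mmap_def)

text \<open>Conjugation is taken in the direction in which \<open>Xi\<close> uses it. The scalar is
  restricted to a sign, as in \<open>Xi\<close>, so the generators have to be shown to produce no
  factor of plus or minus i.\<close>

definition pauli_normalizer :: "nat \<Rightarrow> complex mat \<Rightarrow> bool" where
  "pauli_normalizer n U \<longleftrightarrow> U \<in> carrier_mat (2^n) (2^n) \<and>
     (\<forall>a\<in>labels n. \<exists>b\<in>labels n. \<exists>s\<in>{1,-1}. adj U * pauli a * U = s \<cdot>\<^sub>m pauli b)"

lemma pauli_normalizer_mult: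
  assumes "pauli_normalizer n U" "pauli_normalizer n V"
  shows "pauli_normalizer n (U * V)"
  unfolding pauli_normalizer_def
proof (intro conjI ballI)
  have c: "U \<in> carrier_mat (2^n) (2^n)" "V \<in> carrier_mat (2^n) (2^n)"
    using assms by (auto simp: pauli_normalizer_def)
  thus "U * V \<in> carrier_mat (2^n) (2^n)" by simp
  fix a assume a: "a \<in> labels n"
  obtain b s where b: "b \<in> labels n" "s \<in> {1,-1}" "adj U * pauli a * U = s \<cdot>\<^sub>m pauli b"
    using assms(1) a unfolding pauli_normalizer_def by blast
  obtain e t where e: "e \<in> labels n" "t \<in> {1,-1}" "adj V * pauli b * V = t \<cdot>\<^sub>m pauli e"
    using assms(2) b(1) unfolding pauli_normalizer_def by blast
  have "adj (U * V) * pauli a * (U * V) = adj V * (adj U * pauli a * U) * V"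
    using c pauli_carrier[OF a] by (simp add: adj_mult[of _ "2^n" "2^n" _ "2^n"] mult_assoc_sq[of _ "2^n"])
  also have "\<dots> = s \<cdot>\<^sub>m (adj V * pauli b * V)"
    unfolding b(3) using c pauli_carrier[OF b(1)]
    by (simp add: mult_smult_assoc_mat[of _ "2^n" "2^n" _ "2^n"] mult_smult_distrib[of _ "2^n" "2^n" _ "2^n"])
  also have "\<dots> = (s * t) \<cdot>\<^sub>m pauli e" unfolding e(3) by (intro eq_matI) auto
  finally show "\<exists>b\<in>labels n. \<exists>s\<in>{1,-1}. adj (U * V) * pauli a * (U * V) = s \<cdot>\<^sub>m pauli b"
    using b(2) e(1,2) by (intro bexI[of _ e] bexI[of _ "s * t"]; auto)
qed

lemma pauli_eq_upt: "length a = n \<Longrightarrow> pauli a = kron_list (map (\<lambda>k. sigma1 (a ! k)) [0..<n])"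
proof -
  assume "length a = n"
  hence "map sigma1 a = map (\<lambda>k. sigma1 (a ! k)) [0..<n]"
    by (intro nth_equalityI) simp_all
  thus ?thesis unfolding pauli_def by (rule arg_cong)
qed

lemma pauli_update:
  assumes "length a = n" "i < n"
  shows "kron_list (map ((\<lambda>k. sigma1 (a ! k))(i := sigma1 s)) [0..<n]) = pauli (a[i := s])"
proof -
  have "map ((\<lambda>k. sigma1 (a ! k))(i := sigma1 s)) [0..<n] = map sigma1 (a[i := s])"
    using assms by (intro nth_equalityI) (auto simp: nth_list_update)
  thus ?thesis by (simp add: pauli_def)
qed

text \<open>Conjugation acts factor by factor and leaves all slots but \<open>i\<close> alone, so a
  single-qubit check suffices; the sign is pulled out of slot \<open>i\<close>.\<close>

lemma embed1_normalizer:
  assumes U: "U \<in> carrier_mat 2 2" and i: "i < n"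
    and conj: "\<And>t. \<exists>b. \<exists>s\<in>{1,-1}. adj U * sigma1 t * U = s \<cdot>\<^sub>m sigma1 b"
  shows "pauli_normalizer n (embed1 n i U)"
  unfolding pauli_normalizer_def
proof (intro conjI ballI)
  show "embed1 n i U \<in> carrier_mat (2^n) (2^n)"
    unfolding embed1_def using kron_list_carrier[of "[0..<n]" "\<lambda>k. if k = i then U else 1\<^sub>m 2"] U by simp
  fix a assume "a \<in> labels n"
  hence a: "length a = n" by (simp add: labels_iff)
  obtain b s where b: "s \<in> {1,-1}" "adj U * sigma1 (a ! i) * U = s \<cdot>\<^sub>m sigma1 b" using conj by blast
  let ?f = "\<lambda>k. sigma1 (a ! k)"
  have "adj (embed1 n i U) * pauli a * embed1 n i U
     = kron_list (map (\<lambda>k. adj (if k = i then U else 1\<^sub>m 2) * ?f k * (if k = i then U else 1\<^sub>m 2)) [0..<n])"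
    unfolding embed1_def pauli_eq_upt[OF a] kron_list_adj using U
    by (subst kron_list_mult, simp, simp, subst kron_list_mult, simp_all)
  also have "(\<lambda>k. adj (if k = i then U else 1\<^sub>m 2) * ?f k * (if k = i then U else 1\<^sub>m 2)) = ?f(i := s \<cdot>\<^sub>m sigma1 b)"
    using b(2) by (intro ext) simp
  also have "kron_list (map \<dots> [0..<n]) = s \<cdot>\<^sub>m kron_list (map (?f(i := sigma1 b)) [0..<n])"
    using i by (intro kron_list_update_smult) auto
  also have "kron_list (map (?f(i := sigma1 b)) [0..<n]) = pauli (a[i := b])"
    by (rule pauli_update[OF a i])
  finally show "\<exists>b\<in>labels n. \<exists>s\<in>{1,-1}. adj (embed1 n i U) * pauli a * embed1 n i U = s \<cdot>\<^sub>m pauli b"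
    using b(1) a by (intro bexI[of _ "a[i := b]"] bexI[of _ s]) (simp_all add: labels_iff)
qed

section \<open>Clifford conjugation\<close>

lemma complex_sqrt2 [simp]: "complex_of_real (sqrt 2) * complex_of_real (sqrt 2) = 2"
  by (simp flip: of_real_mult)

text \<open>The Hadamard matrix exchanges X and Z and sends Y to -Y.\<close>

lemma Hm_conj: "\<exists>b. \<exists>s\<in>{1,-1}. adj Hm * sigma1 t * Hm = s \<cdot>\<^sub>m sigma1 b"
proof (cases t rule: sigma1.cases)
  case 1
  have "adj Hm * sigma1 t * Hm = 1 \<cdot>\<^sub>m sigma1 (False,False)"
    unfolding 1 by (rule mat2_eqI) (auto simp: mult2_index mat2_index field_simps simp del: index_mult_mat(1))
  thus ?thesis by blast
next
  case 2
  have "adj Hm * sigma1 t * Hm = 1 \<cdot>\<^sub>m sigma1 (True,False)"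
    unfolding 2 by (rule mat2_eqI) (auto simp: mult2_index mat2_index field_simps simp del: index_mult_mat(1))
  thus ?thesis by blast
next
  case 3
  have "adj Hm * sigma1 t * Hm = (-1) \<cdot>\<^sub>m sigma1 (True,True)"
    unfolding 3 by (rule mat2_eqI) (auto simp: mult2_index mat2_index field_simps simp del: index_mult_mat(1))
  thus ?thesis by blast
next
  case 4
  have "adj Hm * sigma1 t * Hm = 1 \<cdot>\<^sub>m sigma1 (False,True)"
    unfolding 4 by (rule mat2_eqI) (auto simp: mult2_index mat2_index field_simps simp del: index_mult_mat(1))
  thus ?thesis by blast
qed

text \<open>In this direction of conjugation the phase gate sends X to -Y and Y to X, and it fixes
  Z.\<close>

lemma Sm_conj: "\<exists>b. \<exists>s\<in>{1,-1}. adj Sm * sigma1 t * Sm = s \<cdot>\<^sub>m sigma1 b"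
proof (cases t rule: sigma1.cases)
  case 1
  have "adj Sm * sigma1 t * Sm = 1 \<cdot>\<^sub>m sigma1 (False,False)"
    unfolding 1 by (rule mat2_eqI) (auto simp: mult2_index mat2_index simp del: index_mult_mat(1))
  thus ?thesis by blast
next
  case 2
  have "adj Sm * sigma1 t * Sm = (-1) \<cdot>\<^sub>m sigma1 (True,True)"
    unfolding 2 by (rule mat2_eqI) (auto simp: mult2_index mat2_index simp del: index_mult_mat(1))
  thus ?thesis by blast
next
  case 3
  have "adj Sm * sigma1 t * Sm = 1 \<cdot>\<^sub>m sigma1 (False,True)"
    unfolding 3 by (rule mat2_eqI) (auto simp: mult2_index mat2_index simp del: index_mult_mat(1))
  thus ?thesis by blast
next
  case 4
  have "adj Sm * sigma1 t * Sm = 1 \<cdot>\<^sub>m sigma1 (True,False)"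
    unfolding 4 by (rule mat2_eqI) (auto simp: mult2_index mat2_index simp del: index_mult_mat(1))
  thus ?thesis by blast
qed

lemma P_adj [simp]: "adj P0 = P0" "adj P1 = P1" "adj Xm = Xm"
  by (auto intro!: mat2_eqI simp: mat2_index)

text \<open>The first component of a label says whether the Pauli matrix anticommutes with \<open>X\<close>, the second
  one whether it is off-diagonal.\<close>

lemma sigma1_X: "sigma1 r * Xm = (if fst r then -1 else 1) \<cdot>\<^sub>m (Xm * sigma1 r)"
  by (cases r rule: sigma1.cases; rule mat2_eqI) (auto simp: mult2_index mat2_index simp del: index_mult_mat(1))

lemma X_sigma1_X: "Xm * sigma1 r * Xm = (if fst r then -1 else 1) \<cdot>\<^sub>m sigma1 r"
  by (cases r rule: sigma1.cases; rule mat2_eqI) (auto simp: mult2_index mat2_index simp del: index_mult_mat(1))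

text \<open>A diagonal control matrix has no part between the two control states. The bit
  \<open>e\<close> stands for the sign that the target acquires from conjugation by X; on the P1
  part it amounts to an additional factor Z on the control.\<close>

lemma P_sigma1_diag:
  assumes "\<not> snd s"
  shows "P0 * sigma1 s * P1 = 0\<^sub>m 2 2" "P1 * sigma1 s * P0 = 0\<^sub>m 2 2"
    "P0 * sigma1 s * P0 + (if e then -1 else 1) \<cdot>\<^sub>m (P1 * sigma1 s * P1) = sigma1 (fst s \<noteq> e, False)"
  using assms
  by (cases s rule: sigma1.cases; cases e; auto intro!: mat2_eqI simp: mult2_index mat2_index simp del: index_mult_mat(1))+

lemma P_sigma1_offdiag:
  assumes "snd s"
  shows "P0 * sigma1 s * P0 = 0\<^sub>m 2 2" "P1 * sigma1 s * P1 = 0\<^sub>m 2 2"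
  using assms
  by (cases s rule: sigma1.cases; auto intro!: mat2_eqI simp: mult2_index mat2_index simp del: index_mult_mat(1))+

text \<open>If the target anticommutes with X, the control factor and the target factor each acquire
  a phase of plus or minus i. Neither is a sign by itself, so the claim can only concern the product
  \<open>u * v\<close>.\<close>

lemma P_sigma1_X_offdiag:
  assumes "snd s"
  shows "\<exists>s' r' u v. u * v \<in> {1,-1} \<and> Xm * sigma1 r = v \<cdot>\<^sub>m sigma1 r' \<and>
    (if fst r then -1 else 1) \<cdot>\<^sub>m (P0 * sigma1 s * P1) + P1 * sigma1 s * P0 = u \<cdot>\<^sub>m sigma1 s'"
proof -
  define v :: complex where "v = (if fst r then if snd r then \<i> else -\<i> else 1)"
  define u :: complex where "u = (if fst r then if fst s then \<i> else -\<i> else 1)"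
  have "Xm * sigma1 r = v \<cdot>\<^sub>m sigma1 (fst r, \<not> snd r)"
    unfolding v_def
    by (cases r rule: sigma1.cases; auto intro!: mat2_eqI simp: mult2_index mat2_index simp del: index_mult_mat(1))
  moreover have "(if fst r then -1 else 1) \<cdot>\<^sub>m (P0 * sigma1 s * P1) + P1 * sigma1 s * P0
     = u \<cdot>\<^sub>m sigma1 (fst s \<noteq> fst r, True)"
    unfolding u_def using assms
    by (cases s rule: sigma1.cases; cases "fst r"; auto intro!: mat2_eqI simp: mult2_index mat2_index simp del: index_mult_mat(1))
  moreover have "u * v \<in> {1,-1}" by (auto simp: u_def v_def)
  ultimately show ?thesis by blast
qed

lemma kron_list_update_zero:
  assumes "distinct xs" "c \<in> set xs" "length xs = n" "\<And>x. f x \<in> carrier_mat 2 2"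
  shows "kron_list (map (f(c := 0\<^sub>m 2 2)) xs) = 0\<^sub>m (2^n) (2^n)"
proof -
  have z: "0\<^sub>m 2 2 = (0 :: complex) \<cdot>\<^sub>m 0\<^sub>m 2 2" by (intro eq_matI) auto
  have "kron_list (map (f(c := 0\<^sub>m 2 2)) xs) = 0 \<cdot>\<^sub>m kron_list (map (f(c := 0\<^sub>m 2 2)) xs)"
    using kron_list_update_smult[OF assms(1,2), of f 0 "0\<^sub>m 2 2"] by (simp flip: z)
  also have "kron_list (map (f(c := 0\<^sub>m 2 2)) xs) \<in> carrier_mat (2^n) (2^n)"
    unfolding assms(3)[symmetric] using assms(4) by (intro kron_list_carrier) auto
  hence "0 \<cdot>\<^sub>m kron_list (map (f(c := 0\<^sub>m 2 2)) xs) = 0\<^sub>m (2^n) (2^n)"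
    by (intro eq_matI) auto
  finally show ?thesis .
qed

text \<open>CNOT is a sum of two product operators, so conjugation gives four products that differ
  only in the control and target slots. A diagonal control matrix leaves the two terms with equal
  projections, an off-diagonal one the two mixed terms; each pair recombines into one signed Pauli
  matrix.\<close>

lemma cnot_normalizer:
  assumes ct: "c < n" "t < n" "c \<noteq> t"
  shows "pauli_normalizer n (cnot n c t)"
  unfolding pauli_normalizer_def
proof (intro conjI ballI)
  define K where "K h = kron_list (map h [0..<n])" for h
  define u where "u = (\<lambda>k. if k = c then P0 else 1\<^sub>m 2)"
  define v where "v = (\<lambda>k. if k = c then P1 else if k = t then Xm else 1\<^sub>m 2)"
  have uv: "u k \<in> carrier_mat 2 2" "v k \<in> carrier_mat 2 2" "adj (u k) = u k" "adj (v k) = v k" for k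
    by (auto simp: u_def v_def)
  have Kc: "K h \<in> carrier_mat (2^n) (2^n)" if "\<And>k. h k \<in> carrier_mat 2 2" for h
    using that kron_list_carrier[of "[0..<n]" h] by (simp add: K_def)
  have cnot: "cnot n c t = K u + K v" by (simp add: cnot_def embed1_def K_def u_def v_def)
  show "cnot n c t \<in> carrier_mat (2^n) (2^n)" unfolding cnot using Kc[of u] Kc[of v] uv by simp
  fix a assume "a \<in> labels n"
  hence a: "length a = n" by (simp add: labels_iff)
  define f where "f = (\<lambda>k. sigma1 (a ! k))"
  have fc: "f k \<in> carrier_mat 2 2" for k by (simp add: f_def)
  have Ka: "pauli a = K f" using pauli_eq_upt[OF a] by (simp add: K_def f_def)
  \<comment> \<open>The Pauli product with its control factor replaced by \<open>A\<close> and its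
    target factor by \<open>B\<close>; it is linear in each.\<close>
  define F where "F A B = K (f(c := A, t := B))" for A B
  have F_index: "F A B = K (\<lambda>k. if k = c then A else if k = t then B else f k)" for A B
    unfolding F_def using ct by (intro arg_cong[of _ _ K]) (auto simp: fun_eq_iff)
  have Fc: "F A B \<in> carrier_mat (2^n) (2^n)" if "A \<in> carrier_mat 2 2" "B \<in> carrier_mat 2 2" for A B
    unfolding F_def using that fc by (intro Kc) auto
  have triple: "K g * K f * K h = F (g c * f c * h c) (g t * f t * h t)"
    if "g \<in> {u,v}" "h \<in> {u,v}" for g h
  proof -
    have gh: "g k \<in> carrier_mat 2 2" "h k \<in> carrier_mat 2 2" for k using that uv by auto
    have "K g * K f * K h = K (\<lambda>k. g k * f k * h k)"
      unfolding K_def using gh fc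
      by (subst kron_list_mult, simp, simp, subst kron_list_mult, simp_all)
    also have "(\<lambda>k. g k * f k * h k) = (\<lambda>k. if k = c then g c * f c * h c else if k = t then g t * f t * h t else f k)"
    proof -
      have "1\<^sub>m 2 * f k * 1\<^sub>m 2 = f k" for k using fc[of k] by simp
      thus ?thesis using that by (auto simp: fun_eq_iff u_def v_def)
    qed
    finally show ?thesis unfolding F_index .
  qed
  have F_add: "F (A + A') B = F A B + F A' B" if "A \<in> carrier_mat 2 2" "A' \<in> carrier_mat 2 2" "B \<in> carrier_mat 2 2" for A A' B
    unfolding F_def K_def fun_upd_twist[OF ct(3)] using that fc ct by (intro kron_list_update_add) auto
  have F_smult: "F (z \<cdot>\<^sub>m A) B = z \<cdot>\<^sub>m F A B" for z A B
    unfolding F_def K_def fun_upd_twist[OF ct(3)] using ct by (intro kron_list_update_smult) auto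
  have F_smult2: "F A (z \<cdot>\<^sub>m B) = z \<cdot>\<^sub>m F A B" for z A B
    unfolding F_def K_def using ct by (intro kron_list_update_smult) auto
  have F_zero: "F (0\<^sub>m 2 2) B = 0\<^sub>m (2^n) (2^n)" if "B \<in> carrier_mat 2 2" for B
    unfolding F_def K_def fun_upd_twist[OF ct(3)] using that fc ct by (intro kron_list_update_zero) auto
  have F_pauli: "F (sigma1 s) (sigma1 r) = pauli (a[c := s, t := r])" for s r
  proof -
    have "f(c := sigma1 s) = (\<lambda>k. sigma1 (a[c := s] ! k))" using ct a
      by (auto simp: fun_eq_iff f_def nth_list_update)
    thus ?thesis unfolding F_def K_def using pauli_update[of "a[c := s]" n t r] ct a by simp
  qed
  let ?s = "a ! c" and ?r = "a ! t"
  define x where "x = sigma1 ?s" define y where "y = sigma1 ?r"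
  have xy: "x \<in> carrier_mat 2 2" "y \<in> carrier_mat 2 2" by (auto simp: x_def y_def)
  have adjK: "adj (K u + K v) = K u + K v"
    using uv Kc[of u] Kc[of v] by (simp add: adj_add[of _ "2^n" "2^n"]) (simp add: K_def kron_list_adj uv)
  have "adj (cnot n c t) * pauli a * cnot n c t
     = (K u * K f * K u + K u * K f * K v) + (K v * K f * K u + K v * K f * K v)"
    unfolding cnot adjK Ka using Kc[of u] Kc[of v] Kc[of f] uv fc
    by (simp add: add_mult_distrib_mat[of _ "2^n" "2^n" _ _ "2^n"] mult_add_distrib_mat[of _ "2^n" "2^n" _ "2^n"]
       mult_assoc_sq[of _ "2^n"]) (intro eq_matI; auto)
  also have "\<dots> = (F (P0 * x * P0) y + F (P0 * x * P1) (y * Xm)) + (F (P1 * x * P0) (Xm * y) + F (P1 * x * P1) (Xm * y * Xm))"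
    using ct xy by (simp add: triple) (simp add: u_def v_def f_def x_def y_def)
  finally have main: "adj (cnot n c t) * pauli a * cnot n c t = \<dots>" .
  let ?e = "if fst ?r then -1 else 1 :: complex"
  show "\<exists>b\<in>labels n. \<exists>s\<in>{1,-1}. adj (cnot n c t) * pauli a * cnot n c t = s \<cdot>\<^sub>m pauli b"
  proof (cases "snd ?s")
    case False
    note P = P_sigma1_diag[OF False, folded x_def]
    \<comment> \<open>The mixed terms vanish, and the sign from \<open>X_sigma1_X\<close> moves from
      the target to the control, so both terms share the target factor \<open>y\<close>.\<close>
    have "adj (cnot n c t) * pauli a * cnot n c t = F (P0 * x * P0) y + F (?e \<cdot>\<^sub>m (P1 * x * P1)) y"
      unfolding main P(1,2) y_def X_sigma1_X using xy Fc
      by (simp add: F_zero F_smult F_smult2 y_def[symmetric])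
    also have "\<dots> = F (sigma1 (fst ?s \<noteq> fst ?r, False)) y"
      unfolding P(3)[of "fst ?r", symmetric] using xy by (intro F_add[symmetric]) auto
    also have "\<dots> = 1 \<cdot>\<^sub>m pauli (a[c := (fst ?s \<noteq> fst ?r, False), t := ?r])"
      unfolding y_def F_pauli by (intro eq_matI) auto
    finally show ?thesis using a by (intro bexI[of _ "a[c := (fst ?s \<noteq> fst ?r, False), t := ?r]"] bexI[of _ 1])
      (auto simp: labels_iff)
  next
    case True
    obtain s' r' p q where pq: "p * q \<in> {1,-1}" "Xm * y = q \<cdot>\<^sub>m sigma1 r'"
      "?e \<cdot>\<^sub>m (P0 * x * P1) + P1 * x * P0 = p \<cdot>\<^sub>m sigma1 s'"
      using P_sigma1_X_offdiag[OF True, of ?r, folded x_def y_def] by blast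
    \<comment> \<open>The equal-projection terms vanish. Replacing \<open>y * Xm\<close> by a signed
      \<open>Xm * y\<close> gives both mixed terms the same target factor.\<close>
    have "adj (cnot n c t) * pauli a * cnot n c t = F (?e \<cdot>\<^sub>m (P0 * x * P1)) (Xm * y) + F (P1 * x * P0) (Xm * y)"
      unfolding main P_sigma1_offdiag[OF True, folded x_def] sigma1_X[of ?r, folded y_def] using xy Fc
      by (simp add: F_zero F_smult F_smult2)
    also have "\<dots> = F (p \<cdot>\<^sub>m sigma1 s') (q \<cdot>\<^sub>m sigma1 r')"
      unfolding pq(2,3)[symmetric] using xy by (intro F_add[symmetric]) auto
    also have "\<dots> = (p * q) \<cdot>\<^sub>m pauli (a[c := s', t := r'])"
      unfolding F_smult F_smult2 F_pauli by (intro eq_matI) auto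
    finally show ?thesis using pq(1) a by (intro bexI[of _ "a[c := s', t := r']"] bexI[of _ "p * q"])
      (auto simp: labels_iff)
  qed
qed

lemma clifford_normalizer: "g \<in> clifford n \<Longrightarrow> pauli_normalizer n g"
proof (induction rule: clifford.induct)
  case cl_one
  have "adj (1\<^sub>m (2^n)) * pauli a * 1\<^sub>m (2^n) = 1 \<cdot>\<^sub>m pauli a" if "a \<in> labels n" for a
    using pauli_carrier[OF that] by (intro eq_matI) auto
  thus ?case unfolding pauli_normalizer_def by (intro conjI ballI one_carrier_mat) blast
qed (auto intro!: pauli_normalizer_mult embed1_normalizer cnot_normalizer Hm_conj Sm_conj simp del: bex_simps insert_iff)

section \<open>The diamond norm\<close>

definition munit :: "nat \<Rightarrow> nat \<Rightarrow> nat \<Rightarrow> complex mat" where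
  "munit d k l = mat d d (\<lambda>(i,j). if i = k \<and> j = l then 1 else 0)"

lemma munit_carrier [simp]: "munit d k l \<in> carrier_mat d d"
  by (simp add: munit_def)

lemma linear_sopD:
  assumes "linear_sop d \<Phi>"
  shows "A \<in> carrier_mat d d \<Longrightarrow> \<Phi> A \<in> carrier_mat d d"
    "A \<in> carrier_mat d d \<Longrightarrow> B \<in> carrier_mat d d \<Longrightarrow> \<Phi> (A + B) = \<Phi> A + \<Phi> B"
    "A \<in> carrier_mat d d \<Longrightarrow> \<Phi> (c \<cdot>\<^sub>m A) = c \<cdot>\<^sub>m \<Phi> A"
  using assms by (auto simp: linear_sop_def)

lemma linear_sop_zero:
  assumes "linear_sop d \<Phi>" shows "\<Phi> (0\<^sub>m d d) = 0\<^sub>m d d"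
proof -
  have "\<Phi> (0 \<cdot>\<^sub>m 0\<^sub>m d d) = 0 \<cdot>\<^sub>m \<Phi> (0\<^sub>m d d)" using linear_sopD(3)[OF assms, of "0\<^sub>m d d" 0] by simp
  moreover have "0 \<cdot>\<^sub>m 0\<^sub>m d d = (0\<^sub>m d d :: complex mat)" by (intro eq_matI) auto
  moreover have "0 \<cdot>\<^sub>m \<Phi> (0\<^sub>m d d) = 0\<^sub>m d d"
    using linear_sopD(1)[OF assms, of "0\<^sub>m d d"] by (intro eq_matI) auto
  ultimately show ?thesis by simp
qed

lemma msum_insert:
  assumes "finite I" "x \<notin> I" "f x \<in> carrier_mat d d"
  shows "msum d f (insert x I) = f x + msum d f I"
  using assms by (intro eq_matI) auto

lemma linear_sop_msum:
  assumes "linear_sop d \<Phi>" "finite I" "\<And>x. x \<in> I \<Longrightarrow> f x \<in> carrier_mat d d"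
  shows "\<Phi> (msum d f I) = msum d (\<lambda>x. \<Phi> (f x)) I"
  using assms(2,3)
proof (induction I rule: finite_induct)
  case empty
  have "msum d h {} = 0\<^sub>m d d" for h :: "'a \<Rightarrow> complex mat" by (intro eq_matI) auto
  thus ?case by (simp add: linear_sop_zero[OF assms(1)])
next
  case (insert x I)
  thus ?case using linear_sopD[OF assms(1)] by (simp add: msum_insert)
qed

lemma linear_sop_entry:
  assumes "linear_sop d \<Phi>" "A \<in> carrier_mat d d" "i < d" "j < d"
  shows "\<Phi> A $$ (i,j) = (\<Sum>(k,l)\<in>{..<d} \<times> {..<d}. A $$ (k,l) * \<Phi> (munit d k l) $$ (i,j))"
proof -
  let ?f = "\<lambda>(k,l). A $$ (k,l) \<cdot>\<^sub>m munit d k l"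
  have "A = msum d ?f ({..<d} \<times> {..<d})"
  proof (intro eq_matI)
    fix i j assume "i < dim_row (msum d ?f ({..<d} \<times> {..<d}))" "j < dim_col (msum d ?f ({..<d} \<times> {..<d}))"
    hence ij: "i < d" "j < d" by auto
    have "msum d ?f ({..<d} \<times> {..<d}) $$ (i,j) = (\<Sum>k<d. \<Sum>l<d. if l = j then (if k = i then A $$ (i,j) else 0) else 0)"
      unfolding msum_index[OF ij] sum.cartesian_product using ij
      by (intro sum.cong refl) (auto simp: munit_def split: prod.splits)
    thus "A $$ (i,j) = msum d ?f ({..<d} \<times> {..<d}) $$ (i,j)" using ij by simp
  qed (use assms in auto)
  hence "\<Phi> A = \<Phi> (msum d ?f ({..<d} \<times> {..<d}))" by simp
  also have "\<dots> = msum d (\<lambda>x. \<Phi> (?f x)) ({..<d} \<times> {..<d})"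
    by (intro linear_sop_msum[OF assms(1)]) auto
  also have "\<dots> $$ (i,j) = (\<Sum>(k,l)\<in>{..<d} \<times> {..<d}. A $$ (k,l) * \<Phi> (munit d k l) $$ (i,j))"
    unfolding msum_index[OF assms(3,4)]
  proof (intro sum.cong refl, clarify)
    fix k l
    have "\<Phi> (munit d k l) \<in> carrier_mat d d" using linear_sopD(1)[OF assms(1)] by simp
    thus "\<Phi> (A $$ (k,l) \<cdot>\<^sub>m munit d k l) $$ (i,j) = A $$ (k,l) * \<Phi> (munit d k l) $$ (i,j)"
      using assms(3,4) by (simp add: linear_sopD(3)[OF assms(1)])
  qed
  finally show ?thesis .
qed

lemma tensor_id_carrier [simp]: "tensor_id d k \<Phi> X \<in> carrier_mat (d * k) (d * k)"
  by (simp add: tensor_id_def)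

lemma blk_carrier [simp]: "blk d k X b e \<in> carrier_mat d d"
  by (simp add: blk_def)

lemma tensor_id_index:
  "i < d * k \<Longrightarrow> j < d * k \<Longrightarrow> tensor_id d k \<Phi> X $$ (i,j) = \<Phi> (blk d k X (i mod k) (j mod k)) $$ (i div k, j div k)"
  by (simp add: tensor_id_def)

lemma mult_add_less: "a < d \<Longrightarrow> b < k \<Longrightarrow> a * k + b < d * (k::nat)"
proof -
  assume a: "a < d" and b: "b < k"
  have "a * k + b < (a + 1) * k" using b by simp
  also have "\<dots> \<le> d * k" using a by (intro mult_le_mono1) simp
  finally show ?thesis .
qed

text \<open>Entries of \<open>X\<close> are at most its trace norm, so by linearity each output
  entry is at most a sum of d^2 copies of \<open>b\<close>, and the entries in turn bound the trace
  norm. The result depends on \<open>d\<close> and \<open>b\<close> only; this makes it uniform over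
  all maps with the same entry bound.\<close>

lemma trace_norm_tensor_id_le:
  assumes \<Phi>: "linear_sop d \<Phi>" and b: "\<And>k l i j. k < d \<Longrightarrow> l < d \<Longrightarrow> i < d \<Longrightarrow> j < d \<Longrightarrow> cmod (\<Phi> (munit d k l) $$ (i,j)) \<le> b"
    and X: "X \<in> carrier_mat (d * d) (d * d)" "trace_norm X \<le> 1"
  shows "trace_norm (tensor_id d d \<Phi> X) \<le> (\<Sum>i<d * d. \<Sum>j<d * d. \<Sum>(k,l)\<in>{..<d} \<times> {..<d}. b)"
proof -
  have "cmod (tensor_id d d \<Phi> X $$ (i,j)) \<le> (\<Sum>(k,l)\<in>{..<d} \<times> {..<d}. b)" if ij: "i < d * d" "j < d * d" for i j
  proof -
    let ?B = "blk d d X (i mod d) (j mod d)"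
    have ij': "i div d < d" "j div d < d" "i mod d < d" "j mod d < d"
      using ij by (auto intro: mod_less_mult div_less_mult)
    have B: "cmod (?B $$ (k,l)) \<le> 1" if "k < d" "l < d" for k l
    proof -
      have "cmod (?B $$ (k,l)) \<le> trace_norm X"
        using that ij' entry_le_trace_norm[OF X(1), of "k * d + i mod d" "l * d + j mod d"]
        by (simp add: blk_def mult_add_less)
      thus ?thesis using X(2) by simp
    qed
    have "cmod (tensor_id d d \<Phi> X $$ (i,j))
        = cmod (\<Sum>(k,l)\<in>{..<d} \<times> {..<d}. ?B $$ (k,l) * \<Phi> (munit d k l) $$ (i div d, j div d))"
      unfolding tensor_id_index[OF ij] by (subst linear_sop_entry[OF \<Phi>]) (use ij' in auto)
    also have "\<dots> \<le> (\<Sum>(k,l)\<in>{..<d} \<times> {..<d}. b)"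
    proof (rule sum_norm_le, clarify)
      fix k l assume kl: "k < d" "l < d"
      have "cmod (?B $$ (k,l)) * cmod (\<Phi> (munit d k l) $$ (i div d, j div d)) \<le> 1 * b"
        using B b kl ij' by (intro mult_mono) auto
      thus "cmod (?B $$ (k,l) * \<Phi> (munit d k l) $$ (i div d, j div d)) \<le> b" by (simp add: norm_mult)
    qed
    finally show ?thesis .
  qed
  thus ?thesis
    by (intro order.trans[OF trace_norm_le_entries[of _ "d * d"]] sum_mono) auto
qed

lemma trace_norm_tensor_id_bounded:
  assumes \<Phi>: "linear_sop d \<Phi>"
  obtains b where "\<And>X. X \<in> carrier_mat (d * d) (d * d) \<Longrightarrow> trace_norm X \<le> 1 \<Longrightarrow> trace_norm (tensor_id d d \<Phi> X) \<le> b"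
proof -
  let ?f = "\<lambda>(k,l,i,j). cmod (\<Phi> (munit d k l) $$ (i,j))"
  let ?S = "{..<d} \<times> {..<d} \<times> {..<d} \<times> {..<d}"
  have "cmod (\<Phi> (munit d k l) $$ (i,j)) \<le> sum ?f ?S" if "k < d" "l < d" "i < d" "j < d" for k l i j
    using that member_le_sum[of "(k,l,i,j)" ?S ?f] by auto
  from that[OF trace_norm_tensor_id_le[OF \<Phi> this]] show ?thesis by blast
qed

text \<open>A real supremum dominates its members only if the set is bounded above, which linearity
  in finite dimension guarantees.\<close>

lemma diamond_norm_upper:
  assumes \<Phi>: "linear_sop d \<Phi>" and X: "X \<in> carrier_mat (d * d) (d * d)" "trace_norm X \<le> 1"
  shows "trace_norm (tensor_id d d \<Phi> X) \<le> diamond_norm d \<Phi>"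
  unfolding diamond_norm_def
proof (rule cSup_upper)
  obtain b where "\<And>X. X \<in> carrier_mat (d * d) (d * d) \<Longrightarrow> trace_norm X \<le> 1 \<Longrightarrow> trace_norm (tensor_id d d \<Phi> X) \<le> b"
    using trace_norm_tensor_id_bounded[OF \<Phi>] by blast
  thus "bdd_above {trace_norm (tensor_id d d \<Phi> X) | X. X \<in> carrier_mat (d * d) (d * d) \<and> trace_norm X \<le> 1}"
    by (intro bdd_aboveI[of _ b]) auto
qed (use X in auto)

text \<open>A real supremum is controlled by an upper bound only if the set is non-empty; the zero
  matrix is the witness.\<close>

lemma diamond_norm_least:
  assumes "\<And>X. X \<in> carrier_mat (d * d) (d * d) \<Longrightarrow> trace_norm X \<le> 1 \<Longrightarrow> trace_norm (tensor_id d d \<Phi> X) \<le> b"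
  shows "diamond_norm d \<Phi> \<le> b"
  unfolding diamond_norm_def
proof (rule cSup_least)
  have "trace_norm (0\<^sub>m (d * d) (d * d)) \<le> 1"
    using trace_norm_le_entries[of "0\<^sub>m (d * d) (d * d)" "d * d"] by simp
  thus "{trace_norm (tensor_id d d \<Phi> X) | X. X \<in> carrier_mat (d * d) (d * d) \<and> trace_norm X \<le> 1} \<noteq> {}"
    using zero_carrier_mat[of "d * d" "d * d"] by blast
qed (use assms in auto)

text \<open>Every entry of a channel is an entry of its Choi matrix, which is positive semidefinite of trace \<open>d\<close>.\<close>

lemma quantum_channel_entry_le:
  assumes \<Lambda>: "quantum_channel d \<Lambda>" and kl: "k < d" "l < d" "i < d" "j < d"
  shows "cmod (\<Lambda> (munit d k l) $$ (i,j)) \<le> d"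
proof -
  \<comment> \<open>The vectorised identity: its support is the set of indices a * d + a.
    \<open>X\<close> is thus the unnormalised maximally entangled state, whose blocks are the matrix
    units, and \<open>tensor_id d d \<Lambda> X\<close> is the Choi matrix.\<close>
  define e :: "nat \<Rightarrow> complex" where "e i = (if i div d = i mod d then 1 else 0)" for i
  define X where "X = mat (d * d) (d * d) (\<lambda>(i,j). e i * e j)"
  have ce: "cnj (e i) = e i" for i by (simp add: e_def)
  have "psd (d * d) X"
    unfolding psd_def hermitian_def
  proof (intro conjI allI)
    show "X \<in> carrier_mat (d * d) (d * d)" by (simp add: X_def)
    show "adj X = X" by (intro eq_matI) (auto simp: X_def ce)
    fix v :: "nat \<Rightarrow> complex"
    define s where "s = (\<Sum>j<d * d. e j * v j)"
    have "(\<Sum>i<d * d. \<Sum>j<d * d. cnj (v i) * X $$ (i,j) * v j) = cnj s * s"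
    proof -
      have "cnj s = (\<Sum>i<d * d. cnj (v i) * e i)" by (simp add: s_def ce mult.commute)
      hence "cnj s * s = (\<Sum>i<d * d. \<Sum>j<d * d. (cnj (v i) * e i) * (e j * v j))"
        by (simp only: s_def sum_product)
      thus ?thesis by (simp add: X_def mult.assoc)
    qed
    also have "\<dots> = of_real ((cmod s)\<^sup>2)" by (simp only: complex_norm_square mult.commute)
    finally show "0 \<le> Re (\<Sum>i<d * d. \<Sum>j<d * d. cnj (v i) * X $$ (i,j) * v j)"
      by (simp only: Re_complex_of_real) simp
  qed
  let ?Y = "tensor_id d d \<Lambda> X"
  have "psd (d * d) ?Y"
    using \<Lambda> \<open>psd (d * d) X\<close> by (auto simp: quantum_channel_def completely_positive_def)
  note tn = trace_norm_psd[OF this]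
  have blk: "blk d d X b c = munit d b c" if "b < d" "c < d" for b c
    using that by (intro eq_matI) (auto simp: blk_def munit_def X_def e_def mult_add_less)
  have tr1: "trace (munit d b b) = 1" if "b < d" for b
    using that by (subst trace_eq[of _ d]) (auto simp: munit_def)
  \<comment> \<open>The trace of the Choi matrix collects the traces of the images of the d diagonal
    matrix units, each equal to one by trace preservation.\<close>
  have "trace ?Y = (\<Sum>i<d * d. \<Lambda> (munit d (i mod d) (i mod d)) $$ (i div d, i div d))"
    by (subst trace_eq[of _ "d * d"]) (auto simp: tensor_id_index blk mod_less_mult intro!: sum.cong)
  also have "\<dots> = (\<Sum>a<d. \<Sum>b<d. \<Lambda> (munit d b b) $$ (a,a))"
    by (rule sum_div_mod[of "\<lambda>a b. \<Lambda> (munit d b b) $$ (a,a)"])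
  also have "\<dots> = (\<Sum>b<d. \<Sum>a<d. \<Lambda> (munit d b b) $$ (a,a))" by (rule sum.swap)
  also have "\<dots> = (\<Sum>b<d. 1)"
  proof (intro sum.cong refl)
    fix b assume b: "b \<in> {..<d}"
    have "\<Lambda> (munit d b b) \<in> carrier_mat d d"
      using \<Lambda> by (auto simp: quantum_channel_def linear_sop_def)
    hence "(\<Sum>a<d. \<Lambda> (munit d b b) $$ (a,a)) = trace (\<Lambda> (munit d b b))" by (simp add: trace_eq[of _ d])
    also have "\<dots> = 1" using \<Lambda> b tr1 by (auto simp: quantum_channel_def trace_preserving_def)
    finally show "(\<Sum>a<d. \<Lambda> (munit d b b) $$ (a,a)) = 1" .
  qed
  finally have "complex_of_real (trace_norm ?Y) = of_real (real d)" using tn by simp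
  hence "trace_norm ?Y = d" by (simp only: of_real_eq_iff)
  moreover have "?Y $$ (i * d + k, j * d + l) = \<Lambda> (munit d k l) $$ (i,j)"
    using kl by (simp add: tensor_id_index mult_add_less blk)
  ultimately show ?thesis
    using entry_le_trace_norm[of ?Y "d * d" "i * d + k" "j * d + l"] kl by (simp add: mult_add_less)
qed

lemma linear_sop_diff_id:
  assumes "linear_sop d \<Phi>" shows "linear_sop d (\<lambda>C. C - \<Phi> C)"
  unfolding linear_sop_def
proof (intro conjI ballI allI)
  note L = linear_sopD[OF assms]
  note L' = carrier_matD[OF L(1)]
  fix A B :: "complex mat" and c :: complex assume A: "A \<in> carrier_mat d d"
  show "A - \<Phi> A \<in> carrier_mat d d" using L(1)[OF A] by (rule minus_carrier_mat)
  show "c \<cdot>\<^sub>m A - \<Phi> (c \<cdot>\<^sub>m A) = c \<cdot>\<^sub>m (A - \<Phi> A)"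
    unfolding L(3)[OF A] using A L' by (intro eq_matI) (auto simp: algebra_simps)
  assume B: "B \<in> carrier_mat d d"
  show "A + B - \<Phi> (A + B) = A - \<Phi> A + (B - \<Phi> B)"
    unfolding L(2)[OF A B] using A B L' by (intro eq_matI) auto
qed

lemma diamond_norm_channels_bdd:
  assumes "\<forall>g\<in>I. quantum_channel d (\<Lambda> g)"
  shows "bdd_above ((\<lambda>g. diamond_norm d (\<lambda>C. C - \<Lambda> g C)) ` I)"
proof (rule bdd_aboveI2)
  fix g assume "g \<in> I"
  hence q: "quantum_channel d (\<Lambda> g)" using assms by blast
  hence lin: "linear_sop d (\<Lambda> g)" by (simp add: quantum_channel_def)
  \<comment> \<open>The 1 comes from the identity map, the d from the Choi matrix of the
    channel.\<close>
  have "cmod ((munit d k l - \<Lambda> g (munit d k l)) $$ (i,j)) \<le> 1 + real d"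
    if "k < d" "l < d" "i < d" "j < d" for k l i j
  proof -
    have "cmod ((munit d k l - \<Lambda> g (munit d k l)) $$ (i,j)) = cmod (munit d k l $$ (i,j) - \<Lambda> g (munit d k l) $$ (i,j))"
      using that carrier_matD[OF linear_sopD(1)[OF lin]] by simp
    also have "\<dots> \<le> cmod (munit d k l $$ (i,j)) + cmod (\<Lambda> g (munit d k l) $$ (i,j))" by (rule norm_triangle_ineq4)
    also have "\<dots> \<le> 1 + real d"
      using that by (intro add_mono quantum_channel_entry_le[OF q]) (auto simp: munit_def)
    finally show ?thesis .
  qed
  from trace_norm_tensor_id_le[OF linear_sop_diff_id[OF lin] this]
  show "diamond_norm d (\<lambda>C. C - \<Lambda> g C) \<le> (\<Sum>i<d * d. \<Sum>j<d * d. \<Sum>(k,l)\<in>{..<d} \<times> {..<d}. 1 + real d)"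
    by (intro diamond_norm_least) 
qed

text \<open>The second factor kills all indices that are not multiples of d, so the quadratic form
  at \<open>v\<close> is that of \<rho> at the subvector \<open>w\<close>.\<close>

lemma psd_kron_Ebas:
  assumes \<rho>: "psd d \<rho>" and d: "0 < d"
  shows "psd (d * d) (kron \<rho> (Ebas d 0))"
  unfolding psd_def hermitian_def
proof (intro conjI allI)
  have h: "\<rho> \<in> carrier_mat d d" "adj \<rho> = \<rho>" using \<rho> by (auto simp: psd_def hermitian_def)
  have E: "Ebas d 0 \<in> carrier_mat d d" by (simp add: Ebas_def)
  have "adj (Ebas d 0) = Ebas d 0" by (intro eq_matI) (auto simp: Ebas_index)
  thus "adj (kron \<rho> (Ebas d 0)) = kron \<rho> (Ebas d 0)" by (simp add: kron_adj h)
  show "kron \<rho> (Ebas d 0) \<in> carrier_mat (d * d) (d * d)" using h E by simp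
  fix v :: "nat \<Rightarrow> complex"
  define w where "w i = v (i * d)" for i
  have red: "(\<Sum>i<d * d. if i mod d = 0 then f (i div d) else 0) = (\<Sum>a<d. f a)" for f :: "nat \<Rightarrow> complex"
  proof -
    have "(\<Sum>i<d * d. if i mod d = 0 then f (i div d) else 0) = (\<Sum>a<d. \<Sum>b<d. if b = 0 then f a else 0)"
      by (rule sum_div_mod[of "\<lambda>a b. if b = 0 then f a else 0"])
    thus ?thesis using d by simp
  qed
  have vw: "v i = w (i div d)" if "i mod d = 0" for i using that by (auto simp: w_def)
  have "(\<Sum>i<d * d. \<Sum>j<d * d. cnj (v i) * kron \<rho> (Ebas d 0) $$ (i,j) * v j)
     = (\<Sum>i<d * d. \<Sum>j<d * d. if j mod d = 0 then
         (if i mod d = 0 then cnj (w (i div d)) * \<rho> $$ (i div d, j div d) * w (j div d) else 0) else 0)"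
    using h E by (intro sum.cong refl) (auto simp: kron_index[of _ d d _ d d] Ebas_index mod_less_mult vw)
  also have "\<dots> = (\<Sum>i<d * d. if i mod d = 0 then (\<Sum>c<d. cnj (w (i div d)) * \<rho> $$ (i div d, c) * w c) else 0)"
    by (subst red) (auto intro!: sum.cong)
  also have "\<dots> = (\<Sum>a<d. \<Sum>c<d. cnj (w a) * \<rho> $$ (a, c) * w c)" by (rule red)
  finally show "0 \<le> Re (\<Sum>i<d * d. \<Sum>j<d * d. cnj (v i) * kron \<rho> (Ebas d 0) $$ (i,j) * v j)"
    using \<rho> by (simp add: psd_def)
qed

text \<open>The state is padded with \<open>|0\<rangle>\<langle>0|\<close> on the reference system, on which \<open>U\<close> acts trivially.\<close>

lemma cmod_trace_le_diamond_norm: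
  assumes \<Phi>: "linear_sop d \<Phi>" and \<rho>: "density d \<rho>" and U: "unitary d U" and d: "0 < d"
  shows "cmod (trace (U * \<Phi> \<rho>)) \<le> diamond_norm d \<Phi>"
proof -
  have psd: "psd d \<rho>" and tr: "trace \<rho> = 1" using \<rho> by (auto simp: density_def)
  have h: "\<rho> \<in> carrier_mat d d" using psd by (auto simp: psd_def hermitian_def)
  have E: "Ebas d 0 \<in> carrier_mat d d" by (simp add: Ebas_def)
  have trE: "trace (Ebas d 0) = 1" using d by (subst trace_eq[OF E]) (auto simp: Ebas_index)
  let ?X = "kron \<rho> (Ebas d 0)"
  have X: "?X \<in> carrier_mat (d * d) (d * d)" using h E by simp
  have "complex_of_real (trace_norm ?X) = 1"
    using trace_norm_psd[OF psd_kron_Ebas[OF psd d]] trace_kron[OF h E] tr trE by simp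
  hence tn: "trace_norm ?X \<le> 1" by simp
  \<comment> \<open>Only the block (0,0) is non-zero, so applying the map blockwise commutes with
    the padding.\<close>
  have blk: "blk d d ?X b e = (if b = 0 \<and> e = 0 then \<rho> else 0\<^sub>m d d)" if "b < d" "e < d" for b e
    using that h E
    by (intro eq_matI) (auto simp: blk_def kron_index[of _ d d _ d d] mult_add_less Ebas_index)
  note \<Phi>c = linear_sopD(1)[OF \<Phi> h]
  have Y: "tensor_id d d \<Phi> ?X = kron (\<Phi> \<rho>) (Ebas d 0)"
  proof (intro eq_matI)
    fix i j assume "i < dim_row (kron (\<Phi> \<rho>) (Ebas d 0))" "j < dim_col (kron (\<Phi> \<rho>) (Ebas d 0))"
    hence ij: "i < d * d" "j < d * d" using \<Phi>c by auto
    thus "tensor_id d d \<Phi> ?X $$ (i,j) = kron (\<Phi> \<rho>) (Ebas d 0) $$ (i,j)"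
      using \<Phi>c E by (simp add: tensor_id_index kron_index[of _ d d _ d d] blk mod_less_mult div_less_mult
         linear_sop_zero[OF \<Phi>] Ebas_index)
  qed (use \<Phi>c in \<open>auto simp: tensor_id_def\<close>)
  note Uc = unitaryD(1)[OF U]
  have UU: "unitary (d * d) (kron U (1\<^sub>m d))"
    using Uc unitaryD(2)[OF U] by (simp add: unitary_def kron_adj kron_mult[of _ d _ _ d] kron_one)
  have "kron U (1\<^sub>m d) * kron (\<Phi> \<rho>) (Ebas d 0) = kron (U * \<Phi> \<rho>) (Ebas d 0)"
    using Uc \<Phi>c E by (simp add: kron_mult[of _ d _ _ d])
  also have "trace \<dots> = trace (U * \<Phi> \<rho>)"
    using Uc \<Phi>c E by (subst trace_kron[of _ d _ d]) (auto simp: trE)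
  finally have "trace (U * \<Phi> \<rho>) = trace (kron U (1\<^sub>m d) * tensor_id d d \<Phi> ?X)" by (simp add: Y)
  hence "cmod (trace (U * \<Phi> \<rho>)) \<le> trace_norm (tensor_id d d \<Phi> ?X)"
    using cmod_trace_mult_le[OF unitary_contraction[OF UU] tensor_id_carrier] by simp
  also have "\<dots> \<le> diamond_norm d \<Phi>" by (rule diamond_norm_upper[OF \<Phi> X tn])
  finally show ?thesis .
qed

section \<open>Frame operators\<close>

lemma conj_msum:
  assumes A: "A \<in> carrier_mat d d" and B: "B \<in> carrier_mat d d" and f: "\<And>x. x \<in> I \<Longrightarrow> f x \<in> carrier_mat d d"
  shows "A * msum d f I * B = msum d (\<lambda>x. A * f x * B) I"
proof (intro eq_matI)
  fix i j assume "i < dim_row (msum d (\<lambda>x. A * f x * B) I)" "j < dim_col (msum d (\<lambda>x. A * f x * B) I)"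
  hence ij: "i < d" "j < d" by auto
  have 1: "(A * msum d f I) $$ (i,k) = (\<Sum>x\<in>I. (A * f x) $$ (i,k))" if k: "k < d" for k
  proof -
    have "(A * msum d f I) $$ (i,k) = (\<Sum>l<d. \<Sum>x\<in>I. A $$ (i,l) * f x $$ (l,k))"
      unfolding index_mult_sum[OF A msum_carrier ij(1) k] using k by (auto simp: sum_distrib_left)
    also have "\<dots> = (\<Sum>x\<in>I. \<Sum>l<d. A $$ (i,l) * f x $$ (l,k))" by (rule sum.swap)
    also have "\<dots> = (\<Sum>x\<in>I. (A * f x) $$ (i,k))"
      using f by (intro sum.cong refl) (simp only: index_mult_sum[OF A _ ij(1) k])
    finally show ?thesis .
  qed
  have Am: "A * msum d f I \<in> carrier_mat d d" using A by simp
  have "(A * msum d f I * B) $$ (i,j) = (\<Sum>k<d. \<Sum>x\<in>I. (A * f x) $$ (i,k) * B $$ (k,j))"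
    unfolding index_mult_sum[OF Am B ij] using 1 by (auto simp: sum_distrib_right simp del: index_mult_mat(1))
  also have "\<dots> = (\<Sum>x\<in>I. \<Sum>k<d. (A * f x) $$ (i,k) * B $$ (k,j))" by (rule sum.swap)
  also have "\<dots> = (\<Sum>x\<in>I. (A * f x * B) $$ (i,j))"
  proof (intro sum.cong refl)
    fix x assume "x \<in> I"
    hence "A * f x \<in> carrier_mat d d" using A f by simp
    thus "(\<Sum>k<d. (A * f x) $$ (i,k) * B $$ (k,j)) = (A * f x * B) $$ (i,j)"
      by (simp only: index_mult_sum[OF _ B ij])
  qed
  finally show "(A * msum d f I * B) $$ (i,j) = msum d (\<lambda>x. A * f x * B) I $$ (i,j)"
    using ij by simp
qed (use A B in auto)

text \<open>Taking the trace against \<open>pauli a\<close> compares the coefficients. This is what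
  makes the label in \<open>Xi\<close> and its sign unique.\<close>

lemma pauli_smult_inj:
  assumes "a \<in> labels n" "b \<in> labels n" "s \<cdot>\<^sub>m pauli a = t \<cdot>\<^sub>m pauli b" "s \<noteq> 0"
  shows "a = b" "s = t"
proof -
  note c = pauli_carrier[OF assms(1)] pauli_carrier[OF assms(2)]
  have 1: "trace (pauli a * (s \<cdot>\<^sub>m pauli a)) = s * 2^n"
    using c assms(1,2) by (simp add: mult_smult_distrib[of _ "2^n" "2^n" _ "2^n"] trace_smult[of _ "2^n"] pauli_orth)
  have 2: "trace (pauli a * (t \<cdot>\<^sub>m pauli b)) = t * (if a = b then 2^n else 0)"
    using c assms(1,2) by (simp add: mult_smult_distrib[of _ "2^n" "2^n" _ "2^n"] trace_smult[of _ "2^n"] pauli_orth[of a n b])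
  have "s * 2^n = t * (if a = b then 2^n else 0)"
    by (rule trans[OF 1[unfolded assms(3), symmetric] 2])
  thus "a = b" "s = t" using assms(4) by (auto split: if_splits)
qed

text \<open>The definite description in \<open>Xi\<close> is meaningful: the normalizer property
  gives existence, trace orthogonality of the Pauli matrices gives uniqueness.\<close>

lemma Xi_spec:
  assumes g: "g \<in> clifford n" and z: "z \<in> bitstrings n"
  shows "Xi n z g \<in> labels n" "\<exists>s\<in>{1,-1}. adj g * Zz z * g = s \<cdot>\<^sub>m pauli (Xi n z g)"
proof -
  have one: "pauli b = 1 \<cdot>\<^sub>m pauli b" "- pauli b = (-1) \<cdot>\<^sub>m pauli b" for b by (intro eq_matI; simp)+
  let ?P = "\<lambda>b. length b = n \<and> (adj g * Zz z * g = pauli b \<or> adj g * Zz z * g = - pauli b)"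
  have P: "?P b \<longleftrightarrow> b \<in> labels n \<and> (\<exists>s\<in>{1,-1}. adj g * Zz z * g = s \<cdot>\<^sub>m pauli b)" for b
    unfolding one(2) by (subst (2) one(1)) (auto simp: labels_iff)
  have "map (\<lambda>b. (b, False)) z \<in> labels n" using z by (simp add: labels_iff bitstrings_def)
  then obtain b s where b: "b \<in> labels n" "s \<in> {1,-1}" "adj g * Zz z * g = s \<cdot>\<^sub>m pauli b"
    using clifford_normalizer[OF g] unfolding pauli_normalizer_def Zz_eq_pauli by blast
  have "\<exists>!b. ?P b"
  proof (rule ex1I[of _ b])
    show "?P b" using P b by blast
    fix b' assume "?P b'"
    then obtain s' where "b' \<in> labels n" "s' \<in> {1,-1}" "adj g * Zz z * g = s' \<cdot>\<^sub>m pauli b'" using P by blast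
    thus "b' = b" using pauli_smult_inj(1)[of b' n b s' s] b by auto
  qed
  from theI'[OF this] show "Xi n z g \<in> labels n" "\<exists>s\<in>{1,-1}. adj g * Zz z * g = s \<cdot>\<^sub>m pauli (Xi n z g)"
    unfolding Xi_def[symmetric] using P by blast+
qed

lemma clifford_carrier: "g \<in> clifford n \<Longrightarrow> g \<in> carrier_mat (2^n) (2^n)"
  using clifford_normalizer by (simp add: pauli_normalizer_def)

text \<open>Each \<open>Zz z\<close> enters once in the trace and once as an operator. Both
  occurrences become \<open>pauli (Xi n z g)\<close> with the same sign, so the sign squares to one;
  this is why \<open>Xi\<close> may forget it.\<close>

lemma conj_Mmap:
  assumes g: "g \<in> clifford n" and C: "C \<in> carrier_mat (2^n) (2^n)"
  shows "omega_adj g (Mmap (2^n) (omega g C)) =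
     msum (2^n) (\<lambda>z. (trace (pauli (Xi n z g) * C) / 2^n) \<cdot>\<^sub>m pauli (Xi n z g)) (bitstrings n)"
proof -
  let ?d = "2^n :: nat"
  note gc = clifford_carrier[OF g]
  have om: "omega g C \<in> carrier_mat ?d ?d" using gc C by (simp add: omega_def)
  have "omega_adj g (Mmap ?d (omega g C)) =
     msum ?d (\<lambda>z. adj g * ((trace (Zz z * omega g C) / 2^n) \<cdot>\<^sub>m Zz z) * g) (bitstrings n)"
    unfolding omega_adj_def Mmap_eq[OF om] using gc by (intro conj_msum) (auto simp: Zz_carrier)
  also have "\<dots> = msum ?d (\<lambda>z. (trace (pauli (Xi n z g) * C) / 2^n) \<cdot>\<^sub>m pauli (Xi n z g)) (bitstrings n)"
  proof (rule msum_cong[OF refl])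
    fix z assume z: "z \<in> bitstrings n"
    note Z = Zz_carrier[OF z] and P = pauli_carrier[OF Xi_spec(1)[OF g z]]
    obtain s where s: "s \<in> {1,-1}" "adj g * Zz z * g = s \<cdot>\<^sub>m pauli (Xi n z g)"
      using Xi_spec(2)[OF g z] by blast
    have "trace (Zz z * omega g C) = trace ((Zz z * g * C) * adj g)"
      using gc C Z by (simp add: omega_def mult_assoc_sq[of _ ?d])
    also have "\<dots> = trace (adj g * (Zz z * g * C))" using gc C Z by (intro trace_comm) auto
    also have "adj g * (Zz z * g * C) = (adj g * Zz z * g) * C"
      using gc C Z by (simp add: mult_assoc_sq[of _ ?d])
    also have "trace \<dots> = s * trace (pauli (Xi n z g) * C)"
      unfolding s(2) using P C by (simp add: mult_smult_assoc_mat[of _ ?d ?d _ ?d] trace_smult[of _ ?d])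
    finally have tr: "trace (Zz z * omega g C) = s * trace (pauli (Xi n z g) * C)" .
    have "adj g * ((trace (Zz z * omega g C) / 2^n) \<cdot>\<^sub>m Zz z) * g = (trace (Zz z * omega g C) / 2^n) \<cdot>\<^sub>m (adj g * Zz z * g)"
      using gc Z by (simp add: mult_smult_assoc_mat[of _ ?d ?d _ ?d] mult_smult_distrib[of _ ?d ?d _ ?d])
    also have "\<dots> = (s * s * trace (pauli (Xi n z g) * C) / 2^n) \<cdot>\<^sub>m pauli (Xi n z g)"
      unfolding s(2) tr by (intro eq_matI) auto
    also have "s * s = 1" using s(1) by auto
    finally show "adj g * ((trace (Zz z * omega g C) / 2^n) \<cdot>\<^sub>m Zz z) * g
        = (trace (pauli (Xi n z g) * C) / 2^n) \<cdot>\<^sub>m pauli (Xi n z g)" by simp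
  qed
  finally show ?thesis .
qed

text \<open>Orthogonality selects exactly the pairs (z,g) with \<open>Xi n z g = a\<close>, and the
  squared norm 2^n of \<open>pauli a\<close> cancels the normalisation of the measurement
  map.\<close>

lemma trace_pauli_frame:
  assumes G: "G \<subseteq> clifford n" "finite G" and \<Lambda>: "\<And>g. g \<in> G \<Longrightarrow> \<Lambda> g C \<in> carrier_mat (2^n) (2^n)"
    and a: "a \<in> labels n"
  shows "trace (pauli a * frameS_tilde (2^n) G p \<Lambda> C)
    = (\<Sum>z\<in>bitstrings n. \<Sum>g\<in>{g\<in>G. Xi n z g = a}. of_real (p g) * trace (pauli a * \<Lambda> g C))"
proof -
  let ?d = "2^n :: nat"
  note ac = pauli_carrier[OF a]
  have oc: "omega_adj g (Mmap ?d (omega g (\<Lambda> g C))) \<in> carrier_mat ?d ?d" if "g \<in> G" for g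
    using clifford_carrier[of g n] that G by (auto simp: omega_adj_def)
  have one: "trace (pauli a * omega_adj g (Mmap ?d (omega g (\<Lambda> g C))))
     = (\<Sum>z\<in>bitstrings n. if Xi n z g = a then trace (pauli a * \<Lambda> g C) else 0)" if "g \<in> G" for g
  proof -
    have gc: "g \<in> clifford n" using that G by auto
    have "trace (pauli a * omega_adj g (Mmap ?d (omega g (\<Lambda> g C)))) =
        (\<Sum>z\<in>bitstrings n. trace (pauli a * ((trace (pauli (Xi n z g) * \<Lambda> g C) / 2^n) \<cdot>\<^sub>m pauli (Xi n z g))))"
      unfolding conj_Mmap[OF gc \<Lambda>[OF that]] using Xi_spec(1)[OF gc] by (intro trace_mult_msum ac) (auto simp: pauli_carrier)
    also have "\<dots> = (\<Sum>z\<in>bitstrings n. if Xi n z g = a then trace (pauli a * \<Lambda> g C) else 0)"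
    proof (intro sum.cong refl)
      fix z assume z: "z \<in> bitstrings n"
      note X = Xi_spec(1)[OF gc z]
      have "trace (pauli a * ((trace (pauli (Xi n z g) * \<Lambda> g C) / 2^n) \<cdot>\<^sub>m pauli (Xi n z g)))
         = (trace (pauli (Xi n z g) * \<Lambda> g C) / 2^n) * (if a = Xi n z g then 2^n else 0)"
        using ac pauli_carrier[OF X]
        by (simp add: mult_smult_distrib[of _ ?d ?d _ ?d] trace_smult[of _ ?d] pauli_orth[OF a X])
      thus "trace (pauli a * ((trace (pauli (Xi n z g) * \<Lambda> g C) / 2^n) \<cdot>\<^sub>m pauli (Xi n z g)))
         = (if Xi n z g = a then trace (pauli a * \<Lambda> g C) else 0)" by auto
    qed
    finally show ?thesis .
  qed
  have "trace (pauli a * frameS_tilde ?d G p \<Lambda> C)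
     = (\<Sum>g\<in>G. of_real (p g) * trace (pauli a * omega_adj g (Mmap ?d (omega g (\<Lambda> g C)))))"
    unfolding frameS_tilde_def using ac oc
    by (subst trace_mult_msum) (auto simp: mult_smult_distrib[of _ ?d ?d _ ?d] trace_smult[of _ ?d] intro!: sum.cong)
  also have "\<dots> = (\<Sum>g\<in>G. \<Sum>z\<in>bitstrings n. if Xi n z g = a then of_real (p g) * trace (pauli a * \<Lambda> g C) else 0)"
    by (intro sum.cong refl) (auto simp: one sum_distrib_left intro!: sum.cong)
  also have "\<dots> = (\<Sum>z\<in>bitstrings n. \<Sum>g\<in>G. if Xi n z g = a then of_real (p g) * trace (pauli a * \<Lambda> g C) else 0)"
    by (rule sum.swap)
  finally show ?thesis using G(2) by (simp add: sum.inter_filter)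
qed

text \<open>The ideal frame operator is the case of identity channels, so one coefficient formula
  serves both operators.\<close>

lemma frameS_eq_tilde: "frameS d G p C = frameS_tilde d G p (\<lambda>_. id) C"
  by (simp add: frameS_def frameS_tilde_def)

lemma trace_pauli_frameS:
  assumes G: "G \<subseteq> clifford n" "finite G" and C: "C \<in> carrier_mat (2^n) (2^n)" and a: "a \<in> labels n"
  shows "trace (pauli a * frameS (2^n) G p C) = of_real (s_weight n G p a) * trace (pauli a * C)"
  unfolding frameS_eq_tilde using assms
  by (subst trace_pauli_frame) (auto simp: s_weight_def sum_distrib_right)

lemma eq_by_pauli_traces:
  assumes "A \<in> carrier_mat (2^n) (2^n)" "B \<in> carrier_mat (2^n) (2^n)"
    "\<And>a. a \<in> labels n \<Longrightarrow> trace (pauli a * A) = trace (pauli a * B)"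
  shows "A = B"
proof -
  have "A = msum (2^n) (\<lambda>a. (trace (pauli a * A) / 2^n) \<cdot>\<^sub>m pauli a) (labels n)"
    by (rule pauli_expand[OF assms(1)])
  also have "\<dots> = msum (2^n) (\<lambda>a. (trace (pauli a * B) / 2^n) \<cdot>\<^sub>m pauli a) (labels n)"
    by (intro msum_cong refl) (simp add: assms(3))
  also have "\<dots> = B" by (rule pauli_expand[OF assms(2), symmetric])
  finally show ?thesis .
qed

text \<open>If the weight were zero, the frame operator would send \<open>pauli a\<close> to the
  same image as the zero matrix, contradicting injectivity.\<close>

lemma s_weight_pos:
  assumes G: "G \<subseteq> clifford n" "finite G" and p: "\<forall>g\<in>G. 0 \<le> p g"
    and S: "inj_on (frameS (2^n) G p) (carrier_mat (2^n) (2^n))" and a: "a \<in> labels n"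
  shows "0 < s_weight n G p a"
proof -
  let ?d = "2^n :: nat"
  have "0 \<le> s_weight n G p a" using p by (auto simp: s_weight_def intro!: sum_nonneg)
  moreover have "s_weight n G p a \<noteq> 0"
  proof
    assume 0: "s_weight n G p a = 0"
    note ac = pauli_carrier[OF a]
    have "frameS ?d G p (pauli a) = frameS ?d G p (0\<^sub>m ?d ?d)"
    proof (rule eq_by_pauli_traces)
      fix b assume b: "b \<in> labels n"
      note bc = pauli_carrier[OF b]
      have "trace (pauli b * 0\<^sub>m ?d ?d) = 0" using bc by (simp add: trace_eq[of _ ?d])
      thus "trace (pauli b * frameS ?d G p (pauli a)) = trace (pauli b * frameS ?d G p (0\<^sub>m ?d ?d))"
        using 0 ac by (simp add: trace_pauli_frameS[OF G _ b] pauli_orth[OF b a])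
    qed (auto simp: frameS_def)
    hence "pauli a = 0\<^sub>m ?d ?d" using S ac by (auto dest: inj_onD)
    hence "trace (pauli a * pauli a) = 0" by (simp add: trace_eq[of _ ?d])
    thus False using pauli_orth[OF a a] by simp
  qed
  ultimately show ?thesis by simp
qed

text \<open>Flattening the double sum to one sum over pairs (z,g) exhibits the averaged channel as a
  single weighted sum, the shape in which \<open>trace_mult_msum\<close> and
  \<open>trace_norm_msum_le\<close> apply.\<close>

lemma avg_channel_eq:
  "avg_channel n G p \<Lambda> a C = msum (2^n) (\<lambda>(z,g). of_real (p g / s_weight n G p a) \<cdot>\<^sub>m \<Lambda> g C)
     (SIGMA z:bitstrings n. {g\<in>G. Xi n z g = a})"
  if "finite G" "\<And>g. g \<in> G \<Longrightarrow> \<Lambda> g C \<in> carrier_mat (2^n) (2^n)"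
proof (intro eq_matI)
  let ?I = "SIGMA z:bitstrings n. {g\<in>G. Xi n z g = a}"
  let ?M = "msum (2^n) (\<lambda>(z,g). of_real (p g / s_weight n G p a) \<cdot>\<^sub>m \<Lambda> g C) ?I"
  fix i j assume "i < dim_row ?M" "j < dim_col ?M"
  hence ij: "i < 2^n" "j < 2^n" by auto
  have "?M $$ (i,j) = (\<Sum>(z,g)\<in>?I. of_real (p g / s_weight n G p a) * \<Lambda> g C $$ (i,j))"
    unfolding msum_index[OF ij] using ij carrier_matD[OF that(2)] by (intro sum.cong refl) auto
  also have "\<dots> = (\<Sum>z\<in>bitstrings n. \<Sum>g\<in>{g\<in>G. Xi n z g = a}. of_real (p g / s_weight n G p a) * \<Lambda> g C $$ (i,j))"
    using that(1) by (subst sum.Sigma) auto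
  finally show "avg_channel n G p \<Lambda> a C $$ (i,j) = ?M $$ (i,j)"
    using ij carrier_matD[OF that(2)]
    by (auto simp: avg_channel_def sum_distrib_left divide_simps intro!: sum.cong)
qed (auto simp: avg_channel_def)

lemma sum_weights:
  assumes "finite G"
  shows "(\<Sum>(z,g)\<in>(SIGMA z:bitstrings n. {g\<in>G. Xi n z g = a}). f g) = (\<Sum>z\<in>bitstrings n. \<Sum>g\<in>{g\<in>G. Xi n z g = a}. f g)"
  using assms by (subst sum.Sigma) auto

section \<open>Bounds on the bias\<close>

lemma trace_pauli_avg_channel:
  assumes "finite G" "\<And>g. g \<in> G \<Longrightarrow> \<Lambda> g C \<in> carrier_mat (2^n) (2^n)" "a \<in> labels n"
  shows "trace (pauli a * avg_channel n G p \<Lambda> a C) = inverse (of_real (s_weight n G p a)) *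
    (\<Sum>z\<in>bitstrings n. \<Sum>g\<in>{g\<in>G. Xi n z g = a}. of_real (p g) * trace (pauli a * \<Lambda> g C))"
proof -
  let ?I = "SIGMA z:bitstrings n. {g\<in>G. Xi n z g = a}"
  have "trace (pauli a * avg_channel n G p \<Lambda> a C)
     = (\<Sum>x\<in>?I. trace (pauli a * (case x of (z,g) \<Rightarrow> of_real (p g / s_weight n G p a) \<cdot>\<^sub>m \<Lambda> g C)))"
    by (subst avg_channel_eq, rule assms(1), erule assms(2), rule trace_mult_msum)
      (use assms pauli_carrier in auto)
  also have "\<dots> = (\<Sum>(z,g)\<in>?I. inverse (of_real (s_weight n G p a)) * (of_real (p g) * trace (pauli a * \<Lambda> g C)))"
  proof (rule sum.cong[OF refl])
    fix x assume "x \<in> ?I"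
    then obtain z g where "x = (z,g)" "g \<in> G" by blast
    thus "trace (pauli a * (case x of (z,g) \<Rightarrow> of_real (p g / s_weight n G p a) \<cdot>\<^sub>m \<Lambda> g C))
      = (case x of (z,g) \<Rightarrow> inverse (of_real (s_weight n G p a)) * (of_real (p g) * trace (pauli a * \<Lambda> g C)))"
      using assms(2) pauli_carrier[OF assms(3)]
      by (simp add: mult_smult_distrib[of _ "2^n" "2^n" _ "2^n"] trace_smult[of _ "2^n"] divide_inverse)
  qed
  finally show ?thesis using assms(1) by (simp add: sum_weights sum_distrib_left)
qed

lemma avg_channel_index:
  assumes "finite G" "\<And>g. g \<in> G \<Longrightarrow> \<Lambda> g C \<in> carrier_mat (2^n) (2^n)" "i < 2^n" "j < 2^n"
  shows "avg_channel n G p \<Lambda> a C $$ (i,j) =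
    (\<Sum>(z,g)\<in>(SIGMA z:bitstrings n. {g\<in>G. Xi n z g = a}). of_real (p g / s_weight n G p a) * \<Lambda> g C $$ (i,j))"
  by (subst avg_channel_eq, rule assms(1), erule assms(2), subst msum_index[OF assms(3,4)],
      rule sum.cong[OF refl]) (use assms(3,4) carrier_matD[OF assms(2)] in auto)

lemma avg_channel_carrier [simp]: "avg_channel n G p \<Lambda> a C \<in> carrier_mat (2^n) (2^n)"
  by (simp add: avg_channel_def)

lemma avg_channel_linear:
  assumes "finite G" and L: "\<And>g. g \<in> G \<Longrightarrow> linear_sop (2^n) (\<Lambda> g)"
  shows "linear_sop (2^n) (avg_channel n G p \<Lambda> a)"
  unfolding linear_sop_def
proof (intro conjI ballI allI)
  let ?d = "2^n :: nat" and ?A = "avg_channel n G p \<Lambda> a"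
  note D = linear_sopD[OF L]
  note I = avg_channel_index[where \<Lambda>=\<Lambda>, OF assms(1) D(1)]
  fix A B :: "complex mat" and c :: complex assume A: "A \<in> carrier_mat ?d ?d"
  show "?A A \<in> carrier_mat ?d ?d" by simp
  have dA: "dim_row (?A C) = ?d" "dim_col (?A C) = ?d" for C using avg_channel_carrier by blast+
  show "?A (c \<cdot>\<^sub>m A) = c \<cdot>\<^sub>m ?A A"
  proof (intro eq_matI)
    fix i j assume "i < dim_row (c \<cdot>\<^sub>m ?A A)" "j < dim_col (c \<cdot>\<^sub>m ?A A)"
    hence ij: "i < ?d" "j < ?d" by (auto simp: dA)
    show "?A (c \<cdot>\<^sub>m A) $$ (i,j) = (c \<cdot>\<^sub>m ?A A) $$ (i,j)"
      using ij A D carrier_matD[OF D(1)]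
      by (simp add: I dA sum_distrib_left) (auto simp: mult_ac intro!: sum.cong)
  qed (auto simp: dA)
  assume B: "B \<in> carrier_mat ?d ?d"
  show "?A (A + B) = ?A A + ?A B"
  proof (intro eq_matI)
    fix i j assume "i < dim_row (?A A + ?A B)" "j < dim_col (?A A + ?A B)"
    hence ij: "i < ?d" "j < ?d" by (auto simp: dA)
    show "?A (A + B) $$ (i,j) = (?A A + ?A B) $$ (i,j)"
      using ij A B D(1,2) carrier_matD[OF D(1)]
      by (simp add: I dA split_def flip: sum.distrib) (intro sum.cong refl, auto simp: distrib_left add_divide_distrib)
  qed (auto simp: dA)
qed

lemma diamond_norm_avg_le:
  assumes G: "finite G" and L: "\<And>g. g \<in> G \<Longrightarrow> linear_sop (2^n) (\<Lambda> g)"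
    and p: "\<forall>g\<in>G. 0 \<le> p g" and s: "0 < s_weight n G p a"
    and b: "\<And>g. g \<in> G \<Longrightarrow> diamond_norm (2^n) (\<lambda>C. C - \<Lambda> g C) \<le> b"
  shows "diamond_norm (2^n) (\<lambda>C. C - avg_channel n G p \<Lambda> a C) \<le> b"
proof (rule diamond_norm_least)
  let ?d = "2^n :: nat"
  let ?I = "SIGMA z:bitstrings n. {g\<in>G. Xi n z g = a}"
  let ?w = "\<lambda>(z,g). p g / s_weight n G p a"
  fix X assume X: "X \<in> carrier_mat (?d * ?d) (?d * ?d)" "trace_norm X \<le> 1"
  let ?T = "\<lambda>(z,g). tensor_id ?d ?d (\<lambda>C. C - \<Lambda> g C) X"
  \<comment> \<open>The weights add up to one by the very definition of \<open>s_weight\<close>; its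
    positivity rules out 0/0.\<close>
  have w1: "(\<Sum>x\<in>?I. ?w x) = 1"
  proof -
    have "(\<Sum>x\<in>?I. ?w x) = s_weight n G p a / s_weight n G p a"
      unfolding sum_weights[OF G] by (subst (2) s_weight_def) (simp only: sum_divide_distrib)
    thus ?thesis using s by simp
  qed
  have "tensor_id ?d ?d (\<lambda>C. C - avg_channel n G p \<Lambda> a C) X = msum (?d * ?d) (\<lambda>x. of_real (?w x) \<cdot>\<^sub>m ?T x) ?I"
    (is "?L = ?R")
  proof (rule eq_matI)
    fix i j assume "i < dim_row ?R" "j < dim_col ?R"
    hence ij: "i < ?d * ?d" "j < ?d * ?d" by (simp_all del: power_mult_distrib)
    hence ij': "i div ?d < ?d" "j div ?d < ?d" by (auto intro: div_less_mult)
    let ?B = "blk ?d ?d X (i mod ?d) (j mod ?d)"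
    have Bc: "?B \<in> carrier_mat ?d ?d" by (rule blk_carrier)
    note \<Lambda>B = linear_sopD(1)[OF L Bc]
    have dA: "dim_row (avg_channel n G p \<Lambda> a ?B) = ?d" "dim_col (avg_channel n G p \<Lambda> a ?B) = ?d"
      using avg_channel_carrier by blast+
    have "?L $$ (i,j) = ?B $$ (i div ?d, j div ?d) - avg_channel n G p \<Lambda> a ?B $$ (i div ?d, j div ?d)"
      unfolding tensor_id_index[OF ij] using ij' dA by simp
    \<comment> \<open>The identity map is multiplied by the total weight one, so that it can be
      distributed over the same pairs as the averaged channel.\<close>
    also have "\<dots> = of_real (\<Sum>x\<in>?I. ?w x) * ?B $$ (i div ?d, j div ?d) -
       (\<Sum>(z,g)\<in>?I. of_real (p g / s_weight n G p a) * \<Lambda> g ?B $$ (i div ?d, j div ?d))"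
      unfolding w1 by (subst avg_channel_index[OF G _ ij']) (use \<Lambda>B in auto)
    also have "\<dots> = (\<Sum>x\<in>?I. of_real (?w x) * ?B $$ (i div ?d, j div ?d)) -
       (\<Sum>(z,g)\<in>?I. of_real (p g / s_weight n G p a) * \<Lambda> g ?B $$ (i div ?d, j div ?d))"
      by (simp only: of_real_sum sum_distrib_right)
    also have "\<dots> = (\<Sum>x\<in>?I. of_real (?w x) * ?T x $$ (i,j))"
      unfolding sum_subtractf[symmetric]
    proof (rule sum.cong[OF refl])
      fix x assume "x \<in> ?I"
      then obtain z g where x: "x = (z,g)" and g: "g \<in> G" by blast
      hence "(?B - \<Lambda> g ?B) $$ (i div ?d, j div ?d) = ?B $$ (i div ?d, j div ?d) - \<Lambda> g ?B $$ (i div ?d, j div ?d)"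
        using ij' carrier_matD[OF \<Lambda>B] by simp
      hence "tensor_id ?d ?d (\<lambda>C. C - \<Lambda> g C) X $$ (i,j)
          = ?B $$ (i div ?d, j div ?d) - \<Lambda> g ?B $$ (i div ?d, j div ?d)"
        unfolding tensor_id_index[OF ij] .
      thus "of_real (?w x) * ?B $$ (i div ?d, j div ?d) -
            (case x of (z,g) \<Rightarrow> of_real (p g / s_weight n G p a) * \<Lambda> g ?B $$ (i div ?d, j div ?d))
          = of_real (?w x) * ?T x $$ (i,j)"
        unfolding x prod.case by (simp only: right_diff_distrib)
    qed
    also have "\<dots> = ?R $$ (i,j)"
      unfolding msum_index[OF ij] using ij carrier_matD[OF tensor_id_carrier[of ?d ?d]]
      by (intro sum.cong refl) (auto simp del: power_mult_distrib)
    finally show "?L $$ (i,j) = ?R $$ (i,j)" .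
  qed (auto simp: tensor_id_def)
  hence "trace_norm ?L \<le> (\<Sum>x\<in>?I. ?w x * trace_norm (?T x))"
    using trace_norm_msum_le[of ?I ?T "?d * ?d" ?w] p s by (auto simp del: power_mult_distrib)
  also have "\<dots> \<le> (\<Sum>x\<in>?I. ?w x * b)"
  proof (rule sum_mono)
    fix x assume "x \<in> ?I"
    then obtain z g where x: "x = (z,g)" and g: "g \<in> G" by blast
    have "trace_norm (tensor_id ?d ?d (\<lambda>C. C - \<Lambda> g C) X) \<le> b"
      using diamond_norm_upper[OF linear_sop_diff_id[OF L[OF g]] X] b[OF g] by linarith
    thus "?w x * trace_norm (?T x) \<le> ?w x * b"
      unfolding x prod.case using p g s by (intro mult_left_mono) auto
  qed
  also have "\<dots> = b" by (simp only: w1 mult_1 flip: sum_distrib_right)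
  finally show "trace_norm ?L \<le> b" .
qed

section \<open>Hilbert-Schmidt estimates and Pauli channels\<close>

lemma pauli_parseval:
  assumes A: "A \<in> carrier_mat (2^n) (2^n)"
  shows "(\<Sum>a\<in>labels n. (cmod (trace (pauli a * A)))\<^sup>2) = 2^n * Re (hs_inner A A)"
proof -
  let ?d = "2^n :: nat"
  have Ac: "adj A \<in> carrier_mat ?d ?d" using A by simp
  have "trace (adj A * A) = trace (adj A * msum ?d (\<lambda>a. (trace (pauli a * A) / 2^n) \<cdot>\<^sub>m pauli a) (labels n))"
    using pauli_expand[OF A] by simp
  also have "\<dots> = (\<Sum>a\<in>labels n. trace (adj A * ((trace (pauli a * A) / 2^n) \<cdot>\<^sub>m pauli a)))"
    by (intro trace_mult_msum Ac) (auto simp: pauli_carrier)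
  also have "\<dots> = (\<Sum>a\<in>labels n. of_real ((cmod (trace (pauli a * A)))\<^sup>2 / 2^n))"
  proof (intro sum.cong refl)
    fix a assume a: "a \<in> labels n"
    note ac = pauli_carrier[OF a]
    have "trace (adj A * pauli a) = trace (adj (pauli a * A))"
      using A ac by (simp add: adj_mult[of _ ?d ?d _ ?d])
    also have "\<dots> = cnj (trace (pauli a * A))"
      using A ac by (simp add: trace_eq[of _ ?d])
    finally show "trace (adj A * ((trace (pauli a * A) / 2^n) \<cdot>\<^sub>m pauli a)) = of_real ((cmod (trace (pauli a * A)))\<^sup>2 / 2^n)"
      using A ac by (simp add: mult_smult_distrib[of _ ?d ?d _ ?d] trace_smult[of _ ?d] flip: complex_norm_square)
  qed
  also have "\<dots> = of_real ((\<Sum>a\<in>labels n. (cmod (trace (pauli a * A)))\<^sup>2) / 2^n)"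
    by (simp only: of_real_sum sum_divide_distrib)
  finally have "Re (hs_inner A A) = (\<Sum>a\<in>labels n. (cmod (trace (pauli a * A)))\<^sup>2) / 2^n"
    unfolding hs_inner_def by (simp only: Re_complex_of_real)
  thus ?thesis by simp
qed

text \<open>The l2 norm of the singular values is at most their l1 norm. Applied to a state it says
  that the purity is at most one.\<close>

lemma hs_inner_le_trace_norm:
  assumes X: "X \<in> carrier_mat n n"
  shows "0 \<le> Re (hs_inner X X)" "Re (hs_inner X X) \<le> (trace_norm X)\<^sup>2"
proof -
  obtain V f where V: "unitary n V" and eq: "adj X * X = V * dmat n (\<lambda>i. complex_of_real (f i)) * adj V"
    and tn: "trace_norm X = (\<Sum>i<n. sqrt (f i))" and f: "\<And>i. i < n \<Longrightarrow> 0 \<le> f i"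
    using trace_norm_svd[OF X] by metis
  note c = unitaryD(1)[OF V]
  have "hs_inner X X = trace (V * (dmat n (\<lambda>i. complex_of_real (f i)) * adj V))"
    unfolding hs_inner_def eq using c by (simp add: mult_assoc_sq[of _ n])
  also have "\<dots> = trace (dmat n (\<lambda>i. complex_of_real (f i)) * adj V * V)"
    using c by (intro trace_comm) auto
  also have "\<dots> = trace (dmat n (\<lambda>i. complex_of_real (f i)))"
    using c unitaryD[OF V] by (simp add: mult_assoc_sq[of _ n])
  also have "\<dots> = of_real (\<Sum>i<n. f i)" by (subst trace_eq[of _ n]) auto
  finally have hs: "Re (hs_inner X X) = (\<Sum>i<n. f i)" by (simp only: Re_complex_of_real)
  thus "0 \<le> Re (hs_inner X X)" using f by (auto intro: sum_nonneg)
  have "sqrt (\<Sum>i<n. f i) = L2_set (\<lambda>i. sqrt (f i)) {..<n}"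
    using f by (simp add: L2_set_def)
  also have "\<dots> \<le> trace_norm X" unfolding tn using f by (intro L2_set_le_sum) auto
  finally show "Re (hs_inner X X) \<le> (trace_norm X)\<^sup>2"
    unfolding hs by (rule sqrt_le_D)
qed

text \<open>Conjugation by a Pauli matrix is self-adjoint, so cyclicity of the trace moves the
  channel onto \<open>pauli a\<close>, where each conjugation is a sign. Thus the eigenvalue also
  scales the Pauli coefficient of an arbitrary \<open>C\<close>.\<close>

lemma pauli_channel_eig:
  assumes \<Lambda>: "pauli_channel n \<Lambda>" and a: "a \<in> labels n" and C: "C \<in> carrier_mat (2^n) (2^n)"
  shows "trace (pauli a * \<Lambda> C) = pauli_eig \<Lambda> a * trace (pauli a * C)"
proof -
  let ?d = "2^n :: nat"
  note ac = pauli_carrier[OF a]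
  obtain q where q: "\<And>A. A \<in> carrier_mat ?d ?d \<Longrightarrow>
      \<Lambda> A = msum ?d (\<lambda>b. complex_of_real (q b) \<cdot>\<^sub>m (pauli b * A * pauli b)) (labels n)"
    using \<Lambda> unfolding pauli_channel_def by blast
  have "\<forall>b\<in>labels n. \<exists>u. pauli b * pauli a * pauli b = u \<cdot>\<^sub>m pauli a" using pauli_conj[OF _ a] by blast
  then obtain u where u: "\<And>b. b \<in> labels n \<Longrightarrow> pauli b * pauli a * pauli b = u b \<cdot>\<^sub>m pauli a" by metis
  define l where "l = (\<Sum>b\<in>labels n. of_real (q b) * u b)"
  have \<Lambda>a: "\<Lambda> (pauli a) = l \<cdot>\<^sub>m pauli a"
  proof (rule eq_matI)
    fix i j assume "i < dim_row (l \<cdot>\<^sub>m pauli a)" "j < dim_col (l \<cdot>\<^sub>m pauli a)"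
    hence ij: "i < ?d" "j < ?d" using ac by auto
    show "\<Lambda> (pauli a) $$ (i,j) = (l \<cdot>\<^sub>m pauli a) $$ (i,j)"
      unfolding q[OF ac] msum_index[OF ij] using ij ac by (simp add: u l_def sum_distrib_right mult.assoc)
  qed (use ac q[OF ac] in auto)
  \<comment> \<open>The eigenvalue is unique because \<open>pauli a\<close> has non-zero
    Hilbert-Schmidt norm, so the definite description denotes \<open>l\<close>.\<close>
  have "pauli_eig \<Lambda> a = l"
    unfolding pauli_eig_def
  proof (rule the_equality)
    fix c assume "\<Lambda> (pauli a) = c \<cdot>\<^sub>m pauli a"
    hence "c * trace (pauli a * pauli a) = l * trace (pauli a * pauli a)"
      using ac \<Lambda>a by (simp flip: trace_smult[of _ ?d] mult_smult_distrib[of _ ?d ?d _ ?d])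
    thus "c = l" by (simp add: pauli_orth[OF a a])
  qed (rule \<Lambda>a)
  moreover have "trace (pauli a * \<Lambda> C) = (\<Sum>b\<in>labels n. of_real (q b) * (u b * trace (pauli a * C)))"
  proof -
    have "trace (pauli a * \<Lambda> C) = (\<Sum>b\<in>labels n. trace (pauli a * (complex_of_real (q b) \<cdot>\<^sub>m (pauli b * C * pauli b))))"
      unfolding q[OF C] using C by (intro trace_mult_msum ac) (auto simp: pauli_carrier)
    also have "\<dots> = (\<Sum>b\<in>labels n. of_real (q b) * (u b * trace (pauli a * C)))"
    proof (intro sum.cong refl)
      fix b assume b: "b \<in> labels n"
      note bc = pauli_carrier[OF b]
      have "trace (pauli a * (pauli b * C * pauli b)) = trace ((pauli a * pauli b * C) * pauli b)"
        using ac bc C by (simp add: mult_assoc_sq[of _ ?d])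
      also have "\<dots> = trace (pauli b * (pauli a * pauli b * C))" using ac bc C by (intro trace_comm) auto
      also have "pauli b * (pauli a * pauli b * C) = (pauli b * pauli a * pauli b) * C"
        using ac bc C by (simp add: mult_assoc_sq[of _ ?d])
      also have "trace \<dots> = u b * trace (pauli a * C)"
        unfolding u[OF b] using ac C by (simp add: mult_smult_assoc_mat[of _ ?d ?d _ ?d] trace_smult[of _ ?d])
      finally show "trace (pauli a * (complex_of_real (q b) \<cdot>\<^sub>m (pauli b * C * pauli b))) = of_real (q b) * (u b * trace (pauli a * C))"
        using ac bc C by (simp add: mult_smult_distrib[of _ ?d ?d _ ?d] trace_smult[of _ ?d])
    qed
    finally show ?thesis .
  qed
  ultimately show ?thesis by (simp add: l_def sum_distrib_right mult.assoc)
qed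

theorem theorem1:
  fixes n :: nat and G :: "complex mat set" and p :: "complex mat \<Rightarrow> real"
    and \<Lambda> :: "complex mat \<Rightarrow> sop" and Obs \<rho> :: "complex mat"
  assumes n: "n \<ge> 1"
    and G: "G \<subseteq> clifford n" "finite G"
    and p: "\<forall>g\<in>G. 0 \<le> p g" "(\<Sum>g\<in>G. p g) = 1"
    and S_inv: "bij_betw (frameS (2^n) G p) (carrier_mat (2^n) (2^n)) (carrier_mat (2^n) (2^n))"
    and chan: "\<forall>g\<in>clifford n. quantum_channel (2^n) (\<Lambda> g)"
    and Obs: "hermitian (2^n) Obs"
    and \<rho>: "density (2^n) \<rho>"
  shows "(bias n G p \<Lambda> Obs \<rho>
            \<le> stab_norm n Obs * (MAX a\<in>labels n. diamond_norm (2^n) (\<lambda>C. C - avg_channel n G p \<Lambda> a C))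
          \<and> stab_norm n Obs * (MAX a\<in>labels n. diamond_norm (2^n) (\<lambda>C. C - avg_channel n G p \<Lambda> a C))
            \<le> stab_norm n Obs * (SUP g\<in>clifford n. diamond_norm (2^n) (\<lambda>C. C - \<Lambda> g C)))
       \<and> ((\<forall>g\<in>clifford n. pauli_channel n (\<Lambda> g)) \<longrightarrow>
            bias n G p \<Lambda> Obs \<rho>
              \<le> min (hs_norm Obs) (stab_norm n Obs) * (MAX a\<in>labels n. cmod (1 - avg_eig n G p \<Lambda> a)))"
proof -
  let ?d = "2^n :: nat"
  let ?S = "frameS ?d G p" and ?avg = "avg_channel n G p \<Lambda>" and ?s = "s_weight n G p"
  have O: "Obs \<in> carrier_mat ?d ?d" "adj Obs = Obs" using Obs by (auto simp: hermitian_def)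
  have psd: "psd ?d \<rho>" and tr1: "trace \<rho> = 1" using \<rho> by (auto simp: density_def)
  have rc: "\<rho> \<in> carrier_mat ?d ?d" using psd by (auto simp: psd_def hermitian_def)
  have lin: "linear_sop ?d (\<Lambda> g)" if "g \<in> G" for g using chan G that by (auto simp: quantum_channel_def)
  have \<Lambda>\<rho>: "\<Lambda> g \<rho> \<in> carrier_mat ?d ?d" if "g \<in> G" for g by (rule linear_sopD(1)[OF lin[OF that] rc])
  have s: "0 < ?s a" if "a \<in> labels n" for a
    by (rule s_weight_pos[OF G p(1) bij_betw_imp_inj_on[OF S_inv] that])
  define R where "R = inv_into (carrier_mat ?d ?d) ?S (frameS_tilde ?d G p \<Lambda> \<rho>)"
  have T: "frameS_tilde ?d G p \<Lambda> \<rho> \<in> ?S ` carrier_mat ?d ?d"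
    using bij_betw_imp_surj_on[OF S_inv] by (simp add: frameS_tilde_def)
  have Rc: "R \<in> carrier_mat ?d ?d" unfolding R_def by (rule inv_into_into[OF T])
  have SR: "?S R = frameS_tilde ?d G p \<Lambda> \<rho>" unfolding R_def by (rule f_inv_into_f[OF T])
  have trR: "trace (pauli a * R) = trace (pauli a * ?avg a \<rho>)" if a: "a \<in> labels n" for a
  proof -
    \<comment> \<open>The inverse is never computed: the coefficients are compared after applying
      the frame operator to \<open>R\<close>, and the positive weight is cancelled.\<close>
    have "of_real (?s a) * trace (pauli a * R) = trace (pauli a * frameS_tilde ?d G p \<Lambda> \<rho>)"
      unfolding SR[symmetric] by (rule trace_pauli_frameS[OF G Rc a, symmetric])
    also have "\<dots> = of_real (?s a) * trace (pauli a * ?avg a \<rho>)"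
      using s[OF a] trace_pauli_avg_channel[OF G(2) _ a, of \<Lambda> \<rho> p] trace_pauli_frame[OF G _ a, of \<Lambda> \<rho> p] \<Lambda>\<rho>
      by simp
    finally show ?thesis using s[OF a] by simp
  qed
  define D where "D = \<rho> - R"
  have Dc: "D \<in> carrier_mat ?d ?d" unfolding D_def using Rc by (rule minus_carrier_mat)
  have trD: "trace (pauli a * D) = trace (pauli a * \<rho>) - trace (pauli a * ?avg a \<rho>)" if a: "a \<in> labels n" for a
    unfolding D_def trR[OF a, symmetric] using pauli_carrier[OF a] rc Rc
    by (simp add: mult_minus_distrib_mat[of _ ?d ?d _ ?d] trace_minus[of _ ?d])
  let ?h = "\<lambda>a. cmod (hs_inner (pauli a) Obs)"
  have bias: "bias n G p \<Lambda> Obs \<rho> \<le> 1 / 2^n * (\<Sum>a\<in>labels n. ?h a * cmod (trace (pauli a * D)))"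
  proof -
    have "trace (Obs * \<rho>) - hs_inner Obs R = trace (Obs * D)"
      unfolding D_def hs_inner_def O(2) using O rc Rc
      by (simp add: mult_minus_distrib_mat[of _ ?d ?d _ ?d] trace_minus[of _ ?d])
    also have "\<dots> = trace (Obs * msum ?d (\<lambda>a. (trace (pauli a * D) / 2^n) \<cdot>\<^sub>m pauli a) (labels n))"
      using pauli_expand[OF Dc] by simp
    also have "\<dots> = (\<Sum>a\<in>labels n. trace (Obs * ((trace (pauli a * D) / 2^n) \<cdot>\<^sub>m pauli a)))"
      by (intro trace_mult_msum O) (auto simp: pauli_carrier)
    also have "\<dots> = (\<Sum>a\<in>labels n. trace (pauli a * D) / 2^n * hs_inner (pauli a) Obs)"
    proof (intro sum.cong refl)
      fix a assume a: "a \<in> labels n"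
      show "trace (Obs * ((trace (pauli a * D) / 2^n) \<cdot>\<^sub>m pauli a)) = trace (pauli a * D) / 2^n * hs_inner (pauli a) Obs"
        using pauli_carrier[OF a] O trace_comm[OF O(1) pauli_carrier[OF a]]
        by (simp add: hs_inner_def mult_smult_distrib[of _ ?d ?d _ ?d] trace_smult[of _ ?d])
    qed
    finally have "bias n G p \<Lambda> Obs \<rho> = cmod (\<Sum>a\<in>labels n. trace (pauli a * D) / 2^n * hs_inner (pauli a) Obs)"
      by (simp add: bias_def R_def)
    also have "\<dots> \<le> (\<Sum>a\<in>labels n. 1 / 2^n * (?h a * cmod (trace (pauli a * D))))"
      by (rule sum_norm_le) (simp add: norm_mult norm_divide norm_power mult_ac)
    finally show ?thesis by (simp add: sum_distrib_left)
  qed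
  \<comment> \<open>Hoelder's inequality with the l1 norm of the observable's coefficients; the
    factor 1/2^n is the one in \<open>stab_norm\<close>.\<close>
  have stab: "1 / 2^n * (\<Sum>a\<in>labels n. ?h a * x a) \<le> stab_norm n Obs * m"
    if "\<And>a. a \<in> labels n \<Longrightarrow> x a \<le> m" for x m
    unfolding stab_norm_def mult.assoc sum_distrib_right using that
    by (intro mult_left_mono sum_mono) auto
  have stab0: "0 \<le> stab_norm n Obs" by (simp add: stab_norm_def sum_nonneg)
  let ?dia = "\<lambda>a. diamond_norm ?d (\<lambda>C. C - ?avg a C)"
  have 1: "bias n G p \<Lambda> Obs \<rho> \<le> stab_norm n Obs * (MAX a\<in>labels n. ?dia a)"
  proof (rule order.trans[OF bias stab])
    fix a assume a: "a \<in> labels n"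
    have l: "linear_sop ?d (\<lambda>C. C - ?avg a C)"
      by (intro linear_sop_diff_id avg_channel_linear G(2) lin)
    have "trace (pauli a * D) = trace (pauli a * (\<rho> - ?avg a \<rho>))"
      unfolding trD[OF a] using pauli_carrier[OF a] rc avg_channel_carrier[of n G p \<Lambda> a \<rho>]
      by (simp add: mult_minus_distrib_mat[of _ ?d ?d _ ?d] trace_minus[of _ ?d])
    hence "cmod (trace (pauli a * D)) \<le> ?dia a"
      using cmod_trace_le_diamond_norm[OF l \<rho> pauli_unitary[OF a]] by simp
    also have "\<dots> \<le> (MAX a\<in>labels n. ?dia a)" using a by (intro Max_ge) auto
    finally show "cmod (trace (pauli a * D)) \<le> (MAX a\<in>labels n. ?dia a)" .
  qed
  have "(MAX a\<in>labels n. ?dia a) \<le> (SUP g\<in>clifford n. diamond_norm ?d (\<lambda>C. C - \<Lambda> g C))"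
  proof (rule Max.boundedI)
    fix x assume "x \<in> ?dia ` labels n"
    then obtain a where a: "a \<in> labels n" "x = ?dia a" by blast
    show "x \<le> (SUP g\<in>clifford n. diamond_norm ?d (\<lambda>C. C - \<Lambda> g C))"
      unfolding a(2) using G
      by (intro diamond_norm_avg_le G(2) lin p(1) s a(1) cSUP_upper diamond_norm_channels_bdd chan) auto
  qed auto
  hence 2: "stab_norm n Obs * (MAX a\<in>labels n. ?dia a) \<le> stab_norm n Obs * (SUP g\<in>clifford n. diamond_norm ?d (\<lambda>C. C - \<Lambda> g C))"
    by (rule mult_left_mono[OF _ stab0])
  have 3: "bias n G p \<Lambda> Obs \<rho> \<le> min (hs_norm Obs) (stab_norm n Obs) * (MAX a\<in>labels n. cmod (1 - avg_eig n G p \<Lambda> a))"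
    if P: "\<forall>g\<in>clifford n. pauli_channel n (\<Lambda> g)"
  proof -
    define m where "m = (MAX a\<in>labels n. cmod (1 - avg_eig n G p \<Lambda> a))"
    have m: "cmod (1 - avg_eig n G p \<Lambda> a) \<le> m" if "a \<in> labels n" for a
      unfolding m_def using that by (intro Max_ge) auto
    \<comment> \<open>The maximum runs over a non-empty set of norms.\<close>
    have m0: "0 \<le> m"
    proof -
      obtain a where "a \<in> labels n" using labels_nonempty by blast
      thus ?thesis using order.trans[OF norm_ge_zero m] by blast
    qed
    let ?r = "\<lambda>a. cmod (trace (pauli a * \<rho>))"
    have tn: "trace_norm \<rho> = 1" using trace_norm_psd[OF psd] tr1 by simp
    have D: "cmod (trace (pauli a * D)) \<le> m * ?r a" if a: "a \<in> labels n" for a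
    proof -
      have "trace (pauli a * ?avg a \<rho>) = avg_eig n G p \<Lambda> a * trace (pauli a * \<rho>)"
      proof -
        have eig: "trace (pauli a * \<Lambda> g \<rho>) = pauli_eig (\<Lambda> g) a * trace (pauli a * \<rho>)" if "g \<in> G" for g
          using P G that a rc by (intro pauli_channel_eig) auto
        have "trace (pauli a * ?avg a \<rho>) = inverse (of_real (?s a)) *
            (\<Sum>z\<in>bitstrings n. \<Sum>g\<in>{g\<in>G. Xi n z g = a}. of_real (p g) * trace (pauli a * \<Lambda> g \<rho>))"
          by (rule trace_pauli_avg_channel[OF G(2) _ a]) (rule \<Lambda>\<rho>)
        also have "\<dots> = inverse (of_real (?s a)) *
            (\<Sum>z\<in>bitstrings n. \<Sum>g\<in>{g\<in>G. Xi n z g = a}. of_real (p g) * pauli_eig (\<Lambda> g) a * trace (pauli a * \<rho>))"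
          by (simp add: eig mult.assoc)
        finally show ?thesis by (simp add: avg_eig_def sum_distrib_right mult.assoc)
      qed
      hence "trace (pauli a * D) = (1 - avg_eig n G p \<Lambda> a) * trace (pauli a * \<rho>)"
        by (simp add: trD[OF a] algebra_simps)
      thus ?thesis using m[OF a] by (simp add: norm_mult mult_right_mono)
    qed
    have "bias n G p \<Lambda> Obs \<rho> \<le> stab_norm n Obs * m"
    proof (rule order.trans[OF bias stab])
      fix a assume a: "a \<in> labels n"
      \<comment> \<open>Pauli coefficients of a state have modulus at most one, since Pauli matrices
        are unitary and the state has trace norm one.\<close>
      have "m * ?r a \<le> m * 1"
        using cmod_trace_mult_le[OF unitary_contraction[OF pauli_unitary[OF a]] rc] m0 tn by (intro mult_left_mono) auto
      thus "cmod (trace (pauli a * D)) \<le> m" using D[OF a] by simp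
    qed
    moreover have "bias n G p \<Lambda> Obs \<rho> \<le> hs_norm Obs * m"
    proof -
      have hO: "(\<Sum>a\<in>labels n. (?h a)\<^sup>2) = 2^n * Re (hs_inner Obs Obs)"
        using pauli_parseval[OF O(1)] by (simp add: hs_inner_def)
      \<comment> \<open>Parseval for the state, with its purity bounded by one.\<close>
      have hr: "(\<Sum>a\<in>labels n. (?r a)\<^sup>2) \<le> 2^n"
        using hs_inner_le_trace_norm(2)[OF rc] by (simp add: pauli_parseval[OF rc] tn)
      have "(\<Sum>a\<in>labels n. ?h a * cmod (trace (pauli a * D))) \<le> (\<Sum>a\<in>labels n. m * (\<bar>?h a\<bar> * \<bar>?r a\<bar>))"
        using D by (intro sum_mono) (auto simp: mult.left_commute[of m] intro!: mult_left_mono)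
      also have "\<dots> = m * (\<Sum>a\<in>labels n. \<bar>?h a\<bar> * \<bar>?r a\<bar>)" by (simp add: sum_distrib_left)
      also have "\<dots> \<le> m * (L2_set ?h (labels n) * L2_set ?r (labels n))"
        by (intro mult_left_mono L2_set_mult_ineq m0)
      also have "\<dots> \<le> m * (L2_set ?h (labels n) * sqrt (2^n))"
        using hr m0 by (intro mult_left_mono) (auto simp: L2_set_def sum_nonneg)
      \<comment> \<open>Parseval for the observable contributes the second factor sqrt(2^n);
        together they cancel the prefactor 1/2^n of the bias bound.\<close>
      also have "\<dots> = m * (hs_norm Obs * 2^n)"
        by (simp add: L2_set_def hO hs_norm_def real_sqrt_mult)
      finally have "1 / 2^n * (\<Sum>a\<in>labels n. ?h a * cmod (trace (pauli a * D))) \<le> 1 / 2^n * (m * (hs_norm Obs * 2^n))"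
        by (intro mult_left_mono) auto
      thus ?thesis using bias by (simp add: mult.commute)
    qed
    ultimately show ?thesis unfolding m_def[symmetric] min_def by simp
  qed
  show ?thesis using 1 2 3 by blast
qed

end
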